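(* Let $n\ge 1$ be an integer and $0<\rho<1$. Suppose that $X_1,\ldots,X_n$ are independent random variables with finite fourth moments, such that $\mathbb{E}X_j=0$ and $\mathbb{E}X_j^2=1$ for $j=1,\ldots,n$. Denote $$\delta=\left(\frac1n\sum_{j=1}^n\mathbb{E}X_j^4\right)^{1/4}.$$ Then there exists a subset $\mathcal{F}\subseteq S^{n-1}$ with $\sigma_{n-1}(\mathcal{F})\ge 1-\rho$ for which the following holds: for any $\theta=(\theta_1,\ldots,\theta_n)\in\mathcal{F}$, $$\sup_{\alpha,\beta\in\mathbb{R},\ \alpha<\beta}\left|\mathbb{P}\left(\alpha\le\sum_{j=1}^n\theta_jX_j\le\beta\right)-\frac{1}{\sqrt{2\pi}}\int_\alpha^\beta e^{-t^2/2}\,dt\right|\le\frac{C(\rho)\,\delta^4}{n},$$ where $C(\rho)$ is a constant depending solely on $\rho$. In fact, $C(\rho)\le C\log^2(1/\rho)$, where $C>0$ is a universal constant.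
   Context: $S^{n-1}=\{x\in\mathbb{R}^n:\sum_i x_i^2=1\}$ is the Euclidean unit sphere and $\sigma_{n-1}$ is the unique rotationally invariant probability measure on it. The random variables are real-valued.
   Formalization: The bound C(ρ) ≤ C log²(1/ρ) fails as ρ→1 (n=1, X₁=±1 symmetric forces C(ρ) ≥ 1/2); it is proved as C(ρ) ≤ C·max(1, log(1/ρ))², the same for ρ ≤ 1/e and giving the original form on (0,ρ₀] for each fixed ρ₀<1. *)

theory Defs
  imports "HOL-Probability.Probability"
begin

text \<open>
  Since the constants must not depend on the dimension \<open>n\<close>, vectors of \<open>\<real>\<^sup>n\<close> are represented as
  functions \<open>nat \<Rightarrow> real\<close> that are extensional on the index set \<open>{1..n}\<close>.
\<close>

definition unit_sphere :: "nat \<Rightarrow> (nat \<Rightarrow> real) set" where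
  "unit_sphere n = {x \<in> {1..n} \<rightarrow>\<^sub>E UNIV. (\<Sum>i=1..n. (x i)\<^sup>2) = 1}"

definition orthogonal_matrix :: "nat \<Rightarrow> (nat \<Rightarrow> nat \<Rightarrow> real) \<Rightarrow> bool" where
  "orthogonal_matrix n Q \<longleftrightarrow>
     (\<forall>i\<in>{1..n}. \<forall>k\<in>{1..n}. (\<Sum>j=1..n. Q i j * Q k j) = (if i = k then 1 else 0))"

definition apply_matrix :: "nat \<Rightarrow> (nat \<Rightarrow> nat \<Rightarrow> real) \<Rightarrow> (nat \<Rightarrow> real) \<Rightarrow> (nat \<Rightarrow> real)" where
  "apply_matrix n Q x = (\<lambda>i\<in>{1..n}. \<Sum>j=1..n. Q i j * x j)"

text \<open>
  Borel probability measures on the sphere that are invariant under the full orthogonal group.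
  Allowing determinant \<open>-1\<close> matters only for \<open>n = 1\<close>, where the sphere is \<open>{-1, 1}\<close> and the
  special orthogonal group is trivial, so that it would not determine the measure.
\<close>

definition rotation_invariant_prob :: "nat \<Rightarrow> (nat \<Rightarrow> real) measure \<Rightarrow> bool" where
  "rotation_invariant_prob n \<sigma> \<longleftrightarrow>
     prob_space \<sigma> \<and>
     sets \<sigma> = sets (restrict_space (\<Pi>\<^sub>M i\<in>{1..n}. borel) (unit_sphere n)) \<and>
     (\<forall>Q. orthogonal_matrix n Q \<longrightarrow> distr \<sigma> \<sigma> (apply_matrix n Q) = \<sigma>)"

definition sphere_measure :: "nat \<Rightarrow> (nat \<Rightarrow> real) measure" where
  "sphere_measure n = (THE \<sigma>. rotation_invariant_prob n \<sigma>)"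

definition normalized_independent ::
    "'a measure \<Rightarrow> nat \<Rightarrow> (nat \<Rightarrow> 'a \<Rightarrow> real) \<Rightarrow> bool" where
  "normalized_independent M n X \<longleftrightarrow>
     prob_space M \<and>
     prob_space.indep_vars M (\<lambda>_. borel) X {1..n} \<and>
     (\<forall>j\<in>{1..n}. integrable M (\<lambda>\<omega>. X j \<omega> ^ 4) \<and>
        (LINT \<omega>|M. X j \<omega>) = 0 \<and> (LINT \<omega>|M. (X j \<omega>)\<^sup>2) = 1)"

definition moment_delta :: "'a measure \<Rightarrow> nat \<Rightarrow> (nat \<Rightarrow> 'a \<Rightarrow> real) \<Rightarrow> real" where
  "moment_delta M n X = (1 / real n * (\<Sum>j=1..n. LINT \<omega>|M. X j \<omega> ^ 4)) powr (1 / 4)"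

text \<open>The set under the supremum is bounded by \<open>1\<close>, so the supremum in \<open>real\<close> is the true one.\<close>

definition normal_discrepancy ::
    "'a measure \<Rightarrow> nat \<Rightarrow> (nat \<Rightarrow> 'a \<Rightarrow> real) \<Rightarrow> (nat \<Rightarrow> real) \<Rightarrow> real" where
  "normal_discrepancy M n X \<theta> =
     (SUP (\<alpha>, \<beta>)\<in>{(\<alpha>, \<beta>). \<alpha> < \<beta>}.
        \<bar>measure M {\<omega> \<in> space M. \<alpha> \<le> (\<Sum>j=1..n. \<theta> j * X j \<omega>) \<and> (\<Sum>j=1..n. \<theta> j * X j \<omega>) \<le> \<beta>}
         - 1 / sqrt (2 * pi) * (LBINT t:{\<alpha>..\<beta>}. exp (- t\<^sup>2 / 2))\<bar>)"

text \<open>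
  \<open>K \<rho>\<close> can serve as the constant \<open>C(\<rho>)\<close> for all \<open>n\<close> and all random variables whose sample space
  has type \<open>'a\<close>. The type is a parameter because HOL cannot quantify over types within a formula.
\<close>

definition admissible_constant :: "'a itself \<Rightarrow> (real \<Rightarrow> real) \<Rightarrow> bool" where
  "admissible_constant _ K \<longleftrightarrow>
     (\<forall>(n::nat) (\<rho>::real) (M::'a measure) X.
        1 \<le> n \<longrightarrow> 0 < \<rho> \<longrightarrow> \<rho> < 1 \<longrightarrow> normalized_independent M n X \<longrightarrow>
        (\<exists>F. F \<subseteq> unit_sphere n \<and> F \<in> sets (sphere_measure n) \<and>
             measure (sphere_measure n) F \<ge> 1 - \<rho> \<and>
             (\<forall>\<theta>\<in>F. normal_discrepancy M n X \<theta> \<le> K \<rho> * moment_delta M n X ^ 4 / real n)))"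

text \<open>
  The theorem has two conjuncts. The constants are chosen for the sample space type \<open>nat \<Rightarrow> real\<close>,
  on which every joint law of real random variables is realised; the second conjunct says that the
  same constants then work for every sample space. Asserting existence for a free type \<open>'a\<close> alone
  would let the constants depend on \<open>'a\<close>.

  The bound \<open>C(\<rho>) \<le> C log\<^sup>2(1/\<rho>)\<close> concerns small \<open>\<rho>\<close> and cannot hold as \<open>\<rho>\<close> tends to \<open>1\<close>: for
  \<open>n = 1\<close> and a symmetric sign \<open>X\<^sub>1\<close> one has \<open>\<delta> = 1\<close> and a discrepancy of at least \<open>1/2\<close> for both
  \<open>\<theta>\<close>, whence \<open>C(\<rho>) \<ge> 1/2\<close> for all \<open>\<rho> < 1\<close>. The logarithm is therefore replaced by its maximum
  with \<open>1\<close>, which changes nothing for \<open>\<rho> \<le> 1/e\<close>. For any fixed \<open>\<rho>\<^sub>0 < 1\<close> this yields the original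
  form on \<open>0 < \<rho> \<le> \<rho>\<^sub>0\<close>, with \<open>C\<close> depending on \<open>\<rho>\<^sub>0\<close>.
\<close>

end

(*
  By Esseen smoothing with a Gaussian of variance 1/N^2, where N = n / delta^4, it suffices to bound
  the integral of |phi(t) - exp(-t^2/2)| exp(-t^2/(2 N^2)) / |t| by a multiple of log^2(1/rho) / N,
  where phi(t) is the product of the characteristic functions of X_j at theta_j t. The range is
  split at |t| = R = sqrt N / 40.

  For |t| <= R the difference is at most exp(-c t^2) (t^4 sum theta_j^4 E X_j^4 + |t|^3 |sum theta_j^3 E X_j^3|):
  a Taylor expansion if t^4 sum theta_j^4 E X_j^4 <= 1, and Gaussian decay of |phi| otherwise; the
  latter comes from the coordinates where neither theta_j nor E X_j^4 is unusually large, which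
  carry a fixed part of the norm of theta. For |t| >= R one averages |phi| over theta.

  A uniform point of the sphere is a normalised Gaussian vector g, so the required properties of
  theta reduce to tail bounds for g, each with failure probability exp(-p), p ~ log(1/rho). The
  fourth order sum is controlled by its p-th moment and the third order sum by a self-normalised
  exponential bound; both are of order p^2 / N. If N is smaller than a multiple of log^2(1/rho),
  there is nothing to prove.

  That the sphere carries exactly one rotation invariant probability measure, the law of g / |g|, is
  derived from the fact that characteristic functions determine finite product laws.
*)
theory Submission
  imports Defs
begin

text \<open>A fixed direction such as n^(-1/2) (1, ..., 1) gives in general only an error of order
  N^(-1/2): third order terms add up, and lattice laws have large atoms. For a random direction the
  signs of \<theta>_j^3 cancel, and the sum of \<theta>_j^3 E X_j^3 has the size of (sum
  \<theta>_j^6 (E X_j^3)^2)^(1/2), at most about \<delta>^2 / n. Absolute values would destroy this,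
  so the cubic terms stay in the exponent until they have been summed. The price of the
  self-normalised bound is a compensator, which is controlled by a moment of the sum of sixth
  powers.

  The cut-off of order N^(1/2) is the range of the pointwise decay: the bound for one factor needs
  \<theta>_j^2 E X_j^4 t^2 <= 1/2, with \<theta>_j^2 of order 1/n and E X_j^4 of order \<delta>^4 in
  typical coordinates. Beyond it, averaging gains exp (- c N), which outweighs every polynomial
  loss, including the one caused by the smoothing scale 1/N.\<close>

declare One_nat_def [simp del]

abbreviation std_gauss :: "real measure" where
  "std_gauss \<equiv> std_normal_distribution"

abbreviation borel_PiM :: "nat \<Rightarrow> (nat \<Rightarrow> real) measure" where
  "borel_PiM n \<equiv> PiM {1..n} (\<lambda>_. borel)"

lemmas LINT_cong = Bochner_Integration.integral_cong

section \<open>Uniqueness for characteristic functions in several variables\<close>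

text \<open>After division by the common mass \<open>m\<close>, the measures with density
  \<open>u / m\<close> have probability laws under \<open>f\<close>, whose characteristic functions
  agree by hypothesis; one-dimensional Levy uniqueness applies. The frequency t = 0 shows that the
  two masses coincide, and for \<open>m = 0\<close> both sides vanish.\<close>

lemma weighted_law_unique:
  fixes f u :: "'a \<Rightarrow> real"
  assumes "finite_measure \<mu>" "finite_measure \<nu>" and sets_eq: "sets \<mu> = sets \<nu>"
    and f: "f \<in> borel_measurable \<nu>" and u: "u \<in> borel_measurable \<nu>"
    and bound: "\<And>x. 0 \<le> u x" "\<And>x. u x \<le> c"
    and eq: "\<And>t. (LINT x|\<mu>. u x *\<^sub>R iexp (t * f x)) = (LINT x|\<nu>. u x *\<^sub>R iexp (t * f x))"
    and B[measurable]: "B \<in> sets borel"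
  shows "(LINT x|\<mu>. indicator B (f x) * u x) = (LINT x|\<nu>. indicator B (f x) * u x)"
proof -
  note [measurable_cong] = sets_eq
  have [measurable]: "f \<in> borel_measurable \<mu>" "f \<in> borel_measurable \<nu>"
      "u \<in> borel_measurable \<mu>" "u \<in> borel_measurable \<nu>"
    using f u by (auto cong: measurable_cong_sets[OF sets_eq refl])
  have int: "integrable M u" "integrable M (\<lambda>x. indicator B (f x) * u x)"
    if "M \<in> {\<mu>, \<nu>}" for M
  proof -
    interpret finite_measure M using assms that by auto
    have [measurable]: "f \<in> borel_measurable M" "u \<in> borel_measurable M" using that by auto
    show "integrable M u"
      by (rule integrable_const_bound[where B = c]) (use bound in auto)
    show "integrable M (\<lambda>x. indicator B (f x) * u x)"
      by (rule Bochner_Integration.integrable_bound[OF \<open>integrable M u\<close>])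
        (use bound in \<open>auto simp: indicator_def\<close>)
  qed
  define m where "m = (LINT x|\<mu>. u x)"
  have m2: "m = (LINT x|\<nu>. u x)"
    using eq[of 0] by (simp add: m_def scaleR_conv_of_real)
  have m0: "0 \<le> m" unfolding m_def using bound by (intro integral_nonneg_AE) auto
  show ?thesis
  proof (cases "m = 0")
    case True
    have "(LINT x|M. indicator B (f x) * u x) = 0" if "M \<in> {\<mu>, \<nu>}" for M
    proof (rule antisym)
      have "(LINT x|M. indicator B (f x) * u x) \<le> (LINT x|M. u x)"
        using int[OF that] by (intro integral_mono) (use bound in \<open>auto simp: indicator_def\<close>)
      also have "\<dots> = 0" using that True m2 m_def by auto
      finally show "(LINT x|M. indicator B (f x) * u x) \<le> 0" .
    qed (use bound in \<open>auto intro!: integral_nonneg_AE\<close>)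
    then show ?thesis by auto
  next
    case False
    then have mpos: "m > 0" using m0 by simp
    define D where "D M = distr (density M (\<lambda>x. u x / m)) borel f" for M
    have real: "real_distribution (D M)"
      and char: "char (D M) t = (LINT x|M. u x *\<^sub>R iexp (t * f x)) / m"
      and mB: "measure (D M) B = (LINT x|M. indicator B (f x) * u x) / m"
      if M: "M \<in> {\<mu>, \<nu>}" for M t
    proof -
      have [measurable]: "f \<in> borel_measurable M" "u \<in> borel_measurable M" using that by auto
      have "emeasure (density M (\<lambda>x. u x / m)) (space (density M (\<lambda>x. u x / m))) = 1"
      proof -
        have "(\<integral>\<^sup>+x. u x / m \<partial>M) = ennreal (LINT x|M. u x / m)"
          using bound mpos int[OF M] by (intro nn_integral_eq_integral) (auto)
        also have "\<dots> = 1" using M m2 m_def mpos by auto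
        finally show ?thesis by (simp add: emeasure_density cong: nn_integral_cong)
      qed
      then interpret P: prob_space "density M (\<lambda>x. u x / m)" by (rule prob_spaceI)
      show r: "real_distribution (D M)" unfolding D_def by (intro P.real_distribution_distr) simp
      show "char (D M) t = (LINT x|M. u x *\<^sub>R iexp (t * f x)) / m"
        unfolding char_def D_def
        apply (subst integral_distr)
          apply (simp_all)
        apply (subst integral_density)
        using bound mpos by (auto simp: scaleR_conv_of_real)
      interpret r: real_distribution "D M" by fact
      have "measure (D M) B = (LINT x|D M. indicator B x)" by (simp add: r.emeasure_eq_measure)
      also have "\<dots> = (LINT x|M. indicator B (f x) * u x) / m"
        unfolding D_def
        apply (subst integral_distr)
          apply (simp_all)
        apply (subst integral_density)
        using bound mpos by (auto simp: mult.commute)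
      finally show "measure (D M) B = (LINT x|M. indicator B (f x) * u x) / m" .
    qed
    have "D \<mu> = D \<nu>"
      by (intro Levy_uniqueness real ext) (simp_all only: char eq insertI1 insertI2 simp_thms)
    then show ?thesis using mB[of \<mu>] mB[of \<nu>] mpos by auto
  qed
qed

text \<open>
  The characters are exchanged for indicators one coordinate at a time. The one-dimensional
  uniqueness theorem needs positive weights, hence \<open>1 + cos\<close> and \<open>1 + sin\<close> instead of the complex
  exponential in the remaining coordinates.
\<close>

lemma PiM_borel_eqI_char:
  fixes \<mu> \<nu> :: "('i \<Rightarrow> real) measure"
  assumes fin: "finite I" and "prob_space \<mu>" "prob_space \<nu>"
    and s\<mu>: "sets \<mu> = sets (PiM I (\<lambda>_. borel))" and s\<nu>: "sets \<nu> = sets (PiM I (\<lambda>_. borel))"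
    and char_eq: "\<And>y. (LINT x|\<mu>. iexp (\<Sum>i\<in>I. y i * x i)) = (LINT x|\<nu>. iexp (\<Sum>i\<in>I. y i * x i))"
  shows "\<mu> = \<nu>"
proof -
  interpret \<mu>: prob_space \<mu> by fact
  interpret \<nu>: prob_space \<nu> by fact
  note [measurable_cong] = s\<mu> s\<nu>
  define ip where "ip y x = (\<Sum>i\<in>I. y i * x i)" for y x :: "'i \<Rightarrow> real"
  have [measurable]: "ip y \<in> borel_measurable (PiM I (\<lambda>_. borel))" for y
    unfolding ip_def by measurable
  \<comment> \<open>The frequency y is left arbitrary because the induction step uses the shifted
    frequencies \<open>e t i + y i\<close> and \<open>e t i + - y i\<close>.\<close>
  have claim: "(LINT x|\<mu>. (\<Prod>j\<in>K. indicator (A j) (x j) :: real) *\<^sub>R iexp (ip y x))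
      = (LINT x|\<nu>. (\<Prod>j\<in>K. indicator (A j) (x j) :: real) *\<^sub>R iexp (ip y x))"
    if "finite K" "K \<subseteq> I" and A: "\<And>i. A i \<in> sets borel" for y :: "'i \<Rightarrow> real" and K :: "'i set" and A :: "'i \<Rightarrow> real set"
    using that(1,2)
  proof (induction K arbitrary: y)
    case empty
    then show ?case using char_eq by (simp add: ip_def)
  next
    case (insert k K)
    define w where "w x = (\<Prod>j\<in>K. indicator (A j) (x j) :: real)" for x
    have w01: "0 \<le> w x" "w x \<le> 1" for x
      unfolding w_def by (auto intro!: prod_nonneg prod_le_1)
    have kI: "k \<in> I" and KI: "K \<subseteq> I" using insert.prems by auto
    note A[measurable]
    have [measurable]: "w \<in> borel_measurable (PiM I (\<lambda>_. borel))"
      unfolding w_def by (intro borel_measurable_prod) (use KI in auto)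
    note [measurable] = kI
    have IH: "(LINT x|\<mu>. w x *\<^sub>R iexp (ip z x)) = (LINT x|\<nu>. w x *\<^sub>R iexp (ip z x))" for z
      using insert.IH[OF KI] by (simp add: w_def)
    define e where "e t i = (if i = k then t else 0 :: real)" for t i
    have ipe: "ip (e t) x = t * x k" for t x
      using kI fin by (simp add: ip_def e_def if_distrib[of "\<lambda>z. z * _"] cong: if_cong)
    have ipadd: "ip (\<lambda>i. y i + z i) x = ip y x + ip z x" for y z x
      by (simp add: ip_def algebra_simps sum.distrib)
    have ipneg: "ip (\<lambda>i. - y i) x = - ip y x" for y x
      by (simp add: ip_def sum_negf)
    have int: "integrable M (\<lambda>x. w x *\<^sub>R iexp (ip z x))" if "M \<in> {\<mu>, \<nu>}" for M z
    proof -
      interpret prob_space M using that \<mu>.prob_space_axioms \<nu>.prob_space_axioms by auto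
      have [measurable_cong]: "sets M = sets (PiM I (\<lambda>_. borel))" using that s\<mu> s\<nu> by auto
      show ?thesis
        by (rule integrable_const_bound[where B = 1]) (use w01 in auto)
    qed
    \<comment> \<open>Writing the cosine as two exponentials turns a positive weight times a
      character into a combination of three characters, to which the induction hypothesis
      applies.\<close>
    have trig: "(v * (1 + cos (s - a))) *\<^sub>R iexp r =
        v *\<^sub>R iexp r + (iexp (- a) * (v *\<^sub>R iexp (r + s)) + iexp a * (v *\<^sub>R iexp (r + - s))) / 2" for a s r v
      by (auto simp: complex_eq_iff Re_exp Im_exp cos_add sin_add cos_diff sin_diff algebra_simps)
    have one: "(LINT x|M. (w x) *\<^sub>R iexp (t * x k)) = (LINT x|M. w x *\<^sub>R iexp (ip (e t) x))" for t M
      by (simp add: ipe)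
    have lin3: "(LINT x|M. f x + (c * g x + d * h x) / 2) = (LINT x|M. f x) + (c * (LINT x|M. g x) + d * (LINT x|M. h x)) / 2"
      if "integrable M f" "integrable M g" "integrable M h"
      for M and f g h :: "('i \<Rightarrow> real) \<Rightarrow> complex" and c d
      using that by simp
    have cs: "(LINT x|M. (w x * (1 + cos (ip y x - a))) *\<^sub>R iexp (t * x k)) =
        (LINT x|M. w x *\<^sub>R iexp (ip (e t) x)) +
        (iexp (- a) * (LINT x|M. w x *\<^sub>R iexp (ip (\<lambda>i. e t i + y i) x))
          + iexp a * (LINT x|M. w x *\<^sub>R iexp (ip (\<lambda>i. e t i + - y i) x))) / 2"
      if M: "M \<in> {\<mu>, \<nu>}" for t M a
    proof -
      have "(LINT x|M. (w x * (1 + cos (ip y x - a))) *\<^sub>R iexp (t * x k)) =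
         (LINT x|M. w x *\<^sub>R iexp (ip (e t) x) + (iexp (- a) * (w x *\<^sub>R iexp (ip (\<lambda>i. e t i + y i) x))
          + iexp a * (w x *\<^sub>R iexp (ip (\<lambda>i. e t i + - y i) x))) / 2)"
        unfolding ipe ipadd ipneg
        by (intro LINT_cong refl) (simp only: trig)
      also have "\<dots> = (LINT x|M. w x *\<^sub>R iexp (ip (e t) x)) +
        (iexp (- a) * (LINT x|M. w x *\<^sub>R iexp (ip (\<lambda>i. e t i + y i) x))
          + iexp a * (LINT x|M. w x *\<^sub>R iexp (ip (\<lambda>i. e t i + - y i) x))) / 2"
        by (rule lin3[OF int[OF M] int[OF M] int[OF M]])
      finally show ?thesis .
    qed
    have ge: "0 \<le> 1 + cos z" "1 + cos z \<le> 2" for z :: real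
      using cos_ge_minus_one[of z] cos_le_one[of z] by linarith+
    have le2: "w x * (1 + cos z) \<le> 2" for x z
      using mult_mono[OF w01(2)[of x] ge(2)[of z]] ge w01 by auto
    have eq1: "(LINT x|\<mu>. w x *\<^sub>R iexp (t * x k)) = (LINT x|\<nu>. w x *\<^sub>R iexp (t * x k))" for t
      by (simp only: one IH)
    have eq2: "(LINT x|\<mu>. (w x * (1 + cos (ip y x - a))) *\<^sub>R iexp (t * x k)) =
        (LINT x|\<nu>. (w x * (1 + cos (ip y x - a))) *\<^sub>R iexp (t * x k))" for t a
      by (subst (1 2) cs) (simp_all only: IH insertI1 insertI2 simp_thms)
    note unique = weighted_law_unique[OF \<mu>.finite_measure_axioms \<nu>.finite_measure_axioms]
    have E1: "(LINT x|\<mu>. indicator (A k) (x k) * w x) = (LINT x|\<nu>. indicator (A k) (x k) * w x)"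
      by (rule unique[OF _ _ _ _ _ eq1, where c = 1]) (use w01 in \<open>auto simp: s\<mu> s\<nu>\<close>)
    have E2: "(LINT x|\<mu>. indicator (A k) (x k) * (w x * (1 + cos (ip y x - a)))) =
        (LINT x|\<nu>. indicator (A k) (x k) * (w x * (1 + cos (ip y x - a))))" for a
      by (rule unique[OF _ _ _ _ _ eq2, where c = 2]) (use w01 le2 ge in \<open>auto simp: s\<mu> s\<nu>\<close>)
    \<comment> \<open>The phases 0 and pi / 2 give the weights 1 + cos and 1 + sin; subtracting the
      plain weight \<open>w\<close> leaves the real and imaginary parts of
      \<open>iexp (ip y x)\<close>.\<close>
    have comb: "(LINT x|M. (\<Prod>j\<in>insert k K. indicator (A j) (x j) :: real) *\<^sub>R iexp (ip y x)) =
        complex_of_real ((LINT x|M. indicator (A k) (x k) * (w x * (1 + cos (ip y x - 0)))) -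
            (LINT x|M. indicator (A k) (x k) * w x)) +
        \<i> * complex_of_real ((LINT x|M. indicator (A k) (x k) * (w x * (1 + cos (ip y x - pi / 2)))) -
            (LINT x|M. indicator (A k) (x k) * w x))" if "M \<in> {\<mu>, \<nu>}" for M
    proof -
      interpret prob_space M using that \<mu>.prob_space_axioms \<nu>.prob_space_axioms by auto
      have [measurable_cong]: "sets M = sets (PiM I (\<lambda>_. borel))" using that s\<mu> s\<nu> by auto
      have lin: "(LINT x|M. complex_of_real (a x - c x) + \<i> * complex_of_real (b x - c x)) =
          complex_of_real ((LINT x|M. a x) - (LINT x|M. c x)) +
          \<i> * complex_of_real ((LINT x|M. b x) - (LINT x|M. c x))"
        if "integrable M a" "integrable M b" "integrable M c" for a b c :: "('i \<Rightarrow> real) \<Rightarrow> real"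
        using that by (simp del: of_real_diff)
      have i1: "integrable M (\<lambda>x. indicator (A k) (x k) * w x)"
        by (rule integrable_const_bound[where B = 1]) (use w01 in \<open>auto simp: indicator_def\<close>)
      have i2: "integrable M (\<lambda>x. indicator (A k) (x k) * (w x * (1 + cos (ip y x - a))))" for a
        by (rule integrable_const_bound[where B = 2])
          (use w01 le2 ge in \<open>auto simp: indicator_def\<close>)
      show ?thesis
        unfolding lin[OF i2 i2 i1, symmetric] using insert.hyps
        by (intro LINT_cong refl)
           (auto simp: w_def[symmetric] complex_eq_iff Re_exp Im_exp cos_diff algebra_simps)
    qed
    show ?case by (subst (1 2) comb) (simp_all only: E1 E2 insertI1 insertI2 simp_thms)
  qed
  show ?thesis
  proof (rule measure_eqI_PiM_finite[OF fin])
    show "sets \<mu> = sets (PiM I (\<lambda>_. borel))" "sets \<nu> = sets (PiM I (\<lambda>_. borel))" by fact+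
    fix A assume A: "\<And>i. i \<in> I \<Longrightarrow> A i \<in> sets (borel :: real measure)"
    \<comment> \<open>\<open>claim\<close> asks for Borel sets at every index, whereas A is
      constrained on I only.\<close>
    define A' where "A' i = (if i \<in> I then A i else {})" for i
    have A': "A' i \<in> sets borel" for i using A by (auto simp: A'_def)
    have PA: "Pi\<^sub>E I A = Pi\<^sub>E I A'" by (auto simp: A'_def PiE_def Pi_def)
    have "measure M (Pi\<^sub>E I A) = (LINT x|M. (\<Prod>j\<in>I. indicator (A' j) (x j) :: real))"
      if "M \<in> {\<mu>, \<nu>}" for M
    proof -
      interpret prob_space M using that \<mu>.prob_space_axioms \<nu>.prob_space_axioms by auto
      have [measurable_cong]: "sets M = sets (PiM I (\<lambda>_. borel))" using that s\<mu> s\<nu> by auto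
      have sp: "space M = space (PiM I (\<lambda>_. borel))" by (rule sets_eq_imp_space_eq) fact
      have [measurable]: "Pi\<^sub>E I A' \<in> sets M" using A' fin by (auto intro!: sets_PiM_I_finite)
      have "measure M (Pi\<^sub>E I A) = (LINT x|M. indicator (Pi\<^sub>E I A') x)" unfolding PA by simp
      also have "\<dots> = (LINT x|M. (\<Prod>j\<in>I. indicator (A' j) (x j) :: real))"
      proof (intro LINT_cong refl)
        fix x assume "x \<in> space M"
        then have "x \<in> extensional I" by (auto simp: sp space_PiM PiE_def)
        then show "indicator (Pi\<^sub>E I A') x = (\<Prod>j\<in>I. indicator (A' j) (x j) :: real)"
          using fin by (auto simp: indicator_def PiE_def Pi_def prod_zero_iff)
      qed
      finally show ?thesis .
    qed
    \<comment> \<open>At frequency 0 the character is 1, and \<open>claim\<close> compares the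
      probabilities of boxes.\<close>
    moreover have "complex_of_real (LINT x|\<mu>. (\<Prod>j\<in>I. indicator (A' j) (x j) :: real)) =
        complex_of_real (LINT x|\<nu>. (\<Prod>j\<in>I. indicator (A' j) (x j) :: real))"
      using claim[of I A' "\<lambda>_. 0", OF fin subset_refl A']
      by (simp add: ip_def scaleR_conv_of_real del: of_real_prod flip: integral_complex_of_real)
    ultimately show "emeasure \<mu> (Pi\<^sub>E I A) = emeasure \<nu> (Pi\<^sub>E I A)"
      by (simp add: \<mu>.emeasure_eq_measure \<nu>.emeasure_eq_measure)
  next
    show "range (\<lambda>_::nat. Pi\<^sub>E I (\<lambda>_. UNIV :: real set)) \<subseteq> prod_algebra I (\<lambda>_. borel)"
      using fin by (auto intro!: prod_algebraI_finite)
    show "(\<Union>i. (\<lambda>_::nat. Pi\<^sub>E I (\<lambda>_. UNIV :: real set)) i) = space (PiM I (\<lambda>_. borel))"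
      by (auto simp: space_PiM)
  qed (simp add: \<mu>.emeasure_eq_measure)
qed

section \<open>The rotation invariant measure on the sphere\<close>

text \<open>\<open>P = Q\<^sup>T Q\<close> is a symmetric idempotent of trace \<open>n\<close>, and its diagonal entries are at most \<open>1\<close>.\<close>

lemma orthogonal_matrix_columns:
  assumes Q: "orthogonal_matrix n Q" and jk: "j \<in> {1..n}" "k \<in> {1..n}"
  shows "(\<Sum>i=1..n. Q i j * Q i k) = (if j = k then 1 else 0)"
proof -
  define P where "P j k = (\<Sum>i=1..n. Q i j * Q i k)" for j k
  have rows: "(\<Sum>j=1..n. Q i j * Q k j) = (if i = k then 1 else 0)" if "i \<in> {1..n}" "k \<in> {1..n}" for i k
    using Q that by (auto simp: orthogonal_matrix_def)
  have idem: "(\<Sum>k=1..n. P j k * P l k) = P j l" for j l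
  proof -
    have "(\<Sum>k=1..n. P j k * P l k) = (\<Sum>k=1..n. \<Sum>i=1..n. \<Sum>i'=1..n. (Q i j * Q i' l) * (Q i k * Q i' k))"
      unfolding P_def sum_product by (intro sum.cong refl) (simp add: mult_ac)
    also have "\<dots> = (\<Sum>i=1..n. \<Sum>i'=1..n. \<Sum>k=1..n. (Q i j * Q i' l) * (Q i k * Q i' k))"
      by (rule trans[OF sum.swap sum.cong[OF refl sum.swap]])
    also have "\<dots> = (\<Sum>i=1..n. \<Sum>i'=1..n. (Q i j * Q i' l) * (if i = i' then 1 else 0))"
      unfolding sum_distrib_left[symmetric] by (intro sum.cong refl arg_cong2[where f = "(*)"] rows) auto
    also have "\<dots> = P j l" by (simp add: P_def if_distrib[of "\<lambda>z. _ * z"] cong: if_cong)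
    finally show ?thesis .
  qed
  have diag: "P j j = (P j j)^2 + (\<Sum>k\<in>{1..n}-{j}. (P j k)^2)" if "j \<in> {1..n}" for j
    using idem[of j j] that by (subst (asm) sum.remove[of _ j]) (auto simp: power2_eq_square)
  have le1: "P j j \<le> 1" if "j \<in> {1..n}" for j
  proof -
    have "(P j j)^2 \<le> P j j" using diag[OF that] sum_nonneg[of "{1..n}-{j}" "\<lambda>k. (P j k)^2"] by simp
    then show ?thesis
      using mult_strict_right_mono[of 1 "P j j" "P j j"] unfolding power2_eq_square by linarith
  qed
  have "(\<Sum>j=1..n. 1 - P j j) = real n - (\<Sum>j=1..n. \<Sum>i=1..n. Q i j * Q i j)"
    by (simp add: sum_subtractf P_def)
  also have "(\<Sum>j=1..n. \<Sum>i=1..n. Q i j * Q i j) = (\<Sum>i=1..n. 1)"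
    by (subst sum.swap) (intro sum.cong refl, subst rows, auto)
  finally have "(\<Sum>j=1..n. 1 - P j j) = 0" by simp
  then have P1: "P j j = 1" if "j \<in> {1..n}" for j
    using that le1 by (subst (asm) sum_nonneg_eq_0_iff) auto
  have "(\<Sum>k\<in>{1..n}-{j}. (P j k)^2) = 0" using diag[OF jk(1)] P1[OF jk(1)] by simp
  then have "j \<noteq> k \<Longrightarrow> P j k = 0" using jk by (subst (asm) sum_nonneg_eq_0_iff) auto
  then show ?thesis using P1[OF jk(1)] unfolding P_def by auto
qed

text \<open>Kept general in the array because it serves twice: for the transpose of an orthogonal
  matrix, whose columns are orthonormal by definition, and for the matrix itself, where
  \<open>orthogonal_matrix_columns\<close> is needed.\<close>

lemma sum_square_orthonormal:
  fixes A :: "'i \<Rightarrow> 'i \<Rightarrow> real"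
  assumes fin: "finite I"
    and "\<And>j k. j \<in> I \<Longrightarrow> k \<in> I \<Longrightarrow> (\<Sum>i\<in>I. A i j * A i k) = (if j = k then 1 else 0)"
  shows "(\<Sum>i\<in>I. (\<Sum>j\<in>I. A i j * x j)^2) = (\<Sum>j\<in>I. (x j)^2)"
proof -
  have "(\<Sum>i\<in>I. (\<Sum>j\<in>I. A i j * x j)^2) = (\<Sum>i\<in>I. \<Sum>j\<in>I. \<Sum>k\<in>I. (x j * x k) * (A i j * A i k))"
    unfolding power2_eq_square sum_product by (intro sum.cong refl) (simp add: mult_ac)
  also have "\<dots> = (\<Sum>j\<in>I. \<Sum>k\<in>I. \<Sum>i\<in>I. (x j * x k) * (A i j * A i k))"
    by (rule trans[OF sum.swap sum.cong[OF refl sum.swap]])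
  also have "\<dots> = (\<Sum>j\<in>I. \<Sum>k\<in>I. (x j * x k) * (if j = k then 1 else 0))"
    unfolding sum_distrib_left[symmetric] by (intro sum.cong refl arg_cong2[where f = "(*)"] assms)
  also have "\<dots> = (\<Sum>j\<in>I. (x j)^2)"
    using fin by (simp add: power2_eq_square if_distrib[of "\<lambda>z. _ * z"] cong: if_cong)
  finally show ?thesis .
qed

section \<open>Rotation invariance of the normalised Gaussian vector\<close>

abbreviation sphere_space :: "nat \<Rightarrow> (nat \<Rightarrow> real) measure" where
  "sphere_space n \<equiv> restrict_space (borel_PiM n) (unit_sphere n)"

abbreviation gaussian :: "nat \<Rightarrow> (nat \<Rightarrow> real) measure" where
  "gaussian n \<equiv> PiM {1..n} (\<lambda>_. std_gauss)"

lemma prob_space_std_normal: "prob_space std_gauss"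
  by (intro prob_space_normal_density) simp

interpretation std_normal: real_distribution std_gauss
  by (rule real_dist_normal_dist)

lemma prob_space_gaussian: "prob_space (gaussian n)"
  by (intro prob_space_PiM prob_space_std_normal)

lemma sets_gaussian[measurable_cong]: "sets (gaussian n) = sets (borel_PiM n)"
  by (intro sets_PiM_cong) auto

lemma gaussian_char:
  "(LINT x|gaussian n. iexp (\<Sum>i=1..n. y i * x i)) = exp (- (\<Sum>i=1..n. (y i)^2) / 2)"
proof -
  interpret G: product_sigma_finite "\<lambda>_::nat. std_gauss"
    by standard
  have "(LINT x|gaussian n. iexp (\<Sum>i=1..n. y i * x i)) =
      (LINT x|gaussian n. (\<Prod>i=1..n. iexp (y i * x i)))"
    by (intro LINT_cong refl) (simp add: sum_distrib_left flip: exp_sum)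
  also have "\<dots> = (\<Prod>i=1..n. LINT x|std_gauss. iexp (y i * x))"
    by (intro G.product_integral_prod std_normal.integrable_iexp) auto
  also have "\<dots> = (\<Prod>i=1..n. complex_of_real (exp (- (y i)\<^sup>2 / 2)))"
    using char_std_normal_distribution by (simp add: char_def fun_eq_iff)
  also have "\<dots> = exp (- (\<Sum>i=1..n. (y i)^2) / 2)"
    by (simp flip: exp_sum of_real_prod add: sum_negf sum_divide_distrib)
  finally show ?thesis .
qed

lemma apply_matrix_measurable:
  "apply_matrix n Q \<in> borel_PiM n \<rightarrow>\<^sub>M borel_PiM n"
  unfolding apply_matrix_def by measurable

lemma sum_apply_matrix:
  "(\<Sum>i=1..n. y i * apply_matrix n Q x i) = (\<Sum>j=1..n. (\<Sum>i=1..n. Q i j * y i) * x j)"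
proof -
  have "(\<Sum>i=1..n. y i * apply_matrix n Q x i) = (\<Sum>i=1..n. \<Sum>j=1..n. Q i j * y i * x j)"
    by (simp add: apply_matrix_def sum_distrib_left mult_ac)
  also have "\<dots> = (\<Sum>j=1..n. (\<Sum>i=1..n. Q i j * y i) * x j)"
    by (subst sum.swap) (simp add: sum_distrib_right)
  finally show ?thesis .
qed

text \<open>The image has at y the characteristic function of the Gaussian at Q^T y, and this
  depends on the norm alone.\<close>

lemma gaussian_orthogonal_invariant:
  assumes Q: "orthogonal_matrix n Q"
  shows "distr (gaussian n) (borel_PiM n) (apply_matrix n Q) = gaussian n"
proof -
  interpret G: prob_space "gaussian n" by (rule prob_space_gaussian)
  note [measurable] = apply_matrix_measurable[of n Q]
  show ?thesis
  proof (rule PiM_borel_eqI_char[OF _ G.prob_space_distr prob_space_gaussian])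
    fix y :: "nat \<Rightarrow> real"
    have "(LINT x|distr (gaussian n) (borel_PiM n) (apply_matrix n Q).
        iexp (\<Sum>i=1..n. y i * x i)) = (LINT x|gaussian n. iexp (\<Sum>j=1..n. (\<Sum>i=1..n. Q i j * y i) * x j))"
      by (subst integral_distr) (simp_all only: sum_apply_matrix, measurable)
    also have "\<dots> = exp (- (\<Sum>j=1..n. (\<Sum>i=1..n. Q i j * y i)^2) / 2)"
      by (rule gaussian_char)
    also have "(\<Sum>j=1..n. (\<Sum>i=1..n. Q i j * y i)^2) = (\<Sum>i=1..n. (y i)^2)"
      using Q by (intro sum_square_orthonormal[of _ "\<lambda>j i. Q i j"]) (auto simp: orthogonal_matrix_def)
    also have "complex_of_real (exp (- (\<Sum>i=1..n. (y i)^2) / 2)) = (LINT x|gaussian n. iexp (\<Sum>i=1..n. y i * x i))"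
      by (rule gaussian_char[symmetric])
    finally show "(LINT x|distr (gaussian n) (borel_PiM n) (apply_matrix n Q).
        iexp (\<Sum>i=1..n. y i * x i)) = (LINT x|gaussian n. iexp (\<Sum>i=1..n. y i * x i))" .
  qed (auto simp: sets_gaussian)
qed

text \<open>The zero vector, a null event under the Gaussian, is sent to the first unit vector, so
  that for n >= 1 the map takes all its values in the sphere.\<close>

definition normalise :: "nat \<Rightarrow> (nat \<Rightarrow> real) \<Rightarrow> nat \<Rightarrow> real" where
  "normalise n x = (\<lambda>i\<in>{1..n}. if (\<Sum>i=1..n. (x i)^2) = 0 then (if i = 1 then 1 else 0)
     else x i / sqrt (\<Sum>i=1..n. (x i)^2))"

lemma normalise_in_unit_sphere: "1 \<le> n \<Longrightarrow> normalise n x \<in> unit_sphere n"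
proof (cases "(\<Sum>i=1..n. (x i)^2) = 0")
  case True
  assume n: "1 \<le> n"
  have "(\<Sum>i=1..n. (normalise n x i)^2) = (\<Sum>i=1..n. if i = 1 then 1 else 0 :: real)"
    using True by (intro sum.cong refl) (auto simp: normalise_def)
  then show ?thesis using n by (auto simp: unit_sphere_def normalise_def)
next
  case False
  then have pos: "(\<Sum>i=1..n. (x i)^2) > 0"
    using sum_nonneg[of "{1..n}" "\<lambda>i. (x i)^2"] by (simp add: less_le)
  have "(\<Sum>i=1..n. (normalise n x i)^2) = (\<Sum>i=1..n. (x i)^2 / (\<Sum>i=1..n. (x i)^2))"
    using pos by (intro sum.cong refl) (simp add: normalise_def power_divide)
  then show ?thesis using pos by (auto simp: unit_sphere_def normalise_def simp flip: sum_divide_distrib)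
qed

lemma normalise_measurable:
  assumes "1 \<le> n"
  shows "normalise n \<in> borel_PiM n \<rightarrow>\<^sub>M sphere_space n"
proof (rule measurable_restrict_space2)
  show "normalise n \<in> space (Pi\<^sub>M {1..n} (\<lambda>_. borel)) \<rightarrow> unit_sphere n"
    using normalise_in_unit_sphere[OF assms] by auto
  show "normalise n \<in> borel_PiM n \<rightarrow>\<^sub>M borel_PiM n"
    unfolding normalise_def by measurable
qed

lemma sum_square_apply_matrix:
  assumes "orthogonal_matrix n Q"
  shows "(\<Sum>i=1..n. (apply_matrix n Q x i)^2) = (\<Sum>i=1..n. (x i)^2)"
proof -
  have "(\<Sum>i=1..n. (apply_matrix n Q x i)^2) = (\<Sum>i=1..n. (\<Sum>j=1..n. Q i j * x j)^2)"
    by (intro sum.cong refl) (simp add: apply_matrix_def)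
  also have "\<dots> = (\<Sum>i=1..n. (x i)^2)"
    by (intro sum_square_orthonormal orthogonal_matrix_columns[OF assms]) auto
  finally show ?thesis .
qed

lemma apply_matrix_in_unit_sphere:
  assumes "orthogonal_matrix n Q" "x \<in> unit_sphere n"
  shows "apply_matrix n Q x \<in> unit_sphere n"
proof -
  have "(\<Sum>i=1..n. (apply_matrix n Q x i)^2) = 1"
    using assms by (simp add: sum_square_apply_matrix unit_sphere_def)
  then show ?thesis by (simp add: unit_sphere_def apply_matrix_def)
qed

lemma apply_matrix_measurable_sphere:
  assumes "orthogonal_matrix n Q"
  shows "apply_matrix n Q \<in> sphere_space n \<rightarrow>\<^sub>M sphere_space n"
  using apply_matrix_in_unit_sphere[OF assms] apply_matrix_measurable[of n Q]
  by (intro measurable_restrict_space3) auto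

lemma AE_gaussian_nonzero:
  assumes n: "1 \<le> n"
  shows "AE x in gaussian n. (\<Sum>i=1..n. (x i)^2) \<noteq> 0"
proof -
  have "AE x in std_gauss. x \<noteq> 0"
    by (subst AE_density) (auto intro!: AE_I[of _ _ "{0}"])
  then have "AE x in gaussian n. x 1 \<noteq> 0"
    using n by (intro AE_PiM_component[of "{1..n}" "\<lambda>_. std_gauss" 1]) (auto intro: prob_space_std_normal)
  then show ?thesis
  proof (rule AE_mp, intro AE_I2 impI)
    fix x :: "nat \<Rightarrow> real" assume "x 1 \<noteq> 0"
    then show "(\<Sum>i=1..n. (x i)^2) \<noteq> 0"
      using n by (subst sum_nonneg_eq_0_iff) auto
  qed
qed

text \<open>Away from the zero vector, \<open>normalise\<close> commutes with every orthogonal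
  matrix, so the invariance of the Gaussian measure descends to the sphere.\<close>

lemma rotation_invariant_gaussian:
  assumes n: "1 \<le> n"
  shows "rotation_invariant_prob n (distr (gaussian n) (sphere_space n) (normalise n))"
    (is "rotation_invariant_prob n ?\<sigma>")
  unfolding rotation_invariant_prob_def
proof (intro conjI allI impI)
  interpret G: prob_space "gaussian n" by (rule prob_space_gaussian)
  have [measurable]: "normalise n \<in> borel_PiM n \<rightarrow>\<^sub>M sphere_space n"
    by (rule normalise_measurable[OF n])
  show "prob_space ?\<sigma>"
    by (rule G.prob_space_distr) measurable
  show "sets ?\<sigma> = sets (sphere_space n)" by simp
  fix Q assume Q: "orthogonal_matrix n Q"
  note [measurable] = apply_matrix_measurable[of n Q] apply_matrix_measurable_sphere[OF Q]
  have "distr ?\<sigma> ?\<sigma> (apply_matrix n Q) = distr ?\<sigma> (sphere_space n) (apply_matrix n Q)"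
    by (intro distr_cong) auto
  also have "\<dots> = distr (gaussian n) (sphere_space n) (apply_matrix n Q \<circ> normalise n)"
    by (rule distr_distr) measurable
  also have "\<dots> = distr (gaussian n) (sphere_space n) (normalise n \<circ> apply_matrix n Q)"
  proof (rule distr_cong_AE)
    show "AE x in gaussian n. (apply_matrix n Q \<circ> normalise n) x = (normalise n \<circ> apply_matrix n Q) x"
      using AE_gaussian_nonzero[OF n]
    proof (rule AE_mp, intro AE_I2 impI)
      fix x :: "nat \<Rightarrow> real" assume nz: "(\<Sum>i=1..n. (x i)^2) \<noteq> 0"
      note * = sum_square_apply_matrix[OF Q, of x]
      show "(apply_matrix n Q \<circ> normalise n) x = (normalise n \<circ> apply_matrix n Q) x"
        using nz unfolding o_def normalise_def *
        by (auto simp: apply_matrix_def fun_eq_iff sum_divide_distrib)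
    qed
  qed (auto intro!: measurable_comp)
  also have "\<dots> = distr (distr (gaussian n) (borel_PiM n) (apply_matrix n Q)) (sphere_space n) (normalise n)"
    by (rule distr_distr[symmetric]) measurable
  also have "\<dots> = ?\<sigma>" unfolding gaussian_orthogonal_invariant[OF Q] ..
  finally show "distr ?\<sigma> ?\<sigma> (apply_matrix n Q) = ?\<sigma>" .
qed

section \<open>Uniqueness of the rotation invariant measure\<close>

lemma householder_reflection:
  assumes u: "u \<in> unit_sphere n" and v: "v \<in> unit_sphere n"
  obtains Q where "orthogonal_matrix n Q" "\<And>j. j \<in> {1..n} \<Longrightarrow> (\<Sum>i=1..n. Q i j * v i) = u j"
proof (cases "u = v")
  case True
  have "orthogonal_matrix n (\<lambda>i j. if i = j then 1 else 0)"
    by (auto simp: orthogonal_matrix_def if_distrib[of "\<lambda>z. z * _"] cong: if_cong)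
  then show ?thesis
    by (rule that) (use True in \<open>auto simp: if_distrib[of "\<lambda>z. z * _"] cong: if_cong\<close>)
next
  case False
  define d where "d i = u i - v i" for i
  define D where "D = (\<Sum>i=1..n. (d i)^2)"
  \<comment> \<open>The reflection in the hyperplane orthogonal to d = u - v; it exchanges u and v
    because they have the same norm.\<close>
  define Q where "Q i j = (if i = j then 1 else 0) - 2 * d i * d j / D" for i j
  have "D \<noteq> 0"
  proof
    assume "D = 0"
    then have "d i = 0" if "i \<in> {1..n}" for i
      using that unfolding D_def by (subst (asm) sum_nonneg_eq_0_iff) auto
    then have "u i = v i" for i
      using u v by (cases "i \<in> {1..n}") (auto simp: d_def unit_sphere_def PiE_def extensional_def)
    then show False using False by auto
  qed
  \<comment> \<open>In |u - v|^2 = |u|^2 - |v|^2 - 2 <u - v, v> the first two terms cancel on the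
    unit sphere.\<close>
  have D2: "D = - 2 * (\<Sum>i=1..n. d i * v i)"
  proof -
    have "D = (\<Sum>i=1..n. (u i)^2) - (\<Sum>i=1..n. (v i)^2) - 2 * (\<Sum>i=1..n. d i * v i)"
      unfolding D_def d_def sum_distrib_left sum_subtractf[symmetric]
      by (intro sum.cong refl) (auto simp: power2_eq_square algebra_simps)
    then show ?thesis using u v by (simp add: unit_sphere_def)
  qed
  show ?thesis
  proof (rule that)
    show "orthogonal_matrix n Q"
      unfolding orthogonal_matrix_def
    proof (intro ballI)
      fix i k assume ik: "i \<in> {1..n}" "k \<in> {1..n}"
      have "(\<Sum>j=1..n. Q i j * Q k j) = (\<Sum>j=1..n. (if i = j then (if k = j then 1 else 0) else 0)
          - (if i = j then 2 * d k * d j / D else 0) - (if k = j then 2 * d i * d j / D else 0)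
          + 4 * d i * d k / D^2 * (d j)^2)"
        by (intro sum.cong refl) (auto simp: Q_def algebra_simps power2_eq_square)
      also have "\<dots> = (if k = i then 1 else 0) - 2 * d k * d i / D - 2 * d i * d k / D
          + 4 * d i * d k / D^2 * D"
        unfolding D_def using ik by (simp add: sum.distrib sum_subtractf sum_distrib_left)
      also have "\<dots> = (if i = k then 1 else 0)"
        using \<open>D \<noteq> 0\<close> by (auto simp: power2_eq_square)
      finally show "(\<Sum>j=1..n. Q i j * Q k j) = (if i = k then 1 else 0)" .
    qed
    fix j assume j: "j \<in> {1..n}"
    have "(\<Sum>i=1..n. Q i j * v i) = (\<Sum>i=1..n. (if i = j then v i else 0) - 2 * d j / D * (d i * v i))"
      by (intro sum.cong refl) (auto simp: Q_def algebra_simps)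
    also have "\<dots> = v j - 2 * d j / D * (\<Sum>i=1..n. d i * v i)"
      using j by (simp add: sum_subtractf sum_distrib_left)
    also have "\<dots> = u j"
      using D2 \<open>D \<noteq> 0\<close> by (auto simp: d_def field_simps)
    finally show "(\<Sum>i=1..n. Q i j * v i) = u j" .
  qed
qed

text \<open>Invariance moves the reflection that carries v to u from the variable to the frequency.
  The characteristic function is therefore radial.\<close>

lemma sphere_char_constant:
  assumes \<sigma>: "rotation_invariant_prob n \<sigma>" and u: "u \<in> unit_sphere n" and v: "v \<in> unit_sphere n"
  shows "(LINT x|\<sigma>. iexp (r * (\<Sum>i=1..n. u i * x i))) = (LINT x|\<sigma>. iexp (r * (\<Sum>i=1..n. v i * x i)))"
proof -
  obtain Q where Q: "orthogonal_matrix n Q" and Qv: "\<And>j. j \<in> {1..n} \<Longrightarrow> (\<Sum>i=1..n. Q i j * v i) = u j"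
    using householder_reflection[OF u v] by blast
  have s[measurable_cong]: "sets \<sigma> = sets (sphere_space n)"
    and inv: "distr \<sigma> \<sigma> (apply_matrix n Q) = \<sigma>"
    using \<sigma> Q by (auto simp: rotation_invariant_prob_def)
  have [measurable]: "(\<lambda>x. \<Sum>i=1..n. v i * x i) \<in> borel_measurable (sphere_space n)"
    by (intro measurable_restrict_space1) measurable
  note [measurable] = apply_matrix_measurable_sphere[OF Q]
  have "(LINT x|\<sigma>. iexp (r * (\<Sum>i=1..n. v i * x i))) =
      (LINT x|distr \<sigma> \<sigma> (apply_matrix n Q). iexp (r * (\<Sum>i=1..n. v i * x i)))"
    by (simp only: inv)
  also have "\<dots> = (LINT x|\<sigma>. iexp (r * (\<Sum>i=1..n. v i * apply_matrix n Q x i)))"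
    by (rule integral_distr) measurable
  also have "\<dots> = (LINT x|\<sigma>. iexp (r * (\<Sum>i=1..n. u i * x i)))"
    unfolding sum_apply_matrix by (intro LINT_cong refl arg_cong[where f = iexp]
      arg_cong2[where f = "(*)"] sum.cong Qv)
  finally show ?thesis by simp
qed

text \<open>Both radial characteristic functions equal the double integral of \<open>iexp\<close> of
  r <v, x> over \<sigma> and \<tau>: the integral over x does not depend on v, the integral over v
  does not depend on x, and Fubini compares the two.\<close>

lemma rotation_invariant_unique:
  assumes n: "1 \<le> n" and \<sigma>: "rotation_invariant_prob n \<sigma>" and \<tau>: "rotation_invariant_prob n \<tau>"
  shows "\<sigma> = \<tau>"
proof -
  define B where "B = PiM {1..n} (\<lambda>_. borel :: real measure)"
  have s\<sigma>[measurable_cong]: "sets \<sigma> = sets (sphere_space n)"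
    and s\<tau>[measurable_cong]: "sets \<tau> = sets (sphere_space n)"
    and p\<sigma>: "prob_space \<sigma>" and p\<tau>: "prob_space \<tau>"
    using \<sigma> \<tau> by (auto simp: rotation_invariant_prob_def)
  interpret \<sigma>: prob_space \<sigma> by fact
  interpret \<tau>: prob_space \<tau> by fact
  interpret P: pair_prob_space \<sigma> \<tau> ..
  have sp: "space \<sigma> = unit_sphere n" "space \<tau> = unit_sphere n"
    using sets_eq_imp_space_eq[OF s\<sigma>] sets_eq_imp_space_eq[OF s\<tau>]
    by (auto simp: space_restrict_space space_PiM unit_sphere_def)
  have idm: "id \<in> sphere_space n \<rightarrow>\<^sub>M B"
    unfolding B_def by (intro measurable_restrict_space1) simp
  have [measurable]: "id \<in> \<sigma> \<rightarrow>\<^sub>M B" "id \<in> \<tau> \<rightarrow>\<^sub>M B"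
    using idm s\<sigma> s\<tau> by (auto cong: measurable_cong_sets)
  have coord: "(\<lambda>x. x i) \<in> borel_measurable (sphere_space n)" if "i \<in> {1..n}" for i
    using that by (intro measurable_restrict_space1) measurable
  have coord': "(\<lambda>x. x i) \<in> borel_measurable \<sigma>" "(\<lambda>x. x i) \<in> borel_measurable \<tau>" if "i \<in> {1..n}" for i
    using coord[OF that] s\<sigma> s\<tau> by (auto cong: measurable_cong_sets)
  have ip[measurable]: "(\<lambda>x. \<Sum>i=1..n. y i * x i) \<in> borel_measurable \<sigma>"
       "(\<lambda>x. \<Sum>i=1..n. y i * x i) \<in> borel_measurable \<tau>" for y
    using coord' by (auto intro!: borel_measurable_sum)
  have key: "(LINT x|\<sigma>. iexp (r * (\<Sum>i=1..n. u i * x i))) = (LINT x|\<tau>. iexp (r * (\<Sum>i=1..n. u i * x i)))"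
    if u: "u \<in> unit_sphere n" for u r
  proof -
    have m2: "(\<lambda>(x, v). \<Sum>i=1..n. v i * x i) \<in> borel_measurable (\<sigma> \<Otimes>\<^sub>M \<tau>)"
      unfolding split_beta' using coord'
      by (intro borel_measurable_sum borel_measurable_times measurable_compose[OF measurable_fst]
          measurable_compose[OF measurable_snd]) auto
    have int: "integrable (\<sigma> \<Otimes>\<^sub>M \<tau>) (\<lambda>(x, v). iexp (r * (\<Sum>i=1..n. v i * x i)))"
    proof (rule P.integrable_const_bound[where B = 1])
      note m2[unfolded split_beta', measurable]
      show "(\<lambda>(x, v). iexp (r * (\<Sum>i=1..n. v i * x i))) \<in> borel_measurable (\<sigma> \<Otimes>\<^sub>M \<tau>)"
        unfolding split_beta' by measurable
    qed (auto simp del: of_real_sum of_real_mult)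
    have "(LINT x|\<sigma>. iexp (r * (\<Sum>i=1..n. u i * x i))) =
        (LINT v|\<tau>. (LINT x|\<sigma>. iexp (r * (\<Sum>i=1..n. u i * x i))))"
      by (simp add: \<tau>.prob_space)
    also have "\<dots> = (LINT v|\<tau>. (LINT x|\<sigma>. iexp (r * (\<Sum>i=1..n. v i * x i))))"
      by (intro LINT_cong refl sphere_char_constant[OF \<sigma> u]) (simp add: sp)
    also have "\<dots> = (LINT x|\<sigma>. (LINT v|\<tau>. iexp (r * (\<Sum>i=1..n. v i * x i))))"
      by (rule P.Fubini_integral[OF int])
    also have "\<dots> = (LINT x|\<sigma>. (LINT v|\<tau>. iexp (r * (\<Sum>i=1..n. u i * v i))))"
    proof (rule LINT_cong[OF refl])
      fix x assume "x \<in> space \<sigma>"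
      then have x: "x \<in> unit_sphere n" by (simp add: sp)
      have "(\<Sum>i=1..n. v i * x i) = (\<Sum>i=1..n. x i * v i)" for v
        by (intro sum.cong refl mult.commute)
      then show "(LINT v|\<tau>. iexp (r * (\<Sum>i=1..n. v i * x i))) = (LINT v|\<tau>. iexp (r * (\<Sum>i=1..n. u i * v i)))"
        using sphere_char_constant[OF \<tau> x u, of r] by (simp only:)
    qed
    also have "\<dots> = (LINT x|\<tau>. iexp (r * (\<Sum>i=1..n. u i * x i)))"
      by (simp add: \<sigma>.prob_space)
    finally show ?thesis .
  qed
  have "distr \<sigma> B id = distr \<tau> B id"
  proof (rule PiM_borel_eqI_char[of "{1..n}"])
    show "prob_space (distr \<sigma> B id)" "prob_space (distr \<tau> B id)"
      by (auto intro!: \<sigma>.prob_space_distr \<tau>.prob_space_distr)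
    fix y :: "nat \<Rightarrow> real"
    \<comment> \<open>A general frequency is r times a unit vector; for y = 0 the default value of
      \<open>normalise\<close> does no harm, since then r = 0.\<close>
    define r where "r = sqrt (\<Sum>i=1..n. (y i)^2)"
    have u: "normalise n y \<in> unit_sphere n" by (rule normalise_in_unit_sphere[OF n])
    have y: "r * normalise n y i = y i" if "i \<in> {1..n}" for i
    proof (cases "(\<Sum>i=1..n. (y i)^2) = 0")
      case True
      then have "y i = 0" using that by (subst (asm) sum_nonneg_eq_0_iff) auto
      then show ?thesis using True by (simp add: r_def)
    qed (use that in \<open>auto simp: normalise_def r_def\<close>)
    have ry: "r * (\<Sum>i=1..n. normalise n y i * x i) = (\<Sum>i=1..n. y i * x i)" for x
      unfolding sum_distrib_left using y by (intro sum.cong refl) (simp add: mult.assoc[symmetric])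
    have [measurable]: "(\<lambda>x. \<Sum>i=1..n. y i * x i) \<in> borel_measurable B"
      unfolding B_def by measurable
    show "(LINT x|distr \<sigma> B id. iexp (\<Sum>i=1..n. y i * x i)) = (LINT x|distr \<tau> B id. iexp (\<Sum>i=1..n. y i * x i))"
      by (subst (1 2) integral_distr) (measurable, simp only: id_apply key[OF u, of r, unfolded ry])
  qed (auto simp: B_def)
  then have eq: "emeasure \<sigma> (A \<inter> unit_sphere n) = emeasure \<tau> (A \<inter> unit_sphere n)" if "A \<in> sets B" for A
  proof -
    have "emeasure (distr \<sigma> B id) A = emeasure (distr \<tau> B id) A"
      using \<open>distr \<sigma> B id = distr \<tau> B id\<close> by (rule arg_cong)
    then show ?thesis using that by (subst (asm) (1 2) emeasure_distr) (auto simp: sp)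
  qed
  show ?thesis
  proof (rule measure_eqI)
    fix A assume "A \<in> sets \<sigma>"
    then obtain A' where "A' \<in> sets B" "A = A' \<inter> unit_sphere n"
      unfolding s\<sigma> B_def by (auto simp: sets_restrict_space)
    then show "emeasure \<sigma> A = emeasure \<tau> A" using eq by auto
  qed (simp add: s\<sigma> s\<tau>)
qed

lemma sphere_measure_eq:
  assumes "1 \<le> n"
  shows "sphere_measure n = distr (gaussian n) (sphere_space n) (normalise n)"
  unfolding sphere_measure_def
  using rotation_invariant_gaussian[OF assms] rotation_invariant_unique[OF assms]
  by (intro the_equality) auto

section \<open>Gaussian smoothing\<close>

text \<open>From |exp (i s) - 1| <= |s| the kernel is bounded by |b - a|; at t = 0 the quotient is 0
  by convention and obeys the same bound.\<close>

lemma Levy_kernel_integrable: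
  assumes "real_distribution \<mu>"
  shows "set_integrable lborel (einterval (ereal (- T)) (ereal T))
    (\<lambda>t. (iexp (-(t * a)) - iexp (-(t * b))) / (\<i> * t) * char \<mu> t)"
proof -
  interpret real_distribution \<mu> by fact
  show ?thesis
    unfolding set_integrable_def
  proof (rule integrableI_bounded_set[where A = "{-T<..<T}" and B = "\<bar>b - a\<bar>"])
    show "AE t in lborel. t \<in> {-T<..<T} \<longrightarrow> norm (indicat_real (einterval (ereal (- T)) (ereal T)) t *\<^sub>R
        ((iexp (-(t * a)) - iexp (-(t * b))) / (\<i> * t) * char \<mu> t)) \<le> \<bar>b - a\<bar>"
    proof (rule AE_I2, rule impI)
      fix t :: real
      have 1: "norm ((iexp (-(t * a)) - iexp (-(t * b))) / (\<i> * t)) \<le> \<bar>b - a\<bar>"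
      proof (cases "t = 0")
        case False
        have "norm (iexp (-(t * a)) - iexp (-(t * b))) = norm (iexp (-(t * a)) * (1 - iexp (t * a - t * b)))"
          by (simp add: algebra_simps flip: exp_add)
        also have "\<dots> = norm (iexp (t * a - t * b) - 1)" by (simp add: norm_mult norm_minus_commute)
        also have "\<dots> \<le> \<bar>t * a - t * b\<bar>"
          using iexp_approx1[of "t * a - t * b" 0] by simp
        also have "\<dots> = \<bar>t\<bar> * \<bar>b - a\<bar>" by (simp add: abs_mult[symmetric] algebra_simps abs_minus_commute)
        finally show ?thesis using False by (simp add: norm_divide norm_mult field_simps)
      qed simp
      have "norm ((iexp (-(t * a)) - iexp (-(t * b))) / (\<i> * t) * char \<mu> t) \<le> \<bar>b - a\<bar> * 1"
        unfolding norm_mult by (intro mult_mono 1 cmod_char_le_1) auto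
      then show "norm (indicat_real (einterval (ereal (- T)) (ereal T)) t *\<^sub>R
        ((iexp (-(t * a)) - iexp (-(t * b))) / (\<i> * t) * char \<mu> t)) \<le> \<bar>b - a\<bar>"
        by (auto simp: indicator_def)
    qed
    show "emeasure lborel {- T<..<T} < \<infinity>" by (cases "T \<ge> 0") auto
  qed (auto simp: einterval_def)
qed

text \<open>The difference of two Levy inversion formulas, with the kernel bounded by 2 / |t|.
  Inversion requires that the endpoints carry no mass.\<close>

lemma measure_diff_le_char_diff:
  assumes \<mu>: "real_distribution \<mu>" and \<nu>: "real_distribution \<nu>" and ab: "a \<le> b"
    and "measure \<mu> {a} = 0" "measure \<mu> {b} = 0" "measure \<nu> {a} = 0" "measure \<nu> {b} = 0"
    and J: "0 \<le> J" "(\<integral>\<^sup>+t. ennreal (norm (char \<mu> t - char \<nu> t) / \<bar>t\<bar>) \<partial>lborel) \<le> ennreal J"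
  shows "\<bar>measure \<mu> {a<..b} - measure \<nu> {a<..b}\<bar> \<le> J / pi"
proof -
  interpret \<mu>: real_distribution \<mu> by fact
  interpret \<nu>: real_distribution \<nu> by fact
  define K where "K t = (iexp (-(t * a)) - iexp (-(t * b))) / (\<i> * t)" for t
  have K2: "norm (K t) \<le> 2 / \<bar>t\<bar>" for t
  proof -
    have "norm (iexp (-(t * a)) - iexp (-(t * b))) \<le> norm (iexp (-(t * a))) + norm (iexp (-(t * b)))"
      by (rule norm_triangle_ineq4)
    also have "\<dots> = 2" by (simp only: norm_exp_i_times)
    finally show ?thesis by (simp add: K_def norm_divide norm_mult divide_right_mono)
  qed
  define F where "F M T = 1 / (2 * pi) * (CLBINT t=-T..T. K t * char M t)" for M and T :: real
  have lim: "(\<lambda>n. F \<mu> (real n) - F \<nu> (real n)) \<longlonglongrightarrow> complex_of_real (measure \<mu> {a<..b} - measure \<nu> {a<..b})"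
    using tendsto_diff[OF \<mu>.Levy_Inversion[OF ab assms(4,5)] \<nu>.Levy_Inversion[OF ab assms(6,7)]]
    by (simp add: F_def K_def)
  have bd: "norm (F \<mu> T - F \<nu> T) \<le> J / pi" if "T \<ge> 0" for T
  proof -
    let ?I = "einterval (ereal (-T)) (ereal T)"
    have int: "set_integrable lborel ?I (\<lambda>t. K t * char \<mu> t)" "set_integrable lborel ?I (\<lambda>t. K t * char \<nu> t)"
      unfolding K_def by (rule Levy_kernel_integrable, fact)+
    have "F \<mu> T - F \<nu> T = 1 / (2 * pi) * (CLINT t:?I|lborel. K t * char \<mu> t - K t * char \<nu> t)"
      unfolding F_def using that int
      by (simp add: interval_lebesgue_integral_def set_integral_diff diff_divide_distrib)
    then have "norm (F \<mu> T - F \<nu> T) = 1 / (2 * pi) * norm (CLINT t:?I|lborel. K t * char \<mu> t - K t * char \<nu> t)"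
      by (simp only: norm_mult, simp add: norm_divide norm_mult)
    also have "norm (CLINT t:?I|lborel. K t * char \<mu> t - K t * char \<nu> t) \<le> 2 * J"
    proof -
      have "ennreal (norm (CLINT t:?I|lborel. K t * char \<mu> t - K t * char \<nu> t))
          \<le> (\<integral>\<^sup>+t. norm (indicator ?I t *\<^sub>R (K t * char \<mu> t - K t * char \<nu> t)) \<partial>lborel)"
        unfolding set_lebesgue_integral_def
        using set_integral_diff(1)[OF int] unfolding set_integrable_def
        by (rule integral_norm_bound_ennreal)
      also have "\<dots> \<le> (\<integral>\<^sup>+t. ennreal 2 * ennreal (norm (char \<mu> t - char \<nu> t) / \<bar>t\<bar>) \<partial>lborel)"
      proof (rule nn_integral_mono)
        fix t
        have "norm (indicator ?I t *\<^sub>R (K t * char \<mu> t - K t * char \<nu> t)) \<le> norm (K t) * norm (char \<mu> t - char \<nu> t)"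
          by (auto simp: indicator_def norm_mult simp flip: right_diff_distrib)
        also have "\<dots> \<le> 2 / \<bar>t\<bar> * norm (char \<mu> t - char \<nu> t)" by (intro mult_right_mono K2) auto
        finally show "ennreal (norm (indicator ?I t *\<^sub>R (K t * char \<mu> t - K t * char \<nu> t)))
            \<le> ennreal 2 * ennreal (norm (char \<mu> t - char \<nu> t) / \<bar>t\<bar>)"
          by (subst ennreal_mult[symmetric]) (auto intro!: ennreal_leI)
      qed
      also have "\<dots> = ennreal 2 * (\<integral>\<^sup>+t. ennreal (norm (char \<mu> t - char \<nu> t) / \<bar>t\<bar>) \<partial>lborel)"
        by (rule nn_integral_cmult) measurable
      also have "\<dots> \<le> ennreal 2 * ennreal J" by (intro mult_left_mono J) auto
      also have "\<dots> = ennreal (2 * J)" using J by (simp add: ennreal_mult)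
      finally show ?thesis using J by (simp add: ennreal_le_iff)
    qed
    finally show ?thesis by (simp add: field_simps)
  qed
  have "norm (complex_of_real (measure \<mu> {a<..b} - measure \<nu> {a<..b})) \<le> J / pi"
    by (rule tendsto_upperbound[OF tendsto_norm[OF lim]]) (auto intro!: always_eventually bd)
  then show ?thesis by (simp del: of_real_diff)
qed

text \<open>The left endpoint is sent to minus infinity along the integers, hence the absence of
  atoms at all points.\<close>

lemma cdf_diff_le_char_diff:
  assumes \<mu>: "real_distribution \<mu>" and \<nu>: "real_distribution \<nu>"
    and at: "\<And>a. measure \<mu> {a} = 0" "\<And>a. measure \<nu> {a} = 0"
    and J: "0 \<le> J" "(\<integral>\<^sup>+t. ennreal (norm (char \<mu> t - char \<nu> t) / \<bar>t\<bar>) \<partial>lborel) \<le> ennreal J"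
  shows "\<bar>cdf \<mu> y - cdf \<nu> y\<bar> \<le> J / pi"
proof -
  interpret \<mu>: real_distribution \<mu> by fact
  interpret \<nu>: real_distribution \<nu> by fact
  have "(\<lambda>i. \<bar>(cdf \<mu> y - cdf \<mu> (- real i)) - (cdf \<nu> y - cdf \<nu> (- real i))\<bar>) \<longlonglongrightarrow>
      \<bar>(cdf \<mu> y - 0) - (cdf \<nu> y - 0)\<bar>"
    by (intro tendsto_intros \<mu>.cdf_lim_neg_infty \<nu>.cdf_lim_neg_infty)
  moreover have "\<forall>\<^sub>F i in sequentially.
      \<bar>(cdf \<mu> y - cdf \<mu> (- real i)) - (cdf \<nu> y - cdf \<nu> (- real i))\<bar> \<le> J / pi"
    using eventually_gt_at_top[of "nat \<lceil>\<bar>y\<bar>\<rceil>"]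
  proof eventually_elim
    case (elim i)
    then have "- real i < y" by linarith
    then show ?case
      using measure_diff_le_char_diff[OF \<mu> \<nu> _ at(1) at(1) at(2) at(2) J, of "- real i" y]
      by (simp add: \<mu>.cdf_diff_eq \<nu>.cdf_diff_eq)
  qed
  ultimately have "\<bar>(cdf \<mu> y - 0) - (cdf \<nu> y - 0)\<bar> \<le> J / pi"
    by (rule tendsto_upperbound) auto
  then show ?thesis by simp
qed

text \<open>Independent Gaussian noise has two purposes: it removes all atoms, so that inversion
  applies at every point, and it multiplies the characteristic function by a factor that damps high
  frequencies.\<close>

definition gaussian_smoothing :: "real \<Rightarrow> real measure \<Rightarrow> real measure" where
  "gaussian_smoothing \<epsilon> \<mu> = distr (\<mu> \<Otimes>\<^sub>M std_gauss) borel (\<lambda>(x, z). x + \<epsilon> * z)"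

context
  fixes \<mu> :: "real measure" and \<epsilon> :: real
  assumes \<mu>: "real_distribution \<mu>" and \<epsilon>: "0 < \<epsilon>"
begin

interpretation \<mu>: real_distribution \<mu> by (rule \<mu>)
interpretation pair: pair_prob_space \<mu> std_gauss ..

lemma real_distribution_gaussian_smoothing: "real_distribution (gaussian_smoothing \<epsilon> \<mu>)"
  unfolding gaussian_smoothing_def by (rule pair.real_distribution_distr) measurable

lemma gaussian_smoothing_no_atom: "measure (gaussian_smoothing \<epsilon> \<mu>) {a} = 0"
proof -
  have null: "emeasure std_gauss {z. x + \<epsilon> * z = a} = 0" for x
  proof -
    have "{z. x + \<epsilon> * z = a} = {(a - x) / \<epsilon>}" using \<epsilon> by (auto simp: field_simps)
    moreover have "emeasure std_gauss {(a - x) / \<epsilon>} = 0"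
      by (simp add: emeasure_density nn_integral_indicator_singleton')
    ultimately show ?thesis by simp
  qed
  have "emeasure (gaussian_smoothing \<epsilon> \<mu>) {a} = emeasure (\<mu> \<Otimes>\<^sub>M std_gauss)
      ((\<lambda>(x, z). x + \<epsilon> * z) -` {a} \<inter> space (\<mu> \<Otimes>\<^sub>M std_gauss))"
    unfolding gaussian_smoothing_def by (rule emeasure_distr) auto
  also have "\<dots> = (\<integral>\<^sup>+x. emeasure std_gauss (Pair x -` ((\<lambda>(x, z). x + \<epsilon> * z) -` {a} \<inter> space (\<mu> \<Otimes>\<^sub>M std_gauss))) \<partial>\<mu>)"
    by (rule std_normal.emeasure_pair_measure_alt) measurable
  also have "\<dots> = (\<integral>\<^sup>+x. emeasure std_gauss {z. x + \<epsilon> * z = a} \<partial>\<mu>)"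
    by (intro nn_integral_cong arg_cong2[where f = emeasure] refl) (auto simp: space_pair_measure)
  also have "\<dots> = 0" by (simp add: null)
  finally show ?thesis by (simp add: measure_def)
qed

lemma char_gaussian_smoothing:
  "char (gaussian_smoothing \<epsilon> \<mu>) t = char \<mu> t * exp (- (\<epsilon> * t)\<^sup>2 / 2)"
proof -
  have int: "integrable (\<mu> \<Otimes>\<^sub>M std_gauss) (\<lambda>p. iexp (t * fst p) * iexp ((t * \<epsilon>) * snd p))"
    by (rule pair.integrable_const_bound[where B = 1]) (auto simp: norm_mult simp del: of_real_mult)
  have "char (gaussian_smoothing \<epsilon> \<mu>) t = (LINT p|(\<mu> \<Otimes>\<^sub>M std_gauss). iexp (t * fst p) * iexp ((t * \<epsilon>) * snd p))"
    unfolding char_def gaussian_smoothing_def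
    by (subst integral_distr)
      (auto simp: split_beta' algebra_simps exp_add intro!: LINT_cong)
  also have "\<dots> = (LINT x|\<mu>. LINT z|std_gauss. iexp (t * x) * iexp ((t * \<epsilon>) * z))"
    using pair.integral_fst'[OF int] by simp
  also have "\<dots> = (LINT x|\<mu>. iexp (t * x) * char std_gauss (t * \<epsilon>))"
    unfolding char_def by (intro LINT_cong refl integral_mult_right_zero)
  also have "\<dots> = char \<mu> t * char std_gauss (t * \<epsilon>)"
    unfolding char_def by (rule integral_mult_left_zero)
  finally show ?thesis by (simp add: char_std_normal_distribution mult.commute)
qed

text \<open>In this form the smoothed cdf is a Gaussian average of translates, which is what the
  comparison in \<open>smoothing_inequality\<close> exploits.\<close>

lemma cdf_gaussian_smoothing:
  "cdf (gaussian_smoothing \<epsilon> \<mu>) y = (LINT z|std_gauss. cdf \<mu> (y - \<epsilon> * z))"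
proof -
  interpret s: real_distribution "gaussian_smoothing \<epsilon> \<mu>" by (rule real_distribution_gaussian_smoothing)
  let ?A = "(\<lambda>(x, z). x + \<epsilon> * z) -` {..y} \<inter> space (\<mu> \<Otimes>\<^sub>M std_gauss)"
  have "mono (cdf \<mu>)" by (auto simp: mono_def \<mu>.cdf_nondecreasing)
  then have [measurable]: "cdf \<mu> \<in> borel_measurable borel" by (rule borel_measurable_mono)
  have "ennreal (cdf (gaussian_smoothing \<epsilon> \<mu>) y) = emeasure (gaussian_smoothing \<epsilon> \<mu>) {..y}"
    by (simp add: cdf_def s.emeasure_eq_measure)
  also have "\<dots> = emeasure (\<mu> \<Otimes>\<^sub>M std_gauss) ?A"
    unfolding gaussian_smoothing_def by (rule emeasure_distr) auto
  also have "\<dots> = (\<integral>\<^sup>+z. emeasure \<mu> ((\<lambda>x. (x, z)) -` ?A) \<partial>std_gauss)"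
    by (rule pair.emeasure_pair_measure_alt2) measurable
  also have "\<dots> = (\<integral>\<^sup>+z. ennreal (cdf \<mu> (y - \<epsilon> * z)) \<partial>std_gauss)"
    unfolding cdf_def \<mu>.emeasure_eq_measure[symmetric]
    by (intro nn_integral_cong arg_cong2[where f = emeasure] refl) (auto simp: space_pair_measure)
  also have "\<dots> = ennreal (LINT z|std_gauss. cdf \<mu> (y - \<epsilon> * z))"
    by (intro nn_integral_eq_integral std_normal.integrable_const_bound[where B = 1])
       (auto simp: \<mu>.cdf_nonneg \<mu>.cdf_bounded_prob)
  finally show ?thesis
    by (subst (asm) ennreal_inj) (auto simp: s.cdf_nonneg \<mu>.cdf_nonneg intro!: integral_nonneg_AE)
qed

end

lemma std_normal_cdf_Lipschitz:
  assumes "x \<le> y"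
  shows "cdf std_gauss y - cdf std_gauss x \<le> (y - x) / 2"
proof (cases "x = y")
  case False
  with assms have xy: "x < y" by simp
  have dens: "std_normal_density z \<le> 1 / 2" for z
  proof -
    have "sqrt 4 \<le> sqrt (2 * pi)" using pi_gt3 by (intro real_sqrt_le_mono) simp
    then have "2 \<le> sqrt (2 * pi)" by simp
    then have "1 / sqrt (2 * pi) \<le> 1 / 2" by (intro divide_left_mono) auto
    moreover have "exp (- z\<^sup>2 / 2) \<le> 1" by simp
    ultimately have "1 / sqrt (2 * pi) * exp (- z\<^sup>2 / 2) \<le> 1 / 2 * 1" by (intro mult_mono) auto
    then show ?thesis by (simp add: std_normal_density_def)
  qed
  have "ennreal (cdf std_gauss y - cdf std_gauss x) = emeasure std_gauss {x<..y}"
    using xy by (simp add: std_normal.cdf_diff_eq std_normal.emeasure_eq_measure)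
  also have "\<dots> = (\<integral>\<^sup>+z. ennreal (std_normal_density z) * indicator {x<..y} z \<partial>lborel)"
    by (rule emeasure_density) auto
  also have "\<dots> \<le> (\<integral>\<^sup>+z. ennreal (1/2) * indicator {x<..y} z \<partial>lborel)"
    by (intro nn_integral_mono mult_right_mono ennreal_leI dens) auto
  also have "\<dots> = ennreal (1/2) * ennreal (y - x)"
    using assms by (subst nn_integral_cmult_indicator) auto
  also have "\<dots> = ennreal ((y - x) / 2)" using assms by (subst ennreal_mult[symmetric]) auto
  finally show ?thesis using assms by (simp add: ennreal_le_iff)
qed simp

lemma std_normal_second_moment:
  "integrable std_gauss (\<lambda>z. z^2)" "(LINT z|std_gauss. z^2) = 1"
  using std_normal_distribution_even_moments[of 1] by (simp_all add: fact_numeral)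

text \<open>Let \<Delta> be the supremum of |D|. A large value D x persists, up to 2 \<epsilon>, on
  an interval of length 4 \<epsilon> to the right of x (to the left for a large - D x). The smoothed
  difference, bounded by J / pi, averages D over a Gaussian centred at the midpoint of that
  interval; the mass outside it, at most 1/4, can contribute - \<Delta> at worst.\<close>

lemma smoothing_inequality:
  assumes \<mu>: "real_distribution \<mu>" and \<epsilon>: "0 < \<epsilon>" and J: "0 \<le> J"
    "(\<integral>\<^sup>+t. ennreal (norm (char \<mu> t - exp (- t\<^sup>2 / 2)) * exp (- (\<epsilon> * t)\<^sup>2 / 2) / \<bar>t\<bar>) \<partial>lborel) \<le> ennreal J"
  shows "\<bar>cdf \<mu> x - cdf std_gauss x\<bar> \<le> 3 * \<epsilon> + J"
proof -
  interpret \<mu>: real_distribution \<mu> by fact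
  define D where "D y = cdf \<mu> y - cdf std_gauss y" for y
  define \<Delta> where "\<Delta> = (SUP y. \<bar>D y\<bar>)"
  have D1: "\<bar>D y\<bar> \<le> 1" for y
    using \<mu>.cdf_nonneg[of y] \<mu>.cdf_bounded_prob[of y] std_normal.cdf_nonneg[of y] std_normal.cdf_bounded_prob[of y]
    unfolding D_def by linarith
  have bdd: "bdd_above (range (\<lambda>y. \<bar>D y\<bar>))" using D1 by (auto intro!: bdd_aboveI[where M = 1])
  have D\<Delta>: "\<bar>D y\<bar> \<le> \<Delta>" for y unfolding \<Delta>_def by (intro cSUP_upper bdd) simp
  have [measurable]: "cdf \<mu> \<in> borel_measurable borel" "cdf std_gauss \<in> borel_measurable borel"
    by (auto intro!: borel_measurable_mono simp: mono_def \<mu>.cdf_nondecreasing std_normal.cdf_nondecreasing)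
  have [measurable]: "D \<in> borel_measurable borel" unfolding D_def by measurable
  have intD[simp]: "integrable std_gauss (\<lambda>z. D (y - \<epsilon> * z))" for y
    by (rule std_normal.integrable_const_bound[where B = 1]) (use D1 in auto)
  have smooth: "\<bar>LINT z|std_gauss. D (y - \<epsilon> * z)\<bar> \<le> J / pi" for y
  proof -
    have i: "integrable std_gauss (\<lambda>z. cdf M (y - \<epsilon> * z))" if "real_distribution M" for M
    proof -
      interpret M: real_distribution M by fact
      have [measurable]: "cdf M \<in> borel_measurable borel"
        by (auto intro!: borel_measurable_mono simp: mono_def M.cdf_nondecreasing)
      show ?thesis
        by (rule std_normal.integrable_const_bound[where B = 1]) (auto simp: M.cdf_nonneg M.cdf_bounded_prob)
    qed
    have "(LINT z|std_gauss. D (y - \<epsilon> * z)) = cdf (gaussian_smoothing \<epsilon> \<mu>) y -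
        cdf (gaussian_smoothing \<epsilon> std_gauss) y"
      unfolding D_def cdf_gaussian_smoothing[OF \<mu> \<epsilon>] cdf_gaussian_smoothing[OF real_dist_normal_dist \<epsilon>]
      using i[OF \<mu>] i[OF real_dist_normal_dist] by simp
    also have "\<bar>\<dots>\<bar> \<le> J / pi"
    proof (rule cdf_diff_le_char_diff[OF _ _ _ _ J(1)])
      have eq: "norm (char (gaussian_smoothing \<epsilon> \<mu>) t - char (gaussian_smoothing \<epsilon> std_gauss) t) =
          norm (char \<mu> t - exp (- t\<^sup>2 / 2)) * exp (- (\<epsilon> * t)\<^sup>2 / 2)" for t
        unfolding char_gaussian_smoothing[OF \<mu> \<epsilon>] char_gaussian_smoothing[OF real_dist_normal_dist \<epsilon>]
          left_diff_distrib[symmetric] norm_mult by (simp add: char_std_normal_distribution)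
      show "(\<integral>\<^sup>+t. ennreal (norm (char (gaussian_smoothing \<epsilon> \<mu>) t - char (gaussian_smoothing \<epsilon> std_gauss) t) / \<bar>t\<bar>) \<partial>lborel) \<le> ennreal J"
        unfolding eq by (rule J(2))
    qed (intro real_distribution_gaussian_smoothing gaussian_smoothing_no_atom \<mu> \<epsilon> real_dist_normal_dist)+
    finally show ?thesis .
  qed
  have \<Delta>0: "0 \<le> \<Delta>" using D\<Delta>[of 0] by linarith
  \<comment> \<open>Chebyshev's inequality as a pointwise minorant: the parabola A - (A + \<Delta>)
    z^2 / 4 never exceeds A and is at most - \<Delta> for |z| >= 2, and its mean only involves the
    variance.\<close>
  have average: "A - (A + \<Delta>) / 4 \<le> (LINT z|std_gauss. h z)"
    if A: "0 \<le> A" and h: "integrable std_gauss h"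
      and near: "\<And>z. \<bar>z\<bar> \<le> 2 \<Longrightarrow> A \<le> h z" and far: "\<And>z. - \<Delta> \<le> h z" for A and h :: "real \<Rightarrow> real"
  proof -
    have "A - (A + \<Delta>) / 4 = (LINT z|std_gauss. A - (A + \<Delta>) / 4 * z^2)"
      using std_normal_second_moment std_normal.prob_space by (simp del: std_normal.prob_space)
    also have "\<dots> \<le> (LINT z|std_gauss. h z)"
    proof (rule integral_mono)
      fix z :: real
      show "A - (A + \<Delta>) / 4 * z^2 \<le> h z"
      proof (cases "\<bar>z\<bar> \<le> 2")
        case True
        moreover have "0 \<le> (A + \<Delta>) / 4 * z^2" using A \<Delta>0 by simp
        ultimately show ?thesis using near[of z] by linarith
      next
        case False
        then have "4 \<le> z^2" using power_mono[of 2 "\<bar>z\<bar>" 2] by simp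
        then have "(A + \<Delta>) / 4 * 4 \<le> (A + \<Delta>) / 4 * z^2"
          using A \<Delta>0 by (intro mult_left_mono) auto
        then show ?thesis using far[of z] by simp
      qed
    qed (use std_normal_second_moment h in auto)
    finally show ?thesis .
  qed
  have near: "\<epsilon> * z \<le> 2 * \<epsilon>" "- (2 * \<epsilon>) \<le> \<epsilon> * z" if "\<bar>z\<bar> \<le> 2" for z
    using mult_left_mono[of z 2 \<epsilon>] mult_left_mono[of "-2" z \<epsilon>] that \<epsilon> by (auto simp: mult.commute)
  \<comment> \<open>The cdf of \<mu> increases and the normal one is Lipschitz with constant 1/2, so
    D drops by at most 2 \<epsilon> over a length 4 \<epsilon>.\<close>
  have D_shift: "D x - 2 * \<epsilon> \<le> D y" if "x \<le> y" "y \<le> x + 4 * \<epsilon>" for x y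
    using \<mu>.cdf_nondecreasing[OF that(1)] std_normal_cdf_Lipschitz[OF that(1)] that(2)
    unfolding D_def by argo
  have up: "D x \<le> 2 * \<epsilon> + 4 / 3 * (J / pi) + \<Delta> / 3" for x
  proof (cases "0 \<le> D x - 2 * \<epsilon>")
    case True
    have "(D x - 2 * \<epsilon>) - (D x - 2 * \<epsilon> + \<Delta>) / 4 \<le> (LINT z|std_gauss. D (x + 2 * \<epsilon> - \<epsilon> * z))"
      by (rule average[OF True intD])
        (use near D\<Delta> in \<open>force intro!: D_shift simp: abs_le_iff minus_le_iff\<close>)+
    then show ?thesis using smooth[of "x + 2 * \<epsilon>"] unfolding abs_le_iff by argo
  next
    case False
    then show ?thesis using \<Delta>0 J(1) by (intro add_increasing2) (auto intro!: add_nonneg_nonneg)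
  qed
  have lo: "- D x \<le> 2 * \<epsilon> + 4 / 3 * (J / pi) + \<Delta> / 3" for x
  proof (cases "0 \<le> - D x - 2 * \<epsilon>")
    case True
    have "(- D x - 2 * \<epsilon>) - (- D x - 2 * \<epsilon> + \<Delta>) / 4 \<le> (LINT z|std_gauss. - D (x - 2 * \<epsilon> - \<epsilon> * z))"
    proof (rule average[OF True])
      fix z :: real
      show "- \<Delta> \<le> - D (x - 2 * \<epsilon> - \<epsilon> * z)" using D\<Delta> by (simp add: abs_le_iff)
      assume "\<bar>z\<bar> \<le> 2"
      from near[OF this] have "D (x - 2 * \<epsilon> - \<epsilon> * z) - 2 * \<epsilon> \<le> D x" by (intro D_shift) auto
      then show "- D x - 2 * \<epsilon> \<le> - D (x - 2 * \<epsilon> - \<epsilon> * z)" by simp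
    qed simp
    then show ?thesis using smooth[of "x - 2 * \<epsilon>"] unfolding abs_le_iff by (simp, argo)
  next
    case False
    then show ?thesis using \<Delta>0 J(1) by (intro add_increasing2) (auto intro!: add_nonneg_nonneg)
  qed
  \<comment> \<open>The supremum is taken on the left. As |D| is bounded by 1, \<Delta> is a true
    supremum, and \<Delta> / 3 can be absorbed.\<close>
  have "\<Delta> \<le> 2 * \<epsilon> + 4 / 3 * (J / pi) + \<Delta> / 3"
    unfolding \<Delta>_def by (rule cSUP_least) (use up lo in \<open>auto simp: abs_le_iff \<Delta>_def\<close>)
  then have "\<Delta> \<le> 3 * \<epsilon> + 2 * (J / pi)" by simp
  moreover have "J / pi \<le> J / 2" using J pi_ge_two by (intro divide_left_mono) auto
  ultimately show ?thesis using D\<Delta>[of x] unfolding D_def by linarith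
qed

section \<open>Characteristic functions of standardized laws\<close>

lemma exp_neg_le_quadratic: "exp (- s) \<le> 1 - s + s^2 / 2" if "0 \<le> s" for s :: real
proof -
  have "\<exists>\<xi>. \<bar>\<xi>\<bar> \<le> \<bar>- s\<bar> \<and> exp (- s) = (\<Sum>m<3. (- s) ^ m / fact m) + exp \<xi> / fact 3 * (- s) ^ 3"
    using Maclaurin_exp_le[of "- s" 3] by simp
  then obtain \<xi> where "exp (- s) = (\<Sum>m<3. (- s) ^ m / fact m) + exp \<xi> / fact 3 * (- s) ^ 3" by blast
  moreover have "exp \<xi> / fact 3 * (- s) ^ 3 \<le> 0" using that by (simp add: power3_eq_cube mult_nonneg_nonpos)
  moreover have "{..<3} = {0, 1, 2 :: nat}" by auto
  ultimately show ?thesis by simp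
qed

locale standardized_law = real_distribution M for M :: "real measure" +
  assumes fourth_integrable: "integrable M (\<lambda>x. x ^ 4)"
    and mean_zero: "(LINT x|M. x) = 0"
    and variance_one: "(LINT x|M. x^2) = 1"
begin

definition third_moment :: real where "third_moment = (LINT x|M. x ^ 3)"
definition fourth_moment :: real where "fourth_moment = (LINT x|M. x ^ 4)"

lemma moment_integrable:
  assumes "k \<le> 4"
  shows "integrable M (\<lambda>x. x ^ k)"
proof (rule Bochner_Integration.integrable_bound)
  show "integrable M (\<lambda>x. 1 + x ^ 4)" using fourth_integrable by simp
  show "AE x in M. norm (x ^ k) \<le> norm (1 + x ^ 4)"
  proof (rule AE_I2)
    fix x :: real
    have "\<bar>x\<bar> ^ k \<le> 1 + \<bar>x\<bar> ^ 4"
    proof (cases "\<bar>x\<bar> \<le> 1")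
      case True
      then have "\<bar>x\<bar> ^ k \<le> 1" by (intro power_le_one) auto
      then show ?thesis using zero_le_power[of "\<bar>x\<bar>" 4] by linarith
    next
      case False
      then have "\<bar>x\<bar> ^ k \<le> \<bar>x\<bar> ^ 4" using assms by (intro power_increasing) auto
      then show ?thesis by linarith
    qed
    then show "norm (x ^ k) \<le> norm (1 + x ^ 4)" by (simp add: power_abs)
  qed
qed simp

lemmas moments_integrable [simp] = moment_integrable[of 1, simplified] moment_integrable[of 2, simplified]
  moment_integrable[of 3, simplified] fourth_integrable

lemma one_le_fourth_moment: "1 \<le> fourth_moment"
proof -
  have "0 \<le> (LINT x|M. (x^2 - 1)^2)" by (rule integral_nonneg_AE) simp
  also have "(LINT x|M. (x^2 - 1)^2) = (LINT x|M. x ^ 4 - 2 * x^2 + 1)"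
    by (intro LINT_cong refl) (simp add: power2_eq_square power4_eq_xxxx algebra_simps)
  also have "\<dots> = fourth_moment - 2 + 1"
    using prob_space variance_one by (simp add: fourth_moment_def del: prob_space)
  finally show ?thesis by simp
qed

text \<open>Cauchy-Schwarz for X and X^2. It lets fourth moments control the compensator of the
  cubic sum as well.\<close>

lemma third_moment_square_le: "third_moment^2 \<le> fourth_moment"
proof -
  have "0 \<le> (LINT x|M. (x^2 - third_moment * x)^2)" by (rule integral_nonneg_AE) simp
  also have "(LINT x|M. (x^2 - third_moment * x)^2) =
      (LINT x|M. x ^ 4 - 2 * third_moment * x ^ 3 + third_moment^2 * x^2)"
    by (intro LINT_cong refl)
      (simp add: power2_eq_square power3_eq_cube power4_eq_xxxx algebra_simps)
  also have "\<dots> = fourth_moment - 2 * third_moment * third_moment + third_moment^2"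
    using variance_one by (simp add: fourth_moment_def third_moment_def)
  finally show ?thesis by (simp add: power2_eq_square)
qed

text \<open>The Taylor polynomial of degree four has error t^4 m4 / 12; its quartic term t^4 m4 / 24
  is moved into the error. The cubic term is retained, since its sign matters later.\<close>

lemma char_expansion:
  "norm (char M t - (1 - t\<^sup>2 / 2 - \<i> * (t ^ 3 * third_moment / 6))) \<le> t ^ 4 * fourth_moment / 8"
proof -
  define S where "S = (\<Sum>k \<le> 4. ((\<i> * t)^k / fact k) * expectation (\<lambda>x. x^k))"
  have S: "S = 1 - t\<^sup>2 / 2 - \<i> * (t ^ 3 * third_moment / 6) + t ^ 4 * fourth_moment / 24"
  proof -
    have "{..4} = {0, 1, 2, 3, 4 :: nat}" by auto
    moreover have "(\<i> * complex_of_real t) ^ 3 = - (\<i> * t ^ 3)" "(\<i> * complex_of_real t) ^ 4 = t ^ 4"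
      by (simp_all add: power_mult_distrib power3_eq_cube[of \<i>])
    ultimately show ?thesis
      unfolding S_def third_moment_def fourth_moment_def using mean_zero variance_one prob_space
      by (simp add: fact_numeral power_mult_distrib del: prob_space)
  qed
  have "norm (char M t - S) \<le> (2*\<bar>t\<bar>^4 / fact 4) * expectation (\<lambda>x. \<bar>x\<bar>^4)"
    unfolding S_def by (rule char_approx1) (rule moment_integrable)
  also have "\<dots> = t ^ 4 * fourth_moment / 12" by (simp add: fact_numeral fourth_moment_def)
  finally have 1: "norm (char M t - S) \<le> t ^ 4 * fourth_moment / 12" .
  have "char M t - (1 - t\<^sup>2 / 2 - \<i> * (t ^ 3 * third_moment / 6)) = (char M t - S) + complex_of_real (t ^ 4 * fourth_moment / 24)"
    by (simp add: S)
  also have "norm \<dots> \<le> t ^ 4 * fourth_moment / 12 + \<bar>t ^ 4 * fourth_moment / 24\<bar>"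
    by (rule order_trans[OF norm_triangle_ineq add_mono[OF 1]]) (simp only: norm_of_real order_refl)
  also have "\<bar>t ^ 4 * fourth_moment / 24\<bar> = t ^ 4 * fourth_moment / 24"
    using one_le_fourth_moment by simp
  finally show ?thesis by (simp add: mult.commute)
qed

text \<open>The cubic term of the expansion is imaginary and enters the modulus only through its
  square, at most q / 36 for |t| <= 1. As 1 - t^2 / 2 >= 1/2, adding 10/36 q before squaring more
  than covers it, and 10/36 + 1/8 <= 1/2. For |t| > 1 the exponent is nonnegative because the fourth
  moment is at least 1.\<close>

lemma norm_char_le:
  "norm (char M t) \<le> exp (- t\<^sup>2 / 2 + t ^ 4 * fourth_moment / 2)"
proof (cases "\<bar>t\<bar> \<le> 1")
  case False
  then have "t^2 * 1 \<le> t^2 * t^2" using one_le_power[of "\<bar>t\<bar>" 2]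
    by (intro mult_left_mono) auto
  also have "\<dots> = t ^ 4 * 1" by (simp add: power2_eq_square power4_eq_xxxx)
  also have "\<dots> \<le> t ^ 4 * fourth_moment" using one_le_fourth_moment by (intro mult_left_mono) auto
  finally have "0 \<le> - t\<^sup>2 / 2 + t ^ 4 * fourth_moment / 2" by simp
  then have "1 \<le> exp (- t\<^sup>2 / 2 + t ^ 4 * fourth_moment / 2)" by simp
  then show ?thesis using cmod_char_le_1 order_trans by blast
next
  case True
  define q where "q = t ^ 4 * fourth_moment"
  have t2: "t^2 \<le> 1" using True by (simp add: abs_square_le_1)
  have q0: "0 \<le> q" using one_le_fourth_moment by (simp add: q_def)
  have t6: "t ^ 6 * third_moment^2 \<le> q"
  proof -
    have "t ^ 6 * third_moment^2 = t^2 * (t ^ 4 * third_moment^2)" by (simp add: algebra_simps flip: power_add)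
    also have "\<dots> \<le> 1 * (t ^ 4 * fourth_moment)"
      using t2 third_moment_square_le by (intro mult_mono) auto
    finally show ?thesis by (simp add: q_def)
  qed
  have sq: "(norm (1 - t\<^sup>2 / 2 - \<i> * (t ^ 3 * third_moment / 6)))^2 \<le> (1 - t\<^sup>2 / 2 + 10 / 36 * q)^2"
  proof -
    have "(norm (1 - t\<^sup>2 / 2 - \<i> * (t ^ 3 * third_moment / 6)))^2 = (1 - t\<^sup>2 / 2)^2 + t ^ 6 * third_moment^2 / 36"
      unfolding cmod_power2 by (simp add: power_mult_distrib power_divide flip: power_mult)
    also have "\<dots> \<le> (1 - t\<^sup>2 / 2)^2 + q / 36" using t6 by simp
    also have "\<dots> \<le> (1 - t\<^sup>2 / 2)^2 + 2 * (1 / 2) * (10 / 36 * q) + (10 / 36 * q)^2"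
      using q0 by (simp add: add_increasing2)
    also have "\<dots> \<le> (1 - t\<^sup>2 / 2)^2 + 2 * (1 - t\<^sup>2 / 2) * (10 / 36 * q) + (10 / 36 * q)^2"
      using t2 q0 by (intro add_mono mult_right_mono) auto
    also have "\<dots> = (1 - t\<^sup>2 / 2 + 10 / 36 * q)^2"
      unfolding power2_sum[of "1 - t\<^sup>2 / 2"] by simp
    finally show ?thesis .
  qed
  have "norm (char M t) \<le> norm (1 - t\<^sup>2 / 2 - \<i> * (t ^ 3 * third_moment / 6)) + norm (char M t - (1 - t\<^sup>2 / 2 - \<i> * (t ^ 3 * third_moment / 6)))"
    by (rule norm_triangle_sub)
  also have "\<dots> \<le> (1 - t\<^sup>2 / 2 + 10 / 36 * q) + q / 8"
    using power2_le_imp_le[OF sq] t2 q0 char_expansion[of t] unfolding q_def by (intro add_mono) auto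
  also have "\<dots> \<le> 1 + (- t\<^sup>2 / 2 + q / 2)" using q0 by simp
  also have "\<dots> \<le> exp (- t\<^sup>2 / 2 + q / 2)" by (rule exp_ge_add_one_self)
  finally show ?thesis by (simp add: q_def)
qed

lemma norm_char_le_good:
  assumes "t^2 * fourth_moment \<le> 1 / 2"
  shows "norm (char M t) \<le> exp (- t\<^sup>2 / 4)"
proof -
  have "t ^ 4 * fourth_moment = t^2 * (t^2 * fourth_moment)" by (simp add: power2_eq_square power4_eq_xxxx)
  also have "\<dots> \<le> t^2 * (1 / 2)" using assms by (intro mult_left_mono) auto
  finally have "- t\<^sup>2 / 2 + t ^ 4 * fourth_moment / 2 \<le> - t\<^sup>2 / 4" by simp
  then show ?thesis using norm_char_le[of t] by (meson exp_le_cancel_iff order_trans)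
qed

text \<open>
  Averaging \<open>\<bar>char M\<bar>\<^sup>2\<close> over a Gaussian argument gives \<open>E exp (- u\<^sup>2 (X - Y)\<^sup>2 / 2)\<close> with \<open>Y\<close> an
  independent copy of \<open>X\<close>. This decays even where \<open>char M\<close> itself does not, e.g. for lattice laws.
\<close>

lemma gaussian_average_norm_char:
  assumes v: "0 \<le> v" "v \<le> u^2 / 2" "v * (4 * fourth_moment) \<le> 1"
  shows "(\<integral>\<^sup>+z. ennreal (norm (char M (u * z))) \<partial>std_gauss) \<le> ennreal (exp (- v / 2))"
proof -
  let ?N = std_gauss
  interpret NM: pair_prob_space ?N M ..
  have [measurable]: "cnj \<in> borel_measurable borel"
    by (intro borel_measurable_continuous_onI continuous_intros)
  have char1: "norm (char M t) \<le> 1" for t by (rule cmod_char_le_1)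
  have sq_eq: "complex_of_real (LINT z|?N. (norm (char M (u * z)))^2) = (LINT x|M. LINT y|M. complex_of_real (exp (- (u * (x - y))\<^sup>2 / 2)))"
  proof -
    have int1: "integrable (?N \<Otimes>\<^sub>M M) (\<lambda>(z, x). iexp (u * z * x) * cnj (char M (u * z)))"
      by (rule NM.integrable_const_bound[where B = 1])
        (auto simp: split_beta' norm_mult char1 simp del: of_real_mult)
    have int2: "integrable (?N \<Otimes>\<^sub>M M) (\<lambda>(z, y). iexp (u * z * x) * iexp (- (u * z * y)))" for x
      by (rule NM.integrable_const_bound[where B = 1])
        (auto simp: split_beta' norm_mult simp del: of_real_mult of_real_minus)
    have cnj: "cnj (char M t) = (LINT y|M. iexp (- (t * y)))" for t
      unfolding char_def by (subst Bochner_Integration.integral_cnj[symmetric]) (simp add: exp_cnj)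
    have "complex_of_real (LINT z|?N. (norm (char M (u * z)))^2) = (LINT z|?N. char M (u * z) * cnj (char M (u * z)))"
      by (subst integral_complex_of_real[symmetric]) (simp only: complex_norm_square)
    also have "\<dots> = (LINT z|?N. LINT x|M. iexp (u * z * x) * cnj (char M (u * z)))"
      unfolding char_def by (simp only: integral_mult_left_zero)
    also have "\<dots> = (LINT x|M. LINT z|?N. iexp (u * z * x) * cnj (char M (u * z)))"
      by (rule NM.Fubini_integral[OF int1, symmetric])
    also have "\<dots> = (LINT x|M. LINT z|?N. LINT y|M. iexp (u * z * x) * iexp (- (u * z * y)))"
      unfolding cnj by (simp only: integral_mult_right_zero)
    also have "\<dots> = (LINT x|M. LINT y|M. LINT z|?N. iexp (u * z * x) * iexp (- (u * z * y)))"
      by (intro LINT_cong refl NM.Fubini_integral[OF int2, symmetric])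
    also have "\<dots> = (LINT x|M. LINT y|M. char ?N (u * (x - y)))"
      unfolding char_def by (intro LINT_cong refl) (simp add: algebra_simps flip: exp_add)
    finally show ?thesis by (simp only: char_std_normal_distribution)
  qed
  \<comment> \<open>The given u may be too large for an expansion, so u^2 / 2 is first lowered to v;
    the quadratic bound for exp then involves only moments up to order four. After integration over
    x this amounts to E (X - Y)^2 = 2 and E (X - Y)^4 = 2 m4 + 6.\<close>
  have inner: "(LINT y|M. exp (- (u * (x - y))\<^sup>2 / 2)) \<le>
      1 - v * (x^2 + 1) + v^2 / 2 * (x ^ 4 + 6 * x^2 - 4 * third_moment * x + fourth_moment)" for x
  proof -
    have "(LINT y|M. exp (- (u * (x - y))\<^sup>2 / 2)) \<le> (LINT y|M. 1 - v * (x - y)^2 + v^2 / 2 * (x - y) ^ 4)"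
    proof (rule integral_mono)
      show "integrable M (\<lambda>y. exp (- (u * (x - y))\<^sup>2 / 2))"
        by (rule integrable_const_bound[where B = 1]) auto
      have "(\<lambda>y. 1 - v * (x - y)^2 + v^2 / 2 * (x - y) ^ 4) =
        (\<lambda>y. 1 - v * (x^2 - 2 * x * y + y^2) + v^2 / 2 * (x ^ 4 - 4 * x ^ 3 * y + 6 * x^2 * y^2 - 4 * x * y ^ 3 + y ^ 4))"
        by (auto simp: fun_eq_iff power2_eq_square power3_eq_cube power4_eq_xxxx algebra_simps)
      then show "integrable M (\<lambda>y. 1 - v * (x - y)^2 + v^2 / 2 * (x - y) ^ 4)" by simp
      fix y :: real
      have "v * (x - y)^2 \<le> u^2 / 2 * (x - y)^2" using v by (intro mult_right_mono) auto
      then have "exp (- (u * (x - y))\<^sup>2 / 2) \<le> exp (- (v * (x - y)^2))" by (simp add: power_mult_distrib)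
      also have "\<dots> \<le> 1 - v * (x - y)^2 + (v * (x - y)^2)^2 / 2" using v by (intro exp_neg_le_quadratic) auto
      also have "(v * (x - y)^2)^2 / 2 = v^2 / 2 * (x - y) ^ 4" by (simp add: power_mult_distrib flip: power_mult)
      finally show "exp (- (u * (x - y))\<^sup>2 / 2) \<le> 1 - v * (x - y)^2 + v^2 / 2 * (x - y) ^ 4" .
    qed
    also have "\<dots> = (LINT y|M. 1 - v * (x^2 - 2 * x * y + y^2) + v^2 / 2 * (x ^ 4 - 4 * x ^ 3 * y + 6 * x^2 * y^2 - 4 * x * y ^ 3 + y ^ 4))"
      by (intro LINT_cong refl) (auto simp: fun_eq_iff power2_eq_square power3_eq_cube power4_eq_xxxx algebra_simps)
    also have "\<dots> = 1 - v * (x^2 + 1) + v^2 / 2 * (x ^ 4 + 6 * x^2 - 4 * third_moment * x + fourth_moment)"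
      using mean_zero variance_one prob_space by (simp add: third_moment_def fourth_moment_def del: prob_space)
    finally show ?thesis .
  qed
  have "complex_of_real (LINT z|?N. (norm (char M (u * z)))^2) = complex_of_real (LINT x|M. LINT y|M. exp (- (u * (x - y))\<^sup>2 / 2))"
    unfolding sq_eq by (simp only: integral_complex_of_real)
  then have "(LINT z|?N. (norm (char M (u * z)))^2) = (LINT x|M. LINT y|M. exp (- (u * (x - y))\<^sup>2 / 2))"
    by (simp only: of_real_eq_iff)
  also have "\<dots> \<le> (LINT x|M. 1 - v * (x^2 + 1) + v^2 / 2 * (x ^ 4 + 6 * x^2 - 4 * third_moment * x + fourth_moment))"
  proof (rule integral_mono)
    have "\<bar>LINT y|M. exp (- (u * (x - y))\<^sup>2 / 2)\<bar> \<le> 1" for x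
    proof -
      have "(LINT y|M. exp (- (u * (x - y))\<^sup>2 / 2)) \<le> (LINT y|M. 1)"
        by (intro integral_mono integrable_const_bound[where B = 1]) auto
      moreover have "0 \<le> (LINT y|M. exp (- (u * (x - y))\<^sup>2 / 2))" by (rule integral_nonneg_AE) simp
      ultimately show ?thesis using prob_space by (simp del: prob_space)
    qed
    then show "integrable M (\<lambda>x. LINT y|M. exp (- (u * (x - y))\<^sup>2 / 2))"
      by (intro integrable_const_bound[where B = 1] AE_I2) auto
    show "integrable M (\<lambda>x. 1 - v * (x^2 + 1) + v^2 / 2 * (x ^ 4 + 6 * x^2 - 4 * third_moment * x + fourth_moment))"
      by simp
  qed (rule inner)
  also have "\<dots> = 1 - 2 * v + v^2 * (fourth_moment + 3)"
    using mean_zero variance_one prob_space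
    by (simp add: fourth_moment_def[symmetric] algebra_simps del: prob_space)
  also have "\<dots> \<le> 1 - v"
  proof -
    have "v^2 * (fourth_moment + 3) \<le> v^2 * (4 * fourth_moment)"
      using one_le_fourth_moment by (intro mult_left_mono) auto
    also have "\<dots> = v * (v * (4 * fourth_moment))" by (simp add: power2_eq_square)
    also have "\<dots> \<le> v * 1" using v by (intro mult_left_mono) auto
    finally show ?thesis by simp
  qed
  also have "\<dots> \<le> exp (- v)" using exp_ge_add_one_self[of "- v"] by simp
  finally have sq: "(LINT z|?N. (norm (char M (u * z)))^2) \<le> exp (- v)" .
  \<comment> \<open>With this a, the inequality 2 a y <= y^2 + a^2 passes from the second moment
    bound a^2 to the first moment bound a.\<close>
  define a where "a = exp (- v / 2)"
  have a: "0 < a" "a * a = exp (- v)" by (auto simp: a_def simp flip: exp_add)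
  have i1: "integrable ?N (\<lambda>z. norm (char M (u * z)))"
    by (rule std_normal.integrable_const_bound[where B = 1]) (auto simp: char1)
  have i2: "integrable ?N (\<lambda>z. (norm (char M (u * z)))^2)"
    by (rule std_normal.integrable_const_bound[where B = 1]) (auto simp: char1 abs_square_le_1)
  have "(LINT z|?N. norm (char M (u * z))) \<le> (LINT z|?N. (norm (char M (u * z)))^2 / (2 * a) + a / 2)"
  proof (rule integral_mono[OF i1])
    fix z :: real
    have "2 * a * norm (char M (u * z)) \<le> (norm (char M (u * z)))^2 + a * a"
      using zero_le_power2[of "norm (char M (u * z)) - a"] by (simp add: power2_eq_square algebra_simps)
    then show "norm (char M (u * z)) \<le> (norm (char M (u * z)))^2 / (2 * a) + a / 2"
      using a(1) by (simp add: field_simps)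
  qed (use i2 in simp)
  also have "\<dots> = (LINT z|?N. (norm (char M (u * z)))^2) / (2 * a) + a / 2"
    using i2 std_normal.prob_space by (simp del: std_normal.prob_space)
  also have "\<dots> \<le> (a * a) / (2 * a) + a / 2"
    using sq a by (intro add_mono divide_right_mono) auto
  also have "\<dots> = a" using a(1) by (simp add: field_simps)
  finally have "(LINT z|?N. norm (char M (u * z))) \<le> a" .
  then show ?thesis
    using i1 by (subst nn_integral_eq_integral) (auto simp: a_def intro!: ennreal_leI)
qed

end

lemma norm_exp_minus_one_minus_le:
  assumes "Re z \<le> 0" "- 1 \<le> 2 * Re z"
  shows "norm (exp z - (1 + z)) \<le> 2 * (norm z)^2"
proof -
  have "norm (exp z - (\<Sum>k\<le>1. z ^ k / fact k)) \<le> exp \<bar>Re z\<bar> * norm z ^ Suc 1 / fact 1"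
    by (rule Taylor_exp)
  then have "norm (exp z - (1 + z)) \<le> exp \<bar>Re z\<bar> * (norm z)^2"
    by (simp add: One_nat_def numeral_2_eq_2)
  also have "\<dots> \<le> 2 * (norm z)^2"
  proof (rule mult_right_mono)
    have "exp \<bar>Re z\<bar> \<le> exp (1 / 2)" using assms by simp
    also have "\<dots> \<le> 2" using exp_half_le2 by simp
    finally show "exp \<bar>Re z\<bar> \<le> 2" .
  qed simp
  finally show ?thesis .
qed

text \<open>With z the exponent, both terms are 1 + z up to multiples of t^4 m4. The hypothesis lets
  the sixth order part of |z|^2 count as fourth order and keeps Re z above - 1/2.\<close>

lemma (in standardized_law) char_minus_exp_cubic:
  assumes "t^2 \<le> 1"
  shows "norm (char M t - exp (- t\<^sup>2 / 2 - \<i> * (t ^ 3 * third_moment / 6))) \<le> t ^ 4 * fourth_moment"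
proof -
  define z where "z = complex_of_real (- t\<^sup>2 / 2) - \<i> * (t ^ 3 * third_moment / 6)"
  have "(norm z)^2 = t ^ 4 / 4 + t^2 * (t ^ 4 * third_moment^2) / 36"
    unfolding z_def cmod_power2
    by (simp add: power_mult_distrib power_divide power2_eq_square power4_eq_xxxx power3_eq_cube mult_ac)
  also have "\<dots> \<le> t ^ 4 * fourth_moment / 4 + 1 * (t ^ 4 * fourth_moment) / 36"
    using assms third_moment_square_le mult_left_mono[OF one_le_fourth_moment, of "t ^ 4"]
    by (intro add_mono divide_right_mono mult_mono) auto
  finally have z2: "(norm z)^2 \<le> 10 / 36 * (t ^ 4 * fourth_moment)" by (simp add: mult.commute)
  have "char M t - exp z = (char M t - (1 + z)) - (exp z - (1 + z))" by simp
  also have "norm \<dots> \<le> norm (char M t - (1 + z)) + norm (exp z - (1 + z))" by (rule norm_triangle_ineq4)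
  also have "norm (char M t - (1 + z)) \<le> t ^ 4 * fourth_moment / 8"
    using char_expansion[of t] by (simp add: z_def algebra_simps)
  also have "norm (exp z - (1 + z)) \<le> 2 * (norm z)^2"
    by (rule norm_exp_minus_one_minus_le) (use assms in \<open>auto simp: z_def\<close>)
  finally have "norm (char M t - exp z) \<le> t ^ 4 * fourth_moment / 8 + 2 * (10 / 36 * (t ^ 4 * fourth_moment))"
    using z2 by linarith
  also have "\<dots> \<le> t ^ 4 * fourth_moment" using one_le_fourth_moment by simp
  finally show ?thesis by (simp add: z_def)
qed

section \<open>The characteristic function of a linear form at moderate frequencies\<close>

locale standardized_family =
  fixes n :: nat and \<mu> :: "nat \<Rightarrow> real measure"
  assumes one_le_n: "1 \<le> n"
    and standardized: "j \<in> {1..n} \<Longrightarrow> standardized_law (\<mu> j)"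
begin

abbreviation m3 :: "nat \<Rightarrow> real" where "m3 j \<equiv> standardized_law.third_moment (\<mu> j)"
abbreviation m4 :: "nat \<Rightarrow> real" where "m4 j \<equiv> standardized_law.fourth_moment (\<mu> j)"

definition sum_char :: "(nat \<Rightarrow> real) \<Rightarrow> real \<Rightarrow> complex" where
  "sum_char \<theta> t = (\<Prod>j=1..n. char (\<mu> j) (\<theta> j * t))"

definition cubic_sum :: "(nat \<Rightarrow> real) \<Rightarrow> real" where
  "cubic_sum \<theta> = (\<Sum>j=1..n. \<theta> j ^ 3 * m3 j)"

text \<open>The part of |\<theta>|^2 carried by the coordinates for which
  \<open>norm_char_le_good\<close> is available at every |t| <= R.\<close>

abbreviation controlled_mass :: "real \<Rightarrow> (nat \<Rightarrow> real) \<Rightarrow> real" where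
  "controlled_mass R \<theta> \<equiv> \<Sum>j\<in>{j\<in>{1..n}. (\<theta> j)^2 * m4 j * R^2 \<le> 1 / 2}. (\<theta> j)^2"

definition quartic_sum :: "(nat \<Rightarrow> real) \<Rightarrow> real" where
  "quartic_sum \<theta> = (\<Sum>j=1..n. \<theta> j ^ 4 * m4 j)"

lemma one_le_m4: "j \<in> {1..n} \<Longrightarrow> 1 \<le> m4 j"
  using standardized standardized_law.one_le_fourth_moment by blast

lemma m4_nonneg: "j \<in> {1..n} \<Longrightarrow> 0 \<le> m4 j"
  using one_le_m4[of j] by linarith

lemma norm_char_le_1: "j \<in> {1..n} \<Longrightarrow> norm (char (\<mu> j) t) \<le> 1"
  using standardized[THEN standardized_law.axioms(1)] real_distribution.cmod_char_le_1 by blast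

lemma quartic_sum_nonneg: "0 \<le> quartic_sum \<theta>"
  unfolding quartic_sum_def by (intro sum_nonneg mult_nonneg_nonneg m4_nonneg) auto

text \<open>
  The factors \<open>a j\<close> and the cubic approximations \<open>b j\<close> are divided by the common majorant \<open>c j\<close>
  before telescoping, so that the Gaussian decay of the whole product is kept.
\<close>

lemma sum_char_near:
  assumes \<theta>: "(\<Sum>j=1..n. (\<theta> j)^2) = 1" and small: "t ^ 4 * quartic_sum \<theta> \<le> 1"
  shows "norm (sum_char \<theta> t - exp (- t\<^sup>2 / 2)) \<le>
    4 * exp (- t\<^sup>2 / 2) * (t ^ 4 * quartic_sum \<theta> + \<bar>t\<bar> ^ 3 * \<bar>cubic_sum \<theta>\<bar>)"
proof -
  define s where "s j = \<theta> j * t" for j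
  define a where "a j = char (\<mu> j) (s j)" for j
  define b where "b j = exp (- (s j)\<^sup>2 / 2 - \<i> * (s j ^ 3 * m3 j / 6))" for j
  define c where "c j = exp (- (s j)\<^sup>2 / 2 + s j ^ 4 * m4 j / 2)" for j
  have s2: "(\<Sum>j=1..n. (s j)^2) = t^2"
    using \<theta> by (simp add: s_def power_mult_distrib flip: sum_distrib_right)
  have s4: "(\<Sum>j=1..n. s j ^ 4 * m4 j) = t ^ 4 * quartic_sum \<theta>"
    by (simp add: s_def power_mult_distrib quartic_sum_def sum_distrib_left mult_ac)
  have s3: "(\<Sum>j=1..n. s j ^ 3 * m3 j) = t ^ 3 * cubic_sum \<theta>"
    by (simp add: s_def power_mult_distrib cubic_sum_def sum_distrib_left mult_ac)
  have cpos: "0 < c j" for j by (simp add: c_def)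
  have m4: "1 \<le> m4 j" if "j \<in> {1..n}" for j using one_le_m4 that by auto
  \<comment> \<open>Every fourth moment is at least 1, so smallness of the whole quartic sum forces
    each argument into [-1, 1], as \<open>char_minus_exp_cubic\<close> requires.\<close>
  have s_small: "(s j)^2 \<le> 1" if j: "j \<in> {1..n}" for j
  proof -
    have "s j ^ 4 * 1 \<le> s j ^ 4 * m4 j" using m4[OF j] by (intro mult_left_mono) auto
    also have "\<dots> \<le> (\<Sum>j=1..n. s j ^ 4 * m4 j)"
      by (intro member_le_sum[OF j] mult_nonneg_nonneg m4_nonneg) auto
    also have "\<dots> \<le> 1" using small s4 by simp
    finally have "((s j)^2)^2 \<le> 1^2" by (simp flip: power_mult)
    then show ?thesis by (rule power2_le_imp_le) simp
  qed
  have ca: "norm (a j / c j) \<le> 1" if j: "j \<in> {1..n}" for j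
    using standardized_law.norm_char_le[OF standardized[OF j], of "s j"] cpos[of j]
    by (simp add: a_def norm_divide c_def)
  have cb: "norm (b j / c j) \<le> 1" if j: "j \<in> {1..n}" for j
  proof -
    have "norm (b j) = exp (- (s j)\<^sup>2 / 2)" by (simp add: b_def norm_exp_eq_Re)
    also have "\<dots> \<le> c j" using m4[OF j] by (simp add: c_def)
    finally show ?thesis using cpos[of j] by (simp add: norm_divide)
  qed
  \<comment> \<open>All majorants together exceed the Gaussian factor by no more than exp (1 /
    2).\<close>
  have prod_c: "(\<Prod>j=1..n. c j) \<le> 2 * exp (- t\<^sup>2 / 2)"
  proof -
    have "(\<Prod>j=1..n. c j) = exp (- t\<^sup>2 / 2 + t ^ 4 * quartic_sum \<theta> / 2)"
      unfolding c_def s2[symmetric] s4[symmetric]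
      by (simp add: exp_sum[symmetric] sum_subtractf sum_divide_distrib)
    also have "\<dots> \<le> exp (- t\<^sup>2 / 2 + 1 / 2)" using small by simp
    also have "\<dots> = exp (1 / 2) * exp (- t\<^sup>2 / 2)" by (simp flip: exp_add)
    also have "\<dots> \<le> 2 * exp (- t\<^sup>2 / 2)" using exp_half_le2 by (intro mult_right_mono) auto
    finally show ?thesis .
  qed
  \<comment> \<open>Dividing by \<open>c j\<close> costs at most a factor 2, because
    \<open>c j\<close> is at least exp (- 1/2) for arguments in [-1, 1].\<close>
  have factor: "norm (a j / c j - b j / c j) \<le> 2 * (s j ^ 4 * m4 j)" if j: "j \<in> {1..n}" for j
  proof -
    have "norm (a j - b j) \<le> s j ^ 4 * m4 j"
      unfolding a_def b_def
      using standardized_law.char_minus_exp_cubic[OF standardized[OF j] s_small[OF j]] by simp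
    moreover have "1 \<le> 2 * c j"
    proof -
      have "exp (- (1 / 2)) \<le> c j" unfolding c_def
        using s_small[OF j] m4[OF j] by (intro iffD2[OF exp_le_cancel_iff]) (auto intro!: add_increasing2 simp: field_simps)
      moreover have "1 \<le> 2 * exp (- (1 / 2) :: real)"
        using exp_half_le2 by (simp add: exp_minus field_simps)
      ultimately show ?thesis by linarith
    qed
    moreover have "norm (a j / c j - b j / c j) = norm (a j - b j) / c j"
      using cpos[of j] by (simp add: norm_divide flip: diff_divide_distrib)
    moreover have "norm (a j - b j) * 1 \<le> (s j ^ 4 * m4 j) * (2 * c j)"
      using \<open>1 \<le> 2 * c j\<close> \<open>norm (a j - b j) \<le> s j ^ 4 * m4 j\<close> m4_nonneg[OF j]
      by (intro mult_mono) auto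
    ultimately show ?thesis
      using cpos[of j] by (simp add: pos_divide_le_eq mult_ac)
  qed
  have "norm ((\<Prod>j=1..n. a j) - (\<Prod>j=1..n. b j)) =
      (\<Prod>j=1..n. c j) * norm ((\<Prod>j=1..n. a j / c j) - (\<Prod>j=1..n. b j / c j))"
  proof -
    have "(\<Prod>j=1..n. c j) > 0" using cpos by (intro prod_pos) auto
    moreover have "(\<Prod>j=1..n. a j / c j) - (\<Prod>j=1..n. b j / c j) =
        ((\<Prod>j=1..n. a j) - (\<Prod>j=1..n. b j)) / complex_of_real (\<Prod>j=1..n. c j)"
      by (simp add: prod_dividef diff_divide_distrib)
    ultimately show ?thesis by (simp only: norm_divide norm_of_real) (simp add: cpos[THEN less_imp_neq, symmetric])
  qed
  also have "\<dots> \<le> (2 * exp (- t\<^sup>2 / 2)) * (2 * (t ^ 4 * quartic_sum \<theta>))"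
  proof (rule mult_mono[OF prod_c])
    have "norm ((\<Prod>j=1..n. a j / c j) - (\<Prod>j=1..n. b j / c j)) \<le> (\<Sum>j=1..n. norm (a j / c j - b j / c j))"
      by (rule norm_prod_diff) (use ca cb in auto)
    also have "\<dots> \<le> (\<Sum>j=1..n. 2 * (s j ^ 4 * m4 j))" by (intro sum_mono factor)
    also have "\<dots> = 2 * (t ^ 4 * quartic_sum \<theta>)" by (simp only: s4[symmetric] sum_distrib_left)
    finally show "norm ((\<Prod>j=1..n. a j / c j) - (\<Prod>j=1..n. b j / c j)) \<le> 2 * (t ^ 4 * quartic_sum \<theta>)" .
  qed auto
  finally have 1: "norm (sum_char \<theta> t - (\<Prod>j=1..n. b j)) \<le> 4 * exp (- t\<^sup>2 / 2) * (t ^ 4 * quartic_sum \<theta>)"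
    by (simp add: sum_char_def a_def s_def)
  \<comment> \<open>The exponents of the approximants add up exactly: the product is a Gaussian
    times a phase that contains \<open>cubic_sum\<close> with its signs, so the cancellation between
    coordinates survives.\<close>
  have "(\<Prod>j=1..n. b j) = exp (\<Sum>j=1..n. complex_of_real (- (s j)\<^sup>2 / 2) - \<i> * complex_of_real (s j ^ 3 * m3 j / 6))"
    unfolding b_def by (subst exp_sum) simp_all
  also have "(\<Sum>j=1..n. complex_of_real (- (s j)\<^sup>2 / 2) - \<i> * complex_of_real (s j ^ 3 * m3 j / 6)) =
      complex_of_real (- (\<Sum>j=1..n. (s j)^2) / 2) - \<i> * complex_of_real ((\<Sum>j=1..n. s j ^ 3 * m3 j) / 6)"
    unfolding sum_subtractf sum_distrib_left[symmetric] of_real_sum[symmetric]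
      sum_divide_distrib[symmetric] sum_negf ..
  also have "\<dots> = complex_of_real (- t\<^sup>2 / 2) + \<i> * complex_of_real (- (t ^ 3 * cubic_sum \<theta>) / 6)"
    unfolding s2 s3 by simp
  finally have prod_b: "(\<Prod>j=1..n. b j) = exp (complex_of_real (- t\<^sup>2 / 2)) * iexp (- (t ^ 3 * cubic_sum \<theta>) / 6)"
    by (simp only: exp_add)
  have "(\<Prod>j=1..n. b j) - exp (- t\<^sup>2 / 2) = exp (- t\<^sup>2 / 2) * (iexp (- (t ^ 3 * cubic_sum \<theta>) / 6) - 1)"
    unfolding prod_b by (simp only: exp_of_real right_diff_distrib mult_1_right)
  also have "norm \<dots> = exp (- t\<^sup>2 / 2) * norm (iexp (- (t ^ 3 * cubic_sum \<theta>) / 6) - 1)"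
    by (simp only: norm_mult norm_of_real abs_exp_cancel)
  also have "norm (iexp (- (t ^ 3 * cubic_sum \<theta>) / 6) - 1) \<le> \<bar>- (t ^ 3 * cubic_sum \<theta>) / 6\<bar>"
    using iexp_approx1[of "- (t ^ 3 * cubic_sum \<theta>) / 6" 0] by (simp add: One_nat_def)
  also have "\<dots> \<le> 4 * (\<bar>t\<bar> ^ 3 * \<bar>cubic_sum \<theta>\<bar>)" by (simp add: abs_mult power_abs)
  finally have 2: "norm ((\<Prod>j=1..n. b j) - exp (- t\<^sup>2 / 2)) \<le> exp (- t\<^sup>2 / 2) * (4 * (\<bar>t\<bar> ^ 3 * \<bar>cubic_sum \<theta>\<bar>))"
    by simp
  have "norm (sum_char \<theta> t - exp (- t\<^sup>2 / 2)) \<le> norm (sum_char \<theta> t - (\<Prod>j=1..n. b j)) + norm ((\<Prod>j=1..n. b j) - exp (- t\<^sup>2 / 2))"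
    unfolding dist_norm[symmetric] by (rule dist_triangle)
  then show ?thesis using 1 2 by (simp add: algebra_simps)
qed

lemma norm_sum_char_le:
  assumes G: "G \<subseteq> {1..n}" and mass: "\<kappa> \<le> (\<Sum>j\<in>G. (\<theta> j)^2)"
    and good: "\<And>j. j \<in> G \<Longrightarrow> (\<theta> j)^2 * m4 j * t^2 \<le> 1 / 2"
  shows "norm (sum_char \<theta> t) \<le> exp (- (\<kappa> * t^2) / 4)"
proof -
  have "norm (sum_char \<theta> t) = (\<Prod>j\<in>{1..n}. norm (char (\<mu> j) (\<theta> j * t)))"
    by (simp add: sum_char_def prod_norm)
  also have "\<dots> = (\<Prod>j\<in>G. norm (char (\<mu> j) (\<theta> j * t))) * (\<Prod>j\<in>{1..n} - G. norm (char (\<mu> j) (\<theta> j * t)))"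
    using prod.subset_diff[OF G] by (simp add: mult.commute)
  also have "\<dots> \<le> (\<Prod>j\<in>G. exp (- (\<theta> j * t)\<^sup>2 / 4)) * 1"
  proof (rule mult_mono)
    show "(\<Prod>j\<in>G. norm (char (\<mu> j) (\<theta> j * t))) \<le> (\<Prod>j\<in>G. exp (- (\<theta> j * t)\<^sup>2 / 4))"
    proof (rule prod_mono, rule conjI)
      fix j assume j: "j \<in> G"
      then interpret standardized_law "\<mu> j" using G standardized by auto
      show "norm (char (\<mu> j) (\<theta> j * t)) \<le> exp (- (\<theta> j * t)\<^sup>2 / 4)"
        by (rule norm_char_le_good) (use good[OF j] in \<open>simp add: power_mult_distrib mult_ac\<close>)
    qed simp
    show "(\<Prod>j\<in>{1..n} - G. norm (char (\<mu> j) (\<theta> j * t))) \<le> 1"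
      using norm_char_le_1 by (intro prod_le_1) auto
  qed (auto intro!: prod_nonneg)
  also have "\<dots> = exp (- ((\<Sum>j\<in>G. (\<theta> j)^2) * t^2) / 4)"
    using finite_subset[OF G]
    by (simp add: exp_sum[symmetric] power_mult_distrib sum_distrib_right sum_divide_distrib sum_negf)
  also have "\<dots> \<le> exp (- (\<kappa> * t^2) / 4)"
    using mult_right_mono[OF mass, of "t^2"] by simp
  finally show ?thesis .
qed

lemma sum_char_diff_le:
  assumes \<theta>: "(\<Sum>j=1..n. (\<theta> j)^2) = 1"
    and mass: "\<kappa> \<le> controlled_mass R \<theta>"
    and t: "\<bar>t\<bar> \<le> R"
  shows "norm (sum_char \<theta> t - exp (- t\<^sup>2 / 2)) \<le>
    4 * exp (- (\<kappa> * t^2) / 4) * (t ^ 4 * quartic_sum \<theta> + \<bar>t\<bar> ^ 3 * \<bar>cubic_sum \<theta>\<bar>)"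
proof -
  have "controlled_mass R \<theta> \<le> (\<Sum>j=1..n. (\<theta> j)^2)"
    by (intro sum_mono2) auto
  \<comment> \<open>The controlled mass is at most 1, so the Gaussian decays at least as fast as the
    bound for \<open>sum_char\<close>, and one decay rate serves both cases below.\<close>
  then have \<kappa>1: "\<kappa> \<le> 1" using mass \<theta> by linarith
  then have "\<kappa> * t^2 \<le> 1 * t^2" by (intro mult_right_mono) auto
  then have e: "exp (- t\<^sup>2 / 2) \<le> exp (- (\<kappa> * t^2) / 4)"
    using zero_le_power2[of t] by (intro iffD2[OF exp_le_cancel_iff]) linarith
  define Q where "Q = t ^ 4 * quartic_sum \<theta> + \<bar>t\<bar> ^ 3 * \<bar>cubic_sum \<theta>\<bar>"
  have Q0: "t ^ 4 * quartic_sum \<theta> \<le> Q" "0 \<le> Q" using quartic_sum_nonneg[of \<theta>] by (auto simp: Q_def)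
  show ?thesis
  proof (cases "t ^ 4 * quartic_sum \<theta> \<le> 1")
    case True
    have "norm (sum_char \<theta> t - exp (- t\<^sup>2 / 2)) \<le> 4 * exp (- t\<^sup>2 / 2) * Q"
      unfolding Q_def by (rule sum_char_near[OF \<theta> True])
    also have "\<dots> \<le> 4 * exp (- (\<kappa> * t^2) / 4) * Q" using e Q0 by (intro mult_right_mono mult_left_mono) auto
    finally show ?thesis by (simp add: Q_def)
  next
    case False
    have "norm (sum_char \<theta> t) \<le> exp (- (\<kappa> * t^2) / 4)"
    proof (rule norm_sum_char_le[OF _ mass])
      fix j assume j: "j \<in> {j \<in> {1..n}. (\<theta> j)^2 * m4 j * R^2 \<le> 1 / 2}"
      have "t^2 \<le> R^2" using t by (simp add: abs_le_square_iff[symmetric])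
      then have "(\<theta> j)^2 * m4 j * t^2 \<le> (\<theta> j)^2 * m4 j * R^2"
        using one_le_m4[of j] j by (intro mult_left_mono) auto
      then show "(\<theta> j)^2 * m4 j * t^2 \<le> 1 / 2" using j by simp
    qed auto
    moreover have "norm (sum_char \<theta> t - exp (- t\<^sup>2 / 2)) \<le> norm (sum_char \<theta> t) + exp (- t\<^sup>2 / 2)"
      using norm_triangle_ineq4[of "sum_char \<theta> t" "exp (- t\<^sup>2 / 2)"] by (simp only: norm_of_real abs_exp_cancel)
    ultimately have "norm (sum_char \<theta> t - exp (- t\<^sup>2 / 2)) \<le> 4 * exp (- (\<kappa> * t^2) / 4) * 1"
      using e exp_ge_zero[of "- (\<kappa> * t^2) / 4"] by linarith
    also have "\<dots> \<le> 4 * exp (- (\<kappa> * t^2) / 4) * Q" using False Q0 by (intro mult_left_mono) auto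
    finally show ?thesis by (simp add: Q_def)
  qed
qed

end

section \<open>Tail bounds for Gaussian vectors\<close>

text \<open>Markov's inequality with values in \<open>ennreal\<close>, so that it applies to the
  tail integral \<open>sum_char_tail\<close>.\<close>

lemma (in prob_space) prob_ge_le_exp:
  assumes [measurable]: "f \<in> borel_measurable M" and c: "0 < c"
    and le: "(\<integral>\<^sup>+x. f x \<partial>M) \<le> ennreal (exp (- p) * c)"
  shows "prob {x \<in> space M. ennreal c \<le> f x} \<le> exp (- p)"
proof -
  have "emeasure M {x \<in> space M. ennreal c \<le> f x} = emeasure M {x \<in> space M. 1 \<le> ennreal (1 / c) * f x}"
  proof (rule arg_cong[where f = "emeasure M"], rule Collect_cong, rule conj_cong[OF refl])
    fix x
    have "ennreal (1 / c) * ennreal c = 1" "ennreal c * ennreal (1 / c) = 1"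
      using c by (simp_all add: ennreal_mult[symmetric])
    then show "ennreal c \<le> f x \<longleftrightarrow> 1 \<le> ennreal (1 / c) * f x"
      using mult_left_mono[of "ennreal c" "f x" "ennreal (1 / c)"]
        mult_left_mono[of 1 "ennreal (1 / c) * f x" "ennreal c"]
      by (auto simp: mult.assoc[symmetric])
  qed
  also have "\<dots> \<le> ennreal (1 / c) * (\<integral>\<^sup>+x. f x * indicator (space M) x \<partial>M)"
    by (rule nn_integral_Markov_inequality) auto
  also have "(\<integral>\<^sup>+x. f x * indicator (space M) x \<partial>M) = (\<integral>\<^sup>+x. f x \<partial>M)"
    by (intro nn_integral_cong) auto
  also have "ennreal (1 / c) * \<dots> \<le> ennreal (1 / c) * ennreal (exp (- p) * c)"
    by (intro mult_left_mono le) auto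
  also have "\<dots> = ennreal (exp (- p))" using c by (subst ennreal_mult[symmetric]) auto
  finally show ?thesis by (simp add: emeasure_eq_measure)
qed

lemma (in prob_space) prob_chernoff:
  fixes f :: "'a \<Rightarrow> real"
  assumes [measurable]: "f \<in> borel_measurable M"
    and le: "(\<integral>\<^sup>+x. ennreal (exp (f x)) \<partial>M) \<le> ennreal (exp (b - p))"
  shows "prob {x \<in> space M. b \<le> f x} \<le> exp (- p)"
proof -
  have "prob {x \<in> space M. b \<le> f x} = prob {x \<in> space M. ennreal (exp b) \<le> ennreal (exp (f x))}"
    by (simp add: ennreal_le_iff)
  also have "\<dots> \<le> exp (- p)"
    by (rule prob_ge_le_exp) (use le in \<open>auto simp flip: exp_add\<close>)
  finally show ?thesis .
qed

lemma prod_mono_ennreal: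
  fixes f g :: "'i \<Rightarrow> ennreal"
  shows "(\<And>i. i \<in> I \<Longrightarrow> f i \<le> g i) \<Longrightarrow> prod f I \<le> prod g I"
  by (induction I rule: infinite_finite_induct) (auto intro!: mult_mono)

lemma gaussian_nn_integral_exp_sum:
  assumes [measurable]: "\<And>j. j \<in> {1..n} \<Longrightarrow> f j \<in> borel_measurable borel"
  shows "(\<integral>\<^sup>+g. ennreal (exp (\<Sum>j=1..n. f j (g j))) \<partial>gaussian n) =
    (\<Prod>j=1..n. \<integral>\<^sup>+z. ennreal (exp (f j z)) \<partial>std_gauss)"
proof -
  interpret G: product_sigma_finite "\<lambda>_::nat. std_gauss"
    by standard
  have "(\<integral>\<^sup>+g. ennreal (exp (\<Sum>j=1..n. f j (g j))) \<partial>gaussian n) = (\<integral>\<^sup>+g. (\<Prod>j=1..n. ennreal (exp (f j (g j)))) \<partial>gaussian n)"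
    by (simp add: exp_sum prod_ennreal)
  also have "\<dots> = (\<Prod>j=1..n. \<integral>\<^sup>+z. ennreal (exp (f j z)) \<partial>std_gauss)"
    by (rule G.product_nn_integral_prod) auto
  finally show ?thesis .
qed

lemma nn_integral_gaussian_component:
  assumes j: "j \<in> {1..n}" and [measurable]: "f \<in> borel_measurable borel"
  shows "(\<integral>\<^sup>+g. f (g j) \<partial>gaussian n) = (\<integral>\<^sup>+z. f z \<partial>std_gauss)"
proof -
  interpret product_prob_space "\<lambda>_::nat. std_gauss" "{1..n}"
    by standard
  have "(\<integral>\<^sup>+z. f z \<partial>std_gauss) = (\<integral>\<^sup>+z. f z \<partial>distr (gaussian n) std_gauss (\<lambda>g. g j))"
    using PiM_component[OF j] by simp
  also have "\<dots> = (\<integral>\<^sup>+g. f (g j) \<partial>gaussian n)"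
    using j by (subst nn_integral_distr) auto
  finally show ?thesis by simp
qed

text \<open>The left side is the moment of order 2 m of a standard normal variable.\<close>

lemma fact_double_le: "fact (2 * m) / (2 ^ m * fact m) \<le> real m ^ m"
proof -
  have "fact (2 * m) div fact (2 * m - m) \<le> (2 * m) ^ m" by (rule fact_div_fact_le_pow) simp
  moreover have "(fact m :: nat) dvd fact (2 * m)" by (intro fact_dvd) simp
  ultimately have "(fact (2 * m) :: nat) \<le> (2 * m) ^ m * fact m"
    by (metis (no_types) add_diff_cancel_left' dvd_div_mult_self mult_2 mult_le_mono1)
  then have "real (fact (2 * m)) \<le> real ((2 * m) ^ m * fact m)" by (simp only: of_nat_le_iff)
  then show ?thesis by (simp add: field_simps power_mult_distrib)
qed

text \<open>Jensen's inequality for x^p and the normalised weights, multiplied by W^p.\<close>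

lemma weighted_power_mean:
  fixes w x :: "'i \<Rightarrow> real"
  assumes "finite I" "\<And>i. i \<in> I \<Longrightarrow> 0 \<le> w i" "\<And>i. i \<in> I \<Longrightarrow> 0 \<le> x i" "1 \<le> p"
  shows "(\<Sum>i\<in>I. w i * x i) ^ p \<le> (\<Sum>i\<in>I. w i) ^ (p - 1) * (\<Sum>i\<in>I. w i * x i ^ p)"
proof (cases "(\<Sum>i\<in>I. w i) = 0")
  case True
  then have "w i = 0" if "i \<in> I" for i using assms that by (subst (asm) sum_nonneg_eq_0_iff) auto
  then show ?thesis using assms by (simp add: power_0_left)
next
  case False
  define W where "W = (\<Sum>i\<in>I. w i)"
  have W: "0 < W" using False sum_nonneg[of I w] assms by (simp add: W_def less_le)
  have I: "I \<noteq> {}" using False by auto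
  have conv: "convex_on {0::real..} (\<lambda>x. x ^ p)"
    by (cases "even p") (auto intro: convex_power_odd convex_on_subset[OF convex_power_even])
  have "(\<Sum>i\<in>I. (w i / W) *\<^sub>R x i) ^ p \<le> (\<Sum>i\<in>I. (w i / W) * x i ^ p)"
    by (rule convex_on_sum[OF _ I conv]) (use assms W in \<open>auto simp: W_def simp flip: sum_divide_distrib\<close>)
  then have "((\<Sum>i\<in>I. w i * x i) / W) ^ p \<le> (\<Sum>i\<in>I. w i * x i ^ p) / W"
    by (simp add: sum_divide_distrib)
  then have "(\<Sum>i\<in>I. w i * x i) ^ p \<le> W ^ p * ((\<Sum>i\<in>I. w i * x i ^ p) / W)"
    using W by (simp add: power_divide field_simps)
  also have "W ^ p = W * W ^ (p - 1)" using assms(4) by (simp add: power_eq_if)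
  finally show ?thesis using W by (simp add: W_def)
qed

text \<open>Fourth and sixth powers of a Gaussian have no exponential moments, so the p-th moment of
  the sum is used: by Jensen it is at most W^p times the moment of order 2 k p of a standard normal,
  hence at most W^p (k p)^(k p). The factor \<open>exp 1\<close> of the threshold becomes exp (- p)
  in Markov's inequality.\<close>

lemma gaussian_power_sum_tail:
  assumes w: "\<And>j. j \<in> {1..n} \<Longrightarrow> 0 \<le> w j" and W: "0 < (\<Sum>j=1..n. w j)" and p: "1 \<le> p" and k: "1 \<le> k"
  shows "measure (gaussian n) {g \<in> space (gaussian n).
      exp 1 * real (k * p) ^ k * (\<Sum>j=1..n. w j) \<le> (\<Sum>j=1..n. w j * g j ^ (2 * k))} \<le> exp (- real p)"
proof -
  interpret G: prob_space "gaussian n" by (rule prob_space_gaussian)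
  define W where "W = (\<Sum>j=1..n. w j)"
  define S where "S g = (\<Sum>j=1..n. w j * g j ^ (2 * k))" for g :: "nat \<Rightarrow> real"
  have [measurable]: "S \<in> borel_measurable (gaussian n)" unfolding S_def by measurable
  have S0: "0 \<le> S g" for g unfolding S_def using w by (intro sum_nonneg mult_nonneg_nonneg) (auto simp: power_mult)
  define c where "c = exp 1 * real (k * p) ^ k * W"
  have c: "0 < c" using W p k by (simp add: c_def W_def)
  have mom: "(\<integral>\<^sup>+z. ennreal (z ^ (2 * (k * p))) \<partial>std_gauss) \<le> ennreal (real (k * p) ^ (k * p))"
    using std_normal_distribution_even_moments[of "k * p"] fact_double_le[of "k * p"]
    by (subst nn_integral_eq_integral) (auto simp: power_mult intro!: ennreal_leI)
  have "(\<integral>\<^sup>+g. ennreal (S g ^ p) \<partial>gaussian n) \<le>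
      (\<integral>\<^sup>+g. (\<Sum>j=1..n. ennreal (W ^ (p - 1) * w j) * ennreal (g j ^ (2 * (k * p)))) \<partial>gaussian n)"
  proof (rule nn_integral_mono)
    fix g :: "nat \<Rightarrow> real"
    have "S g ^ p \<le> W ^ (p - 1) * (\<Sum>j=1..n. w j * (g j ^ (2 * k)) ^ p)"
      unfolding S_def W_def by (rule weighted_power_mean) (use w p in \<open>auto simp: power_mult\<close>)
    also have "\<dots> = (\<Sum>j=1..n. (W ^ (p - 1) * w j) * g j ^ (2 * (k * p)))"
      by (simp add: sum_distrib_left mult_ac flip: power_mult)
    finally have "ennreal (S g ^ p) \<le> ennreal (\<Sum>j=1..n. (W ^ (p - 1) * w j) * g j ^ (2 * (k * p)))"
      by (rule ennreal_leI)
    also have "\<dots> = (\<Sum>j=1..n. ennreal (W ^ (p - 1) * w j) * ennreal (g j ^ (2 * (k * p))))"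
      using w W by (subst sum_ennreal[symmetric])
        (auto simp: W_def power_mult intro!: sum.cong ennreal_mult mult_nonneg_nonneg)
    finally show "ennreal (S g ^ p) \<le> (\<Sum>j=1..n. ennreal (W ^ (p - 1) * w j) * ennreal (g j ^ (2 * (k * p))))" .
  qed
  also have "\<dots> = (\<Sum>j=1..n. ennreal (W ^ (p - 1) * w j) * (\<integral>\<^sup>+g. ennreal (g j ^ (2 * (k * p))) \<partial>gaussian n))"
    by (subst nn_integral_sum) (auto intro!: sum.cong nn_integral_cmult)
  also have "\<dots> \<le> (\<Sum>j=1..n. ennreal (W ^ (p - 1) * w j) * ennreal (real (k * p) ^ (k * p)))"
  proof (intro sum_mono mult_left_mono)
    fix j assume j: "j \<in> {1..n}"
    show "(\<integral>\<^sup>+g. ennreal (g j ^ (2 * (k * p))) \<partial>gaussian n) \<le> ennreal (real (k * p) ^ (k * p))"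
      using mom by (subst nn_integral_gaussian_component[OF j, of "\<lambda>z. ennreal (z ^ (2 * (k * p)))"]) auto
  qed simp
  also have "\<dots> = ennreal (\<Sum>j=1..n. (W ^ (p - 1) * w j) * real (k * p) ^ (k * p))"
    using w W by (subst sum_ennreal[symmetric])
      (auto simp: W_def intro!: sum.cong ennreal_mult[symmetric] mult_nonneg_nonneg)
  also have "(\<Sum>j=1..n. (W ^ (p - 1) * w j) * real (k * p) ^ (k * p)) = W ^ p * real (k * p) ^ (k * p)"
    using p by (simp add: W_def power_eq_if[of _ p] mult_ac flip: sum_distrib_left sum_distrib_right)
  also have "\<dots> = exp (- real p) * c ^ p"
    by (simp add: c_def power_mult_distrib exp_minus exp_of_nat_mult[symmetric] mult_ac flip: power_mult)
  finally have "G.prob {g \<in> space (gaussian n). ennreal (c ^ p) \<le> ennreal (S g ^ p)} \<le> exp (- real p)"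
    using c by (intro G.prob_ge_le_exp) auto
  moreover have "ennreal (c ^ p) \<le> ennreal (S g ^ p) \<longleftrightarrow> c \<le> S g" for g
    using c S0[of g] p by (subst ennreal_le_iff) (auto simp: power_mono_iff)
  ultimately show ?thesis by (simp add: c_def S_def W_def)
qed

text \<open>Hoeffding's lemma for a fair sign, with probability 1/2 and interval length 2
  |x|.\<close>

lemma cosh_le_exp_half_square: "cosh x \<le> exp (x^2 / 2)" for x :: real
proof -
  define h where "h = 2 * \<bar>x\<bar>"
  have "- h * (1 / 2) + ln (1 + 1 / 2 * (exp h - 1)) \<le> h^2 / 8"
    using Hoeffdings_lemma_aux[of h "1 / 2"] by (simp add: h_def)
  then have "ln (exp (- \<bar>x\<bar>) * (1 + 1 / 2 * (exp h - 1))) \<le> x^2 / 2"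
    by (subst ln_mult_pos) (auto simp: h_def power_mult_distrib intro!: add_pos_nonneg)
  moreover have "exp (- \<bar>x\<bar>) * (1 + 1 / 2 * (exp h - 1)) = cosh \<bar>x\<bar>"
    by (simp add: cosh_field_def h_def algebra_simps flip: exp_add)
  ultimately have "ln (cosh \<bar>x\<bar>) \<le> x^2 / 2" by simp
  then show ?thesis by (metis cosh_real_abs cosh_real_pos exp_le_cancel_iff exp_ln)
qed

lemma nn_integral_std_normal_reflect:
  assumes [measurable]: "f \<in> borel_measurable borel"
  shows "(\<integral>\<^sup>+z. f (- z) \<partial>std_gauss) = (\<integral>\<^sup>+z. f z \<partial>std_gauss)"
proof -
  have "(\<integral>\<^sup>+z. f z \<partial>std_gauss) = (\<integral>\<^sup>+z. ennreal (std_normal_density z) * f z \<partial>lborel)"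
    by (rule nn_integral_density) auto
  also have "\<dots> = (\<integral>\<^sup>+z. ennreal (std_normal_density (- z)) * f (- z) \<partial>lborel)"
    using nn_integral_real_affine[of "\<lambda>z. ennreal (std_normal_density z) * f z" "-1" 0] by simp
  also have "\<dots> = (\<integral>\<^sup>+z. ennreal (std_normal_density z) * f (- z) \<partial>lborel)"
    by (simp add: std_normal_density_def)
  also have "\<dots> = (\<integral>\<^sup>+z. f (- z) \<partial>std_gauss)"
    by (rule nn_integral_density[symmetric]) auto
  finally show ?thesis by simp
qed

text \<open>
  The exponential moments of \<open>z\<^sup>3\<close> are infinite, but after subtracting the compensator the reflection
  \<open>z \<mapsto> - z\<close> turns the integrand into \<open>cosh x * exp (- x\<^sup>2 / 2) \<le> 1\<close>.
\<close>

lemma std_normal_self_normalised_cubic: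
  "(\<integral>\<^sup>+z. ennreal (exp (c * z ^ 3 - c\<^sup>2 * z ^ 6 / 2)) \<partial>std_gauss) \<le> 1"
proof -
  let ?N = std_gauss
  let ?f = "\<lambda>z::real. exp (c * z ^ 3 - c\<^sup>2 * z ^ 6 / 2)"
  have "2 * (\<integral>\<^sup>+z. ennreal (?f z) \<partial>?N) = (\<integral>\<^sup>+z. ennreal (?f z) \<partial>?N) + (\<integral>\<^sup>+z. ennreal (?f (- z)) \<partial>?N)"
    using nn_integral_std_normal_reflect[of "\<lambda>z. ennreal (?f z)"] by (simp add: mult_2)
  also have "\<dots> = (\<integral>\<^sup>+z. ennreal (?f z) + ennreal (?f (- z)) \<partial>?N)"
    by (rule nn_integral_add[symmetric]) auto
  also have "\<dots> \<le> (\<integral>\<^sup>+z. 2 \<partial>?N)"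
  proof (rule nn_integral_mono)
    fix z :: real
    define x where "x = c * z ^ 3"
    have x2: "x^2 = c^2 * z ^ 6" by (simp add: x_def power_mult_distrib flip: power_mult)
    have "?f z + ?f (- z) = 2 * cosh x * exp (- (x^2 / 2))"
      unfolding cosh_field_def x2 by (simp add: x_def algebra_simps flip: exp_add)
    also have "\<dots> \<le> 2 * exp (x^2 / 2) * exp (- (x^2 / 2))"
      using cosh_le_exp_half_square[of x] by (intro mult_right_mono mult_left_mono) auto
    also have "\<dots> = 2" by (simp flip: exp_add)
    finally have "ennreal (?f z + ?f (- z)) \<le> ennreal 2" by (rule ennreal_leI)
    then show "ennreal (?f z) + ennreal (?f (- z)) \<le> 2" by (simp flip: ennreal_plus)
  qed
  also have "\<dots> = 2" using std_normal.emeasure_space_1 by simp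
  finally have "2 * (\<integral>\<^sup>+z. ennreal (?f z) \<partial>?N) \<le> 2 * 1" by simp
  then show ?thesis by (subst (asm) ennreal_mult_le_mult_iff) auto
qed

text \<open>By independence the one-dimensional bounds multiply to an exponential moment of at most
  1, so the Chernoff bound at level p is exp (- p).\<close>

lemma gaussian_cubic_tail:
  "measure (gaussian n) {g \<in> space (gaussian n).
     p \<le> (\<Sum>j=1..n. c j * g j ^ 3 - (c j)\<^sup>2 * g j ^ 6 / 2)} \<le> exp (- p)"
proof -
  interpret G: prob_space "gaussian n" by (rule prob_space_gaussian)
  have "(\<integral>\<^sup>+g. ennreal (exp (\<Sum>j=1..n. c j * g j ^ 3 - (c j)\<^sup>2 * g j ^ 6 / 2)) \<partial>gaussian n) =
     (\<Prod>j=1..n. \<integral>\<^sup>+z. ennreal (exp (c j * z ^ 3 - (c j)\<^sup>2 * z ^ 6 / 2)) \<partial>std_gauss)"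
    by (rule gaussian_nn_integral_exp_sum) measurable
  also have "\<dots> \<le> 1" by (intro prod_le_1 conjI std_normal_self_normalised_cubic) simp
  finally show ?thesis by (intro G.prob_chernoff) auto
qed

text \<open>The weight exp (z^2 / 4) doubles the variance of the density, so its mean is sqrt 2 <=
  exp (1 / 2).\<close>

lemma gaussian_norm_upper_tail:
  "measure (gaussian n) {g \<in> space (gaussian n). 4 * real n \<le> (\<Sum>j=1..n. (g j)^2)} \<le> exp (- (real n / 2))"
proof -
  interpret G: prob_space "gaussian n" by (rule prob_space_gaussian)
  have single: "(\<integral>\<^sup>+z. ennreal (exp (z^2 / 4)) \<partial>std_gauss) \<le> ennreal (exp (1 / 2))"
  proof -
    have "(\<integral>\<^sup>+z. ennreal (exp (z^2 / 4)) \<partial>std_gauss) =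
        (\<integral>\<^sup>+z. ennreal (std_normal_density z) * ennreal (exp (z^2 / 4)) \<partial>lborel)"
      by (rule nn_integral_density) auto
    also have "\<dots> = (\<integral>\<^sup>+z. ennreal (sqrt 2) * ennreal (normal_density 0 (sqrt 2) z) \<partial>lborel)"
    proof (rule nn_integral_cong)
      fix z :: real
      have "std_normal_density z * exp (z^2 / 4) = sqrt 2 * normal_density 0 (sqrt 2) z"
        unfolding normal_density_def
        by (simp add: real_sqrt_mult field_simps flip: exp_add)
      then show "ennreal (std_normal_density z) * ennreal (exp (z^2 / 4)) = ennreal (sqrt 2) * ennreal (normal_density 0 (sqrt 2) z)"
        by (simp add: ennreal_mult[symmetric] normal_density_nonneg)
    qed
    also have "\<dots> = ennreal (sqrt 2) * (\<integral>\<^sup>+z. ennreal (normal_density 0 (sqrt 2) z) \<partial>lborel)"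
      by (rule nn_integral_cmult) simp
    also have "\<dots> = ennreal (sqrt 2)"
      by (subst nn_integral_eq_integral) (auto simp: normal_density_nonneg)
    also have "\<dots> \<le> ennreal (exp (1 / 2))"
    proof (rule ennreal_leI)
      have "sqrt 2 \<le> 1 + 1 / 2" by (rule real_le_lsqrt) (auto simp: power2_eq_square)
      also have "\<dots> \<le> exp (1 / 2 :: real)" by (rule exp_ge_add_one_self)
      finally show "sqrt 2 \<le> exp (1 / 2)" .
    qed
    finally show ?thesis .
  qed
  have "(\<integral>\<^sup>+g. ennreal (exp (\<Sum>j=1..n. (g j)^2 / 4)) \<partial>gaussian n) =
     (\<Prod>j=1..n. \<integral>\<^sup>+z. ennreal (exp (z^2 / 4)) \<partial>std_gauss)"
    by (rule gaussian_nn_integral_exp_sum) measurable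
  also have "\<dots> \<le> (\<Prod>j=1..n. ennreal (exp (1 / 2)))" by (intro prod_mono_ennreal single)
  also have "\<dots> = ennreal (exp (1 / 2) ^ n)" by (simp add: ennreal_power)
  also have "exp (1 / 2) ^ n = exp (real n - real n / 2)" by (simp flip: exp_of_nat_mult)
  finally have "G.prob {g \<in> space (gaussian n). real n \<le> (\<Sum>j=1..n. (g j)^2 / 4)} \<le> exp (- (real n / 2))"
    by (intro G.prob_chernoff) auto
  moreover have "real n \<le> (\<Sum>j=1..n. (g j)^2 / 4) \<longleftrightarrow> 4 * real n \<le> (\<Sum>j=1..n. (g j)^2)" for g :: "nat \<Rightarrow> real"
    by (simp add: mult.commute flip: sum_divide_distrib)
  ultimately show ?thesis by simp
qed

text \<open>Coordinates surviving the truncation are not unusually large, which is what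
  \<open>controlled_mass\<close> asks for. A factor exp (- 1/14) for each of at least n / 2
  coordinates gives exp (- n / 28); half of this exponent pays for the threshold.\<close>

lemma gaussian_truncated_norm_lower_tail:
  assumes J: "J \<subseteq> {1..n}" and card: "real n \<le> 2 * real (card J)"
  shows "measure (gaussian n) {g \<in> space (gaussian n).
      (\<Sum>j\<in>J. if (g j)^2 \<le> 6 then (g j)^2 else 0) \<le> real n / 56} \<le> exp (- (real n / 56))"
proof -
  interpret G: prob_space "gaussian n" by (rule prob_space_gaussian)
  define h where "h z = (if z^2 \<le> 6 then z^2 else 0)" for z :: real
  have [measurable]: "h \<in> borel_measurable borel" unfolding h_def by measurable
  have single: "(\<integral>\<^sup>+z. ennreal (exp (- h z)) \<partial>std_gauss) \<le> ennreal (exp (- (1 / 14)))"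
  proof -
    \<comment> \<open>The bound 1 / (1 + h) = 1 - h / (1 + h) with h <= 6 gives the slope 1/7, and
      z^2 - z^4 / 6 is a minorant of h, being negative beyond the truncation. As E z^4 = 3, the mean
      will be 1 - 1/14.\<close>
    have pt: "exp (- h z) \<le> 1 - (z^2 - z ^ 4 / 6) / 7" for z
    proof -
      have h: "0 \<le> h z" "h z \<le> 6" by (auto simp: h_def)
      have "h z / 7 \<le> h z / (1 + h z)" using h by (intro divide_left_mono) auto
      moreover have "exp (- h z) \<le> 1 / (1 + h z)"
        using exp_ge_add_one_self[of "h z"] h by (simp add: exp_minus field_simps)
      moreover have "1 / (1 + h z) = 1 - h z / (1 + h z)" using h by (simp add: field_simps)
      moreover have "z^2 - z ^ 4 / 6 \<le> h z"
      proof (cases "z^2 \<le> 6")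
        case False
        then have "6 * z^2 \<le> z^2 * z^2" by (intro mult_right_mono) auto
        then show ?thesis using False by (simp add: h_def power4_eq_xxxx power2_eq_square)
      qed (simp add: h_def)
      ultimately show ?thesis by (simp add: field_simps)
    qed
    have m: "integrable std_gauss (\<lambda>z. z ^ 4)" "(LINT z|std_gauss. z ^ 4) = 3"
      using std_normal_distribution_even_moments[of 2] by (simp_all add: fact_numeral)
    have i: "integrable std_gauss (\<lambda>z. exp (- h z))"
      by (rule std_normal.integrable_const_bound[where B = 1]) (auto simp: h_def)
    have "(\<integral>\<^sup>+z. ennreal (exp (- h z)) \<partial>std_gauss) = ennreal (LINT z|std_gauss. exp (- h z))"
      by (rule nn_integral_eq_integral[OF i]) auto
    also have "(LINT z|std_gauss. exp (- h z)) \<le> (LINT z|std_gauss. 1 - (z^2 - z ^ 4 / 6) / 7)"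
      by (rule integral_mono[OF i]) (use pt m std_normal_second_moment in auto)
    also have "\<dots> = 1 - (1 - 3 / 6) / 7"
      using m std_normal_second_moment std_normal.prob_space by (simp del: std_normal.prob_space)
    also have "\<dots> \<le> exp (- (1 / 14))" using exp_ge_add_one_self[of "- (1 / 14)"] by simp
    finally show ?thesis by (auto intro: ennreal_leI)
  qed
  define f where "f j z = (if j \<in> J then - h z else 0)" for j z
  have [measurable]: "f j \<in> borel_measurable borel" for j unfolding f_def by measurable
  have sumf: "(\<Sum>j=1..n. f j (g j)) = - (\<Sum>j\<in>J. h (g j))" for g
    unfolding f_def using J by (simp add: sum.If_cases Int_absorb1 sum_negf)
  have "(\<integral>\<^sup>+g. ennreal (exp (\<Sum>j=1..n. f j (g j))) \<partial>gaussian n) =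
     (\<Prod>j=1..n. \<integral>\<^sup>+z. ennreal (exp (f j z)) \<partial>std_gauss)"
    by (rule gaussian_nn_integral_exp_sum) measurable
  also have "\<dots> \<le> (\<Prod>j=1..n. if j \<in> J then ennreal (exp (- (1 / 14))) else 1)"
    using single std_normal.emeasure_space_1 by (intro prod_mono_ennreal) (auto simp: f_def)
  also have "\<dots> = ennreal (exp (- (1 / 14)) ^ card J)"
    using J by (simp add: prod.If_cases Int_absorb1 ennreal_power)
  also have "exp (- (1 / 14)) ^ card J = exp (- (real (card J) / 14))" by (simp flip: exp_of_nat_mult)
  also have "\<dots> \<le> exp (- (real n / 56) - real n / 56)" using card by simp
  finally have le: "(\<integral>\<^sup>+g. ennreal (exp (\<Sum>j=1..n. f j (g j))) \<partial>gaussian n) \<le> ennreal (exp (- (real n / 56) - real n / 56))"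
    by (auto intro: ennreal_leI)
  have "G.prob {g \<in> space (gaussian n). - (real n / 56) \<le> (\<Sum>j=1..n. f j (g j))} \<le> exp (- (real n / 56))"
    by (rule G.prob_chernoff[OF _ le]) measurable
  then show ?thesis unfolding sumf by (simp add: h_def)
qed

section \<open>Good directions\<close>

text \<open>The number \<open>896 = 4 * 224\<close> comes from \<open>\<kappa> = 1 / 224\<close> in \<open>sum_char_diff_le\<close>.\<close>

definition third_weight :: real where
  "third_weight = (LINT t|lborel. (\<bar>t\<bar> ^ 3 + \<bar>t\<bar>^2) * exp (- t\<^sup>2 / 896))"

text \<open>The integral left over once 1 / |t| has been replaced by |t| / R^2 on the range |t| >=
  R. Both weights stay symbolic, as universal constants.\<close>

definition first_weight :: real where
  "first_weight = (LINT t|lborel. \<bar>t\<bar> * exp (- t\<^sup>2 / 2))"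

lemma integrable_abs_power_exp:
  assumes "0 < \<sigma>"
  shows "integrable lborel (\<lambda>t::real. \<bar>t\<bar> ^ k * exp (- t\<^sup>2 / (2 * \<sigma>^2)))"
proof -
  have "integrable lborel (\<lambda>t. sqrt (2 * pi * \<sigma>^2) * (normal_density 0 \<sigma> t * \<bar>t - 0\<bar> ^ k))"
    by (intro integrable_mult_right integrable_normal_moment_abs assms)
  also have "(\<lambda>t. sqrt (2 * pi * \<sigma>^2) * (normal_density 0 \<sigma> t * \<bar>t - 0\<bar> ^ k)) = (\<lambda>t. \<bar>t\<bar> ^ k * exp (- t\<^sup>2 / (2 * \<sigma>^2)))"
    using assms by (auto simp: fun_eq_iff normal_density_def)
  finally show ?thesis .
qed

lemma third_weight_integrable:
  "integrable lborel (\<lambda>t::real. (\<bar>t\<bar> ^ 3 + \<bar>t\<bar>^2) * exp (- t\<^sup>2 / 896))"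
  using integrable_abs_power_exp[of "sqrt 448" 3] integrable_abs_power_exp[of "sqrt 448" 2]
  by (simp add: distrib_right)

lemma first_weight_integrable:
  "integrable lborel (\<lambda>t::real. \<bar>t\<bar> * exp (- t\<^sup>2 / 2))"
  using integrable_abs_power_exp[of 1 1] by simp

lemma third_weight_nonneg: "0 \<le> third_weight"
  unfolding third_weight_def by (rule integral_nonneg_AE) simp

lemma first_weight_nonneg: "0 \<le> first_weight"
  unfolding first_weight_def by (rule integral_nonneg_AE) simp

text \<open>On |t| >= R one has 1 / |t| <= |t| / R^2, and scaling by \<epsilon> does the rest. A
  logarithmic bound would be sharper for small \<epsilon>, but the polynomial loss will meet an
  exponentially small factor.\<close>

lemma nn_integral_exp_over_abs_le:
  assumes R: "0 < R" and \<epsilon>: "0 < \<epsilon>"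
  shows "(\<integral>\<^sup>+t. indicator {t. R \<le> \<bar>t\<bar>} t * ennreal (exp (- (\<epsilon> * t)\<^sup>2 / 2) / \<bar>t\<bar>) \<partial>lborel)
    \<le> ennreal (first_weight / (R^2 * \<epsilon>^2))"
proof -
  have "(\<integral>\<^sup>+t. indicator {t. R \<le> \<bar>t\<bar>} t * ennreal (exp (- (\<epsilon> * t)\<^sup>2 / 2) / \<bar>t\<bar>) \<partial>lborel)
      \<le> (\<integral>\<^sup>+t. ennreal (1 / (R^2 * \<epsilon>)) * ennreal (\<bar>\<epsilon> * t\<bar> * exp (- (\<epsilon> * t)\<^sup>2 / 2)) \<partial>lborel)"
  proof (rule nn_integral_mono)
    fix t :: real
    show "indicator {t. R \<le> \<bar>t\<bar>} t * ennreal (exp (- (\<epsilon> * t)\<^sup>2 / 2) / \<bar>t\<bar>)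
      \<le> ennreal (1 / (R^2 * \<epsilon>)) * ennreal (\<bar>\<epsilon> * t\<bar> * exp (- (\<epsilon> * t)\<^sup>2 / 2))"
    proof (cases "R \<le> \<bar>t\<bar>")
      case True
      then have t: "0 < \<bar>t\<bar>" using R by linarith
      have "R^2 \<le> \<bar>t\<bar> * \<bar>t\<bar>" unfolding power2_eq_square using True R by (intro mult_mono) auto
      then have "1 / \<bar>t\<bar> \<le> \<bar>t\<bar> / R^2" using t R by (simp add: field_simps)
      then have "exp (- (\<epsilon> * t)\<^sup>2 / 2) * (1 / \<bar>t\<bar>) \<le> exp (- (\<epsilon> * t)\<^sup>2 / 2) * (\<bar>t\<bar> / R^2)"
        by (intro mult_left_mono) auto
      then have "exp (- (\<epsilon> * t)\<^sup>2 / 2) / \<bar>t\<bar> \<le> 1 / (R^2 * \<epsilon>) * (\<bar>\<epsilon> * t\<bar> * exp (- (\<epsilon> * t)\<^sup>2 / 2))"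
        using \<epsilon> by (simp add: abs_mult field_simps)
      then show ?thesis using True \<epsilon> by (subst ennreal_mult[symmetric]) (auto intro!: ennreal_leI)
    qed simp
  qed
  also have "\<dots> = ennreal (1 / (R^2 * \<epsilon>)) * (\<integral>\<^sup>+t. ennreal (\<bar>\<epsilon> * t\<bar> * exp (- (\<epsilon> * t)\<^sup>2 / 2)) \<partial>lborel)"
    by (rule nn_integral_cmult) measurable
  also have "(\<integral>\<^sup>+t. ennreal (\<bar>\<epsilon> * t\<bar> * exp (- (\<epsilon> * t)\<^sup>2 / 2)) \<partial>lborel) = ennreal (first_weight / \<epsilon>)"
  proof -
    have "ennreal first_weight = (\<integral>\<^sup>+t. ennreal (\<bar>t\<bar> * exp (- t\<^sup>2 / 2)) \<partial>lborel)"
      unfolding first_weight_def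
      by (rule nn_integral_eq_integral[symmetric, OF first_weight_integrable]) auto
    also have "\<dots> = ennreal \<bar>\<epsilon>\<bar> * (\<integral>\<^sup>+t. ennreal (\<bar>0 + \<epsilon> * t\<bar> * exp (- (0 + \<epsilon> * t)\<^sup>2 / 2)) \<partial>lborel)"
      by (rule nn_integral_real_affine) (use \<epsilon> in auto)
    finally have "ennreal (1 / \<epsilon>) * ennreal first_weight =
        ennreal (1 / \<epsilon>) * ennreal \<epsilon> * (\<integral>\<^sup>+t. ennreal (\<bar>\<epsilon> * t\<bar> * exp (- (\<epsilon> * t)\<^sup>2 / 2)) \<partial>lborel)"
      using \<epsilon> by (simp add: mult.assoc)
    moreover have "ennreal (1 / \<epsilon>) * ennreal \<epsilon> = 1" using \<epsilon> by (subst ennreal_mult[symmetric]) auto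
    moreover have "ennreal (1 / \<epsilon>) * ennreal first_weight = ennreal (first_weight / \<epsilon>)"
      using \<epsilon> first_weight_nonneg by (subst ennreal_mult[symmetric]) auto
    ultimately show ?thesis by simp
  qed
  also have "ennreal (1 / (R^2 * \<epsilon>)) * ennreal (first_weight / \<epsilon>) = ennreal (first_weight / (R^2 * \<epsilon>^2))"
    using \<epsilon> R first_weight_nonneg by (subst ennreal_mult[symmetric]) (auto simp: power2_eq_square)
  finally show ?thesis .
qed

section \<open>High frequencies: the tail integral and its Gaussian average\<close>

context standardized_family
begin

definition sum_char_tail :: "real \<Rightarrow> real \<Rightarrow> (nat \<Rightarrow> real) \<Rightarrow> ennreal" where
  "sum_char_tail R \<epsilon> \<theta> = (\<integral>\<^sup>+t. indicator {t. R \<le> \<bar>t\<bar>} t *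
     ennreal (norm (sum_char \<theta> t) * exp (- (\<epsilon> * t)\<^sup>2 / 2) / \<bar>t\<bar>) \<partial>lborel)"

lemma char_measurable_family: "j \<in> {1..n} \<Longrightarrow> char (\<mu> j) \<in> borel_measurable borel"
  using standardized[THEN standardized_law.axioms(1)] real_distribution.char_measurable by blast

lemma sum_char_measurable_pair:
  "(\<lambda>p. sum_char (fst p) (snd p)) \<in> borel_measurable (borel_PiM n \<Otimes>\<^sub>M borel)"
  unfolding sum_char_def
proof (rule borel_measurable_prod)
  fix j assume j: "j \<in> {1..n}"
  have f: "(\<lambda>p. fst p j :: real) \<in> borel_measurable (borel_PiM n \<Otimes>\<^sub>M borel)"
    by (rule measurable_compose[OF measurable_fst measurable_component_singleton[OF j]])
  have "(\<lambda>p. fst p j * snd p :: real) \<in> borel_measurable (borel_PiM n \<Otimes>\<^sub>M borel)"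
    by (intro borel_measurable_times f measurable_snd)
  then show "(\<lambda>p. char (\<mu> j) (fst p j * snd p)) \<in> borel_measurable (borel_PiM n \<Otimes>\<^sub>M borel)"
    by (rule measurable_compose[OF _ char_measurable_family[OF j]])
qed

lemma sum_char_measurable [measurable]: "sum_char \<theta> \<in> borel_measurable borel"
  unfolding sum_char_def
  by (intro borel_measurable_prod measurable_compose[OF _ char_measurable_family]) auto

lemma sum_char_tail_measurable [measurable]:
  "sum_char_tail R \<epsilon> \<in> borel_measurable (borel_PiM n)"
proof -
  note sum_char_measurable_pair[measurable]
  show ?thesis
    unfolding sum_char_tail_def
    by (rule lborel.borel_measurable_nn_integral) (simp add: split_beta')
qed

text \<open>
  As \<open>dt / \<bar>t\<bar>\<close> is invariant under scaling, the tail integral on the sphere can be compared with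
  the one at an unnormalised Gaussian vector.
\<close>

lemma sum_char_tail_rescale:
  assumes r: "0 < r0" "r0 \<le> r" "r \<le> r1"
  shows "sum_char_tail R \<epsilon> (\<lambda>j. x j / r) \<le> sum_char_tail (R / r1) (\<epsilon> * r0) x"
proof -
  have r0: "0 < r" using r by linarith
  have "sum_char_tail R \<epsilon> (\<lambda>j. x j / r) = ennreal \<bar>r\<bar> * (\<integral>\<^sup>+t. indicator {t. R \<le> \<bar>t\<bar>} (0 + r * t) *
     ennreal (norm (sum_char (\<lambda>j. x j / r) (0 + r * t)) * exp (- (\<epsilon> * (0 + r * t))\<^sup>2 / 2) / \<bar>0 + r * t\<bar>) \<partial>lborel)"
    unfolding sum_char_tail_def by (rule nn_integral_real_affine) (use r0 in auto)
  also have "\<dots> = (\<integral>\<^sup>+t. ennreal r * (indicator {t. R \<le> \<bar>t\<bar>} (0 + r * t) *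
     ennreal (norm (sum_char (\<lambda>j. x j / r) (0 + r * t)) * exp (- (\<epsilon> * (0 + r * t))\<^sup>2 / 2) / \<bar>0 + r * t\<bar>)) \<partial>lborel)"
    using r0 by (subst nn_integral_cmult) auto
  also have "\<dots> \<le> sum_char_tail (R / r1) (\<epsilon> * r0) x"
    unfolding sum_char_tail_def
  proof (rule nn_integral_mono)
    fix t :: real
    have sc: "sum_char (\<lambda>j. x j / r) (r * t) = sum_char x t"
      using r0 by (simp add: sum_char_def)
    show "ennreal r * (indicator {t. R \<le> \<bar>t\<bar>} (0 + r * t) *
     ennreal (norm (sum_char (\<lambda>j. x j / r) (0 + r * t)) * exp (- (\<epsilon> * (0 + r * t))\<^sup>2 / 2) / \<bar>0 + r * t\<bar>))
      \<le> indicator {t. R / r1 \<le> \<bar>t\<bar>} t * ennreal (norm (sum_char x t) * exp (- (\<epsilon> * r0 * t)\<^sup>2 / 2) / \<bar>t\<bar>)"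
    proof (cases "R \<le> \<bar>r * t\<bar>")
      case True
      \<comment> \<open>Cut-off and damping are monotone in r: the first is relaxed to its value at
        r1, the second to its value at r0.\<close>
      have "\<bar>r * t\<bar> \<le> r1 * \<bar>t\<bar>" using r r0 by (simp add: abs_mult mult_right_mono)
      then have "R / r1 \<le> \<bar>t\<bar>" using True r r0 by (simp add: field_simps)
      moreover have "r * (norm (sum_char x t) * exp (- (\<epsilon> * (r * t))\<^sup>2 / 2) / \<bar>r * t\<bar>) \<le>
          norm (sum_char x t) * exp (- (\<epsilon> * r0 * t)\<^sup>2 / 2) / \<bar>t\<bar>"
      proof -
        have "r0^2 \<le> r^2" using r by (intro power_mono) auto
        then have "(\<epsilon> * r0 * t)^2 \<le> (\<epsilon> * (r * t))^2"
          unfolding power_mult_distrib by (simp add: mult_left_mono mult_right_mono mult.assoc)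
        then have "exp (- (\<epsilon> * (r * t))\<^sup>2 / 2) \<le> exp (- (\<epsilon> * r0 * t)\<^sup>2 / 2)" by simp
        then have "norm (sum_char x t) * exp (- (\<epsilon> * (r * t))\<^sup>2 / 2) / \<bar>t\<bar> \<le> norm (sum_char x t) * exp (- (\<epsilon> * r0 * t)\<^sup>2 / 2) / \<bar>t\<bar>"
          by (intro divide_right_mono mult_left_mono) auto
        moreover have "r * (norm (sum_char x t) * exp (- (\<epsilon> * (r * t))\<^sup>2 / 2) / \<bar>r * t\<bar>) = norm (sum_char x t) * exp (- (\<epsilon> * (r * t))\<^sup>2 / 2) / \<bar>t\<bar>"
          using r0 by (simp add: abs_mult)
        ultimately show ?thesis by simp
      qed
      ultimately show ?thesis
        using True r0 by (simp add: sc ennreal_mult[symmetric] ennreal_leI)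
    qed simp
  qed
  finally show ?thesis .
qed

text \<open>Inside |t| < R, dividing \<open>sum_char_diff_le\<close> by |t| turns t^4 and |t|^3 into
  |t|^3 and t^2, which removes the singularity at 0 and produces \<open>third_weight\<close>.
  Outside, the two moduli are integrated separately; the Gaussian one is
  \<open>nn_integral_exp_over_abs_le\<close> with parameter 1, hence the factor
  \<open>1 * t\<close>.\<close>

lemma smoothed_char_integral_le:
  assumes \<theta>: "(\<Sum>j=1..n. (\<theta> j)^2) = 1" and R: "0 < R"
    and a: "quartic_sum \<theta> \<le> a" "\<bar>cubic_sum \<theta>\<bar> \<le> a"
    and mass: "1 / 224 \<le> controlled_mass R \<theta>"
    and tail: "sum_char_tail R \<epsilon> \<theta> \<le> ennreal b" and b: "0 \<le> b"
  shows "(\<integral>\<^sup>+t. ennreal (norm (sum_char \<theta> t - exp (- t\<^sup>2 / 2)) * exp (- (\<epsilon> * t)\<^sup>2 / 2) / \<bar>t\<bar>) \<partial>lborel)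
     \<le> ennreal (4 * a * third_weight + b + first_weight / R^2)"
proof -
  have a0: "0 \<le> a" using a(2) by linarith
  have "(\<integral>\<^sup>+t. ennreal (norm (sum_char \<theta> t - exp (- t\<^sup>2 / 2)) * exp (- (\<epsilon> * t)\<^sup>2 / 2) / \<bar>t\<bar>) \<partial>lborel) \<le>
     (\<integral>\<^sup>+t. ennreal (4 * a) * ennreal ((\<bar>t\<bar> ^ 3 + \<bar>t\<bar>^2) * exp (- t\<^sup>2 / 896)) +
       (indicator {t. R \<le> \<bar>t\<bar>} t * ennreal (norm (sum_char \<theta> t) * exp (- (\<epsilon> * t)\<^sup>2 / 2) / \<bar>t\<bar>) +
        indicator {t. R \<le> \<bar>t\<bar>} t * ennreal (exp (- (1 * t)\<^sup>2 / 2) / \<bar>t\<bar>)) \<partial>lborel)"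
  proof (rule nn_integral_mono)
    fix t :: real
    let ?d = "norm (sum_char \<theta> t - exp (- t\<^sup>2 / 2)) * exp (- (\<epsilon> * t)\<^sup>2 / 2) / \<bar>t\<bar>"
    have e1: "exp (- (\<epsilon> * t)\<^sup>2 / 2) \<le> 1" by simp
    show "ennreal ?d \<le> ennreal (4 * a) * ennreal ((\<bar>t\<bar> ^ 3 + \<bar>t\<bar>^2) * exp (- t\<^sup>2 / 896)) +
       (indicator {t. R \<le> \<bar>t\<bar>} t * ennreal (norm (sum_char \<theta> t) * exp (- (\<epsilon> * t)\<^sup>2 / 2) / \<bar>t\<bar>) +
        indicator {t. R \<le> \<bar>t\<bar>} t * ennreal (exp (- (1 * t)\<^sup>2 / 2) / \<bar>t\<bar>))"
    proof (cases "R \<le> \<bar>t\<bar>")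
      case True
      have "norm (sum_char \<theta> t - exp (- t\<^sup>2 / 2)) \<le> norm (sum_char \<theta> t) + exp (- t\<^sup>2 / 2)"
        using norm_triangle_ineq4[of "sum_char \<theta> t" "exp (- t\<^sup>2 / 2)"] by (simp only: norm_of_real abs_exp_cancel)
      then have "norm (sum_char \<theta> t - exp (- t\<^sup>2 / 2)) * exp (- (\<epsilon> * t)\<^sup>2 / 2) \<le>
          (norm (sum_char \<theta> t) + exp (- t\<^sup>2 / 2)) * exp (- (\<epsilon> * t)\<^sup>2 / 2)"
        by (rule mult_right_mono) simp
      also have "\<dots> \<le> norm (sum_char \<theta> t) * exp (- (\<epsilon> * t)\<^sup>2 / 2) + exp (- t\<^sup>2 / 2) * 1"
        unfolding distrib_right by (intro add_left_mono mult_left_mono e1) auto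
      finally have "?d \<le> norm (sum_char \<theta> t) * exp (- (\<epsilon> * t)\<^sup>2 / 2) / \<bar>t\<bar> + exp (- (1 * t)\<^sup>2 / 2) / \<bar>t\<bar>"
        by (simp add: divide_right_mono flip: add_divide_distrib)
      then have "ennreal ?d \<le> ennreal (norm (sum_char \<theta> t) * exp (- (\<epsilon> * t)\<^sup>2 / 2) / \<bar>t\<bar>) + ennreal (exp (- (1 * t)\<^sup>2 / 2) / \<bar>t\<bar>)"
        by (subst (asm) ennreal_le_iff[symmetric]) (simp_all add: ennreal_plus)
      then show ?thesis using True by (simp add: add_increasing)
    next
      case False
      have "norm (sum_char \<theta> t - exp (- t\<^sup>2 / 2)) \<le> 4 * exp (- (1 / 224 * t^2) / 4) * (t ^ 4 * quartic_sum \<theta> + \<bar>t\<bar> ^ 3 * \<bar>cubic_sum \<theta>\<bar>)"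
        by (rule sum_char_diff_le[OF \<theta> mass]) (use False in simp)
      also have "\<dots> \<le> 4 * exp (- (1 / 224 * t^2) / 4) * (t ^ 4 * a + \<bar>t\<bar> ^ 3 * a)"
        using a by (intro mult_left_mono add_mono) auto
      finally have "norm (sum_char \<theta> t - exp (- t\<^sup>2 / 2)) * exp (- (\<epsilon> * t)\<^sup>2 / 2) \<le>
         (4 * exp (- (1 / 224 * t^2) / 4) * (t ^ 4 * a + \<bar>t\<bar> ^ 3 * a)) * 1"
        using e1 a0 by (intro mult_mono) auto
      also have "\<dots> = (4 * a * ((\<bar>t\<bar> ^ 3 + \<bar>t\<bar>^2) * exp (- t\<^sup>2 / 896))) * \<bar>t\<bar>"
      proof -
        have "t ^ 4 = \<bar>t\<bar> ^ 3 * \<bar>t\<bar>" using power_abs[of t 4] by (simp add: power3_eq_cube power4_eq_xxxx)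
        moreover have "\<bar>t\<bar> ^ 3 = \<bar>t\<bar>^2 * \<bar>t\<bar>" by (simp add: power3_eq_cube power2_eq_square)
        ultimately show ?thesis by (simp add: algebra_simps)
      qed
      finally have "?d \<le> 4 * a * ((\<bar>t\<bar> ^ 3 + \<bar>t\<bar>^2) * exp (- t\<^sup>2 / 896))"
        using a0 by (cases "t = 0") (auto simp: divide_le_eq)
      then have "ennreal ?d \<le> ennreal (4 * a) * ennreal ((\<bar>t\<bar> ^ 3 + \<bar>t\<bar>^2) * exp (- t\<^sup>2 / 896))"
        using a0 by (subst ennreal_mult[symmetric]) (auto intro!: ennreal_leI)
      then show ?thesis using False by simp
    qed
  qed
  also have "\<dots> = ennreal (4 * a) * (\<integral>\<^sup>+t. ennreal ((\<bar>t\<bar> ^ 3 + \<bar>t\<bar>^2) * exp (- t\<^sup>2 / 896)) \<partial>lborel) +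
     (sum_char_tail R \<epsilon> \<theta> + (\<integral>\<^sup>+t. indicator {t. R \<le> \<bar>t\<bar>} t * ennreal (exp (- (1 * t)\<^sup>2 / 2) / \<bar>t\<bar>) \<partial>lborel))"
    unfolding sum_char_tail_def
    by (subst nn_integral_add, simp, simp, subst nn_integral_cmult, simp, subst nn_integral_add) simp_all
  also have "\<dots> \<le> ennreal (4 * a) * ennreal third_weight + (ennreal b + ennreal (first_weight / (R^2 * 1^2)))"
  proof (intro add_mono mult_left_mono tail nn_integral_exp_over_abs_le R)
    show "(\<integral>\<^sup>+t. ennreal ((\<bar>t\<bar> ^ 3 + \<bar>t\<bar>^2) * exp (- t\<^sup>2 / 896)) \<partial>lborel) \<le> ennreal third_weight"
      unfolding third_weight_def
      by (subst nn_integral_eq_integral[OF third_weight_integrable]) auto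
  qed auto
  also have "\<dots> = ennreal (4 * a * third_weight + b + first_weight / R^2)"
    using a0 b third_weight_nonneg first_weight_nonneg
    by (simp add: ennreal_mult[symmetric] ennreal_plus[symmetric] add.assoc del: ennreal_plus)
  finally show ?thesis .
qed

text \<open>This is \<delta>^4.\<close>

definition mean_m4 :: real where "mean_m4 = (\<Sum>j=1..n. m4 j) / real n"

lemma one_le_mean_m4: "1 \<le> mean_m4"
proof -
  have "(\<Sum>j=1..n. 1) \<le> (\<Sum>j=1..n. m4 j)" by (intro sum_mono one_le_m4)
  then show ?thesis using one_le_n by (simp add: mean_m4_def field_simps)
qed

text \<open>By Markov's inequality at least half of the indices are light; on them the individual
  fourth moment may be replaced by the average.\<close>

definition light :: "nat set" where "light = {j \<in> {1..n}. m4 j \<le> 2 * mean_m4}"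

lemma card_light: "real n \<le> 2 * real (card light)"
proof -
  have "real (card ({1..n} - light)) * (2 * mean_m4) = (\<Sum>j\<in>{1..n} - light. 2 * mean_m4)" by simp
  also have "\<dots> \<le> (\<Sum>j\<in>{1..n} - light. m4 j)" by (intro sum_mono) (auto simp: light_def)
  also have "\<dots> \<le> (\<Sum>j=1..n. m4 j)" using m4_nonneg by (intro sum_mono2) auto
  also have "\<dots> = real n * mean_m4" using one_le_n by (simp add: mean_m4_def)
  finally have "real (card ({1..n} - light)) * 2 \<le> real n"
    using one_le_mean_m4 by (simp add: mult.assoc[symmetric])
  moreover have "card ({1..n} - light) = n - card light"
    by (subst card_Diff_subset) (auto simp: light_def)
  moreover have "card light \<le> card {1..n}" by (rule card_mono) (auto simp: light_def)
  ultimately show ?thesis by (simp add: of_nat_diff)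
qed

text \<open>Under the Gaussian measure the average of the product factors. Each light coordinate
  contributes exp (- v / 2), and at least n / 2 of them give exp (- R^2 / 8) uniformly in |t| >=
  R.\<close>

lemma sum_char_tail_expectation:
  assumes R: "0 < R" and \<epsilon>: "0 < \<epsilon>" and small: "4 * R^2 * mean_m4 \<le> real n"
  shows "(\<integral>\<^sup>+g. sum_char_tail R \<epsilon> (\<lambda>j. g j / sqrt (real n)) \<partial>gaussian n) \<le>
    ennreal (exp (- R\<^sup>2 / 8) * (first_weight / (R^2 * \<epsilon>^2)))"
proof -
  interpret G: prob_space "gaussian n" by (rule prob_space_gaussian)
  interpret PG: product_sigma_finite "\<lambda>_::nat. std_gauss" by standard
  interpret P: pair_sigma_finite "gaussian n" lborel ..
  have n: "0 < real n" using one_le_n by simp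
  let ?w = "\<lambda>t. indicator {t. R \<le> \<bar>t\<bar>} t * ennreal (exp (- (\<epsilon> * t)\<^sup>2 / 2) / \<bar>t\<bar>)"
  have sc: "sum_char (\<lambda>j. g j / sqrt (real n)) t = (\<Prod>j=1..n. char (\<mu> j) (t / sqrt (real n) * g j))" for g t
    by (simp add: sum_char_def mult.commute)
  have m: "(\<lambda>p. sum_char (\<lambda>j. fst p j / sqrt (real n)) (snd p)) \<in> borel_measurable (gaussian n \<Otimes>\<^sub>M lborel)"
    unfolding sum_char_def
  proof (rule borel_measurable_prod)
    fix j assume j: "j \<in> {1..n}"
    have "(\<lambda>g. g j) \<in> borel_measurable (gaussian n)" using j by measurable
    then have f: "(\<lambda>p. fst p j) \<in> borel_measurable (gaussian n \<Otimes>\<^sub>M lborel)"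
      by (rule measurable_compose[OF measurable_fst])
    have "snd \<in> borel_measurable (gaussian n \<Otimes>\<^sub>M lborel)" by measurable
    then have "(\<lambda>p. fst p j / sqrt (real n) * snd p) \<in> borel_measurable (gaussian n \<Otimes>\<^sub>M lborel)"
      by (intro borel_measurable_times borel_measurable_divide f borel_measurable_const)
    then show "(\<lambda>p. char (\<mu> j) (fst p j / sqrt (real n) * snd p)) \<in> borel_measurable (gaussian n \<Otimes>\<^sub>M lborel)"
      by (rule measurable_compose[OF _ char_measurable_family[OF j]])
  qed
  note m[measurable]
  have avg: "(\<integral>\<^sup>+g. ennreal (norm (sum_char (\<lambda>j. g j / sqrt (real n)) t)) \<partial>gaussian n) \<le> ennreal (exp (- R\<^sup>2 / 8))"
    if t: "R \<le> \<bar>t\<bar>" for t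
  proof -
    \<comment> \<open>Built from R instead of t: it is at most t^2 / (2 n) for all |t| >= R, while 4
      v m4 <= 1 holds on light coordinates however large t is.\<close>
    define v where "v = R^2 / (2 * real n)"
    have "(\<integral>\<^sup>+g. ennreal (norm (sum_char (\<lambda>j. g j / sqrt (real n)) t)) \<partial>gaussian n) =
       (\<integral>\<^sup>+g. (\<Prod>j=1..n. ennreal (norm (char (\<mu> j) (t / sqrt (real n) * g j)))) \<partial>gaussian n)"
      unfolding sc by (simp add: prod_ennreal prod_norm)
    also have "\<dots> = (\<Prod>j=1..n. \<integral>\<^sup>+z. ennreal (norm (char (\<mu> j) (t / sqrt (real n) * z))) \<partial>std_gauss)"
    proof (rule PG.product_nn_integral_prod)
      fix j assume j: "j \<in> {1..n}"
      note char_measurable_family[OF j, measurable]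
      show "(\<lambda>z. ennreal (norm (char (\<mu> j) (t / sqrt (real n) * z)))) \<in> borel_measurable std_gauss"
        by measurable
    qed simp
    also have "\<dots> \<le> (\<Prod>j=1..n. if j \<in> light then ennreal (exp (- v / 2)) else 1)"
    proof (rule prod_mono_ennreal)
      fix j assume j: "j \<in> {1..n}"
      interpret standardized_law "\<mu> j" by (rule standardized[OF j])
      show "(\<integral>\<^sup>+z. ennreal (norm (char (\<mu> j) (t / sqrt (real n) * z))) \<partial>std_gauss)
        \<le> (if j \<in> light then ennreal (exp (- v / 2)) else 1)"
      proof (cases "j \<in> light")
        case True
        have "R^2 \<le> \<bar>t\<bar>^2" using t R by (intro power_mono) auto
        then have v1: "v \<le> (t / sqrt (real n))^2 / 2"
          using n by (simp add: v_def power_divide divide_right_mono mult.commute)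
        have "v * (4 * m4 j) \<le> v * (4 * (2 * mean_m4))"
          using True by (intro mult_left_mono) (auto simp: light_def v_def)
        also have "\<dots> = 4 * R^2 * mean_m4 / real n" by (simp add: v_def)
        also have "\<dots> \<le> 1" using small n by simp
        finally have "v * (4 * m4 j) \<le> 1" .
        then show ?thesis using gaussian_average_norm_char[OF _ v1] True by (simp add: v_def)
      next
        case False
        have "(\<integral>\<^sup>+z. ennreal (norm (char (\<mu> j) (t / sqrt (real n) * z))) \<partial>std_gauss) \<le>
          (\<integral>\<^sup>+z. 1 \<partial>std_gauss)"
          by (intro nn_integral_mono) (use norm_char_le_1[OF j] in auto)
        then show ?thesis using False std_normal.emeasure_space_1 by simp
      qed
    qed
    also have "\<dots> = ennreal (exp (- v / 2) ^ card light)"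
    proof -
      have "light \<subseteq> {1..n}" by (auto simp: light_def)
      then show ?thesis by (simp add: prod.If_cases Int_absorb1 ennreal_power)
    qed
    also have "exp (- v / 2) ^ card light = exp (- (R^2 * real (card light) / (4 * real n)))"
      by (simp add: v_def mult_ac flip: exp_of_nat_mult)
    also have "\<dots> \<le> exp (- R\<^sup>2 / 8)"
    proof -
      have "R^2 * real n \<le> R^2 * (2 * real (card light))" using card_light by (intro mult_left_mono) auto
      then have "R^2 / 8 \<le> R^2 * real (card light) / (4 * real n)" using n by (simp add: field_simps)
      then show ?thesis by simp
    qed
    finally show ?thesis by (auto intro: ennreal_leI)
  qed
  have "(\<integral>\<^sup>+g. sum_char_tail R \<epsilon> (\<lambda>j. g j / sqrt (real n)) \<partial>gaussian n) =
     (\<integral>\<^sup>+g. \<integral>\<^sup>+t. ?w t * ennreal (norm (sum_char (\<lambda>j. g j / sqrt (real n)) t)) \<partial>lborel \<partial>gaussian n)"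
  proof -
    have "ennreal (x * y / \<bar>z\<bar>) = ennreal (y / \<bar>z\<bar>) * ennreal x" if "0 \<le> x" "0 \<le> y" for x y z :: real
      using that by (subst ennreal_mult[symmetric]) (auto simp: mult.commute)
    then show ?thesis
      unfolding sum_char_tail_def by (intro nn_integral_cong) (simp add: mult.assoc)
  qed
  also have "\<dots> = (\<integral>\<^sup>+t. \<integral>\<^sup>+g. ?w t * ennreal (norm (sum_char (\<lambda>j. g j / sqrt (real n)) t)) \<partial>gaussian n \<partial>lborel)"
    by (rule P.Fubini'[symmetric]) (simp add: split_beta')
  also have "\<dots> = (\<integral>\<^sup>+t. ?w t * (\<integral>\<^sup>+g. ennreal (norm (sum_char (\<lambda>j. g j / sqrt (real n)) t)) \<partial>gaussian n) \<partial>lborel)"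
  proof (intro nn_integral_cong nn_integral_cmult)
    fix t :: real
    show "(\<lambda>g. ennreal (norm (sum_char (\<lambda>j. g j / sqrt (real n)) t))) \<in> borel_measurable (gaussian n)"
    proof -
      have "(\<lambda>g. (g, t)) \<in> gaussian n \<rightarrow>\<^sub>M gaussian n \<Otimes>\<^sub>M lborel" by simp
      from measurable_compose[OF this m]
      have [measurable]: "(\<lambda>g. sum_char (\<lambda>j. g j / sqrt (real n)) t) \<in> borel_measurable (gaussian n)"
        by simp
      show ?thesis by measurable
    qed
  qed
  also have "\<dots> \<le> (\<integral>\<^sup>+t. ?w t * ennreal (exp (- R\<^sup>2 / 8)) \<partial>lborel)"
  proof (intro nn_integral_mono)
    fix t :: real
    show "?w t * (\<integral>\<^sup>+g. ennreal (norm (sum_char (\<lambda>j. g j / sqrt (real n)) t)) \<partial>gaussian n) \<le> ?w t * ennreal (exp (- R\<^sup>2 / 8))"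
      using avg[of t] by (cases "R \<le> \<bar>t\<bar>") (auto intro!: mult_left_mono)
  qed
  also have "\<dots> = (\<integral>\<^sup>+t. ?w t \<partial>lborel) * ennreal (exp (- R\<^sup>2 / 8))"
    by (rule nn_integral_multc) measurable
  also have "\<dots> \<le> ennreal (first_weight / (R^2 * \<epsilon>^2)) * ennreal (exp (- R\<^sup>2 / 8))"
    by (intro mult_right_mono nn_integral_exp_over_abs_le R \<epsilon>) simp
  also have "\<dots> = ennreal (exp (- R\<^sup>2 / 8) * (first_weight / (R^2 * \<epsilon>^2)))"
    using first_weight_nonneg by (subst ennreal_mult[symmetric]) (auto simp: mult.commute)
  finally show ?thesis .
qed

end

section \<open>The set of good directions and its probability\<close>

context standardized_family
begin

definition good_directions :: "real \<Rightarrow> real \<Rightarrow> real \<Rightarrow> real \<Rightarrow> (nat \<Rightarrow> real) set" where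
  "good_directions a R \<epsilon> b = {\<theta> \<in> unit_sphere n. quartic_sum \<theta> \<le> a \<and> \<bar>cubic_sum \<theta>\<bar> \<le> a \<and>
     1 / 224 \<le> controlled_mass R \<theta> \<and>
     sum_char_tail R \<epsilon> \<theta> \<le> ennreal b}"

text \<open>\<open>controlled_mass\<close> sums over an index set that depends on \<theta>; as a
  fixed sum of conditional terms it is measurable.\<close>

lemma good_directions_measurable: "good_directions a R \<epsilon> b \<in> sets (sphere_space n)"
proof -
  have "good_directions a R \<epsilon> b = unit_sphere n \<inter> {\<theta> \<in> space (borel_PiM n).
     quartic_sum \<theta> \<le> a \<and> \<bar>cubic_sum \<theta>\<bar> \<le> a \<and>
     1 / 224 \<le> (\<Sum>j=1..n. if (\<theta> j)^2 * m4 j * R^2 \<le> 1 / 2 then (\<theta> j)^2 else 0) \<and>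
     sum_char_tail R \<epsilon> \<theta> \<le> ennreal b}"
    unfolding sum.inter_filter[OF finite_atLeastAtMost, symmetric]
    by (auto simp: good_directions_def unit_sphere_def space_PiM)
  moreover have "{\<theta> \<in> space (borel_PiM n).
     quartic_sum \<theta> \<le> a \<and> \<bar>cubic_sum \<theta>\<bar> \<le> a \<and>
     1 / 224 \<le> (\<Sum>j=1..n. if (\<theta> j)^2 * m4 j * R^2 \<le> 1 / 2 then (\<theta> j)^2 else 0) \<and>
     sum_char_tail R \<epsilon> \<theta> \<le> ennreal b} \<in> sets (borel_PiM n)"
    unfolding quartic_sum_def cubic_sum_def by measurable
  ultimately show ?thesis by (auto simp: sets_restrict_space)
qed

text \<open>The deterministic half: a Gaussian point outside seven exceptional events has a good
  direction. \<open>e1\<close> and \<open>e2\<close> bound sums of fourth and sixth powers,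
  \<open>e3\<close> is the self-normalised bound for both signs, \<open>e4\<close> and
  \<open>e5\<close> confine |g|^2 / n, and \<open>e6\<close> bounds the tail integral before
  normalisation.\<close>

lemma normalise_in_good_directions:
  fixes p :: nat
  defines "N \<equiv> real n / mean_m4"
  assumes p: "1 \<le> p"
    and e1: "(\<Sum>j=1..n. m4 j * g j ^ 4) < exp 1 * real (2 * p) ^ 2 * (\<Sum>j=1..n. m4 j)"
    and e2: "(\<Sum>j=1..n. m4 j * g j ^ 6) < exp 1 * real (3 * p) ^ 3 * (\<Sum>j=1..n. m4 j)"
    and c: "c = 1 / (real p * sqrt (\<Sum>j=1..n. m4 j))"
    and e3: "(\<Sum>j=1..n. (c * m3 j) * g j ^ 3 - (c * m3 j)\<^sup>2 * g j ^ 6 / 2) < real p"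
       "(\<Sum>j=1..n. (- c * m3 j) * g j ^ 3 - (- c * m3 j)\<^sup>2 * g j ^ 6 / 2) < real p"
    and e4: "(\<Sum>j=1..n. (g j)^2) < 4 * real n"
    and e5: "real n / 56 < (\<Sum>j\<in>light. if (g j)^2 \<le> 6 then (g j)^2 else 0)"
    and R: "R^2 = N / 1600"
    and e6: "sum_char_tail (R / 2) (\<epsilon> / 8) (\<lambda>j. g j / sqrt (real n)) < ennreal b"
  shows "normalise n g \<in> good_directions (50000 * (real p)^2 / N) R \<epsilon> b"
proof -
  define m where "m = mean_m4"
  define W where "W = (\<Sum>j=1..n. m4 j)"
  define \<rho> where "\<rho> = (\<Sum>j=1..n. (g j)^2)"
  define s where "s = sqrt \<rho>"
  have n: "0 < real n" using one_le_n by simp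
  have m1: "1 \<le> m" unfolding m_def by (rule one_le_mean_m4)
  have W: "W = real n * m" using n by (simp add: W_def m_def mean_m4_def)
  have W0: "0 < W" using W n m1 by simp
  have p1: "1 \<le> real p" using p by simp
  have light_sub: "light \<subseteq> {1..n}" by (auto simp: light_def)
  have "(\<Sum>j\<in>light. if (g j)^2 \<le> 6 then (g j)^2 else 0) \<le> (\<Sum>j\<in>light. (g j)^2)"
    by (intro sum_mono) auto
  also have "\<dots> \<le> \<rho>" unfolding \<rho>_def using light_sub by (intro sum_mono2) auto
  finally have \<rho>: "real n / 56 < \<rho>" "\<rho> < 4 * real n" using e5 e4 by (auto simp: \<rho>_def)
  \<comment> \<open>Weakened from 56 to 64 to have the rational square root 1/8.\<close>
  have \<rho>64: "real n / 64 \<le> \<rho>" using \<rho> n by simp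
  have \<rho>0: "0 < \<rho>" using \<rho> n by (simp add: less_trans[of 0 "real n / 56"])
  have s0: "0 < s" and s2: "s^2 = \<rho>" using \<rho>0 by (auto simp: s_def)
  have s8: "sqrt (real n) / 8 \<le> s"
  proof -
    have "sqrt (real n / 64) \<le> s" unfolding s_def using \<rho>64 by (rule real_sqrt_le_mono)
    moreover have "sqrt 64 = (8 :: real)" by (rule real_sqrt_unique) auto
    ultimately show ?thesis by (simp add: real_sqrt_divide)
  qed
  have s_2: "s \<le> sqrt (real n) * 2"
  proof -
    have "s \<le> sqrt (4 * real n)" unfolding s_def using \<rho> by (intro real_sqrt_le_mono) simp
    then show ?thesis by (simp add: real_sqrt_mult)
  qed
  have nrm: "normalise n g j = g j / s" if "j \<in> {1..n}" for j
    using that \<rho>0 by (auto simp: normalise_def s_def \<rho>_def)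
  have exp3: "exp 1 \<le> (3 :: real)" by (rule exp_le)

  have quartic: "quartic_sum (normalise n g) \<le> 50000 * (real p)^2 / N"
  proof -
    have "quartic_sum (normalise n g) = (\<Sum>j=1..n. m4 j * g j ^ 4 / \<rho>^2)"
      unfolding quartic_sum_def s2[symmetric]
      by (intro sum.cong refl) (simp add: nrm power_divide mult.commute flip: power_mult)
    also have "\<dots> = (\<Sum>j=1..n. m4 j * g j ^ 4) / \<rho>^2" by (rule sum_divide_distrib[symmetric])
    also have "\<dots> \<le> (3 * real (2 * p) ^ 2 * W) / (real n / 64)^2"
    proof (rule frac_le)
      have "exp 1 * real (2 * p) ^ 2 * W \<le> 3 * real (2 * p) ^ 2 * W"
        using exp3 W0 by (intro mult_right_mono) auto
      then show "(\<Sum>j=1..n. m4 j * g j ^ 4) \<le> 3 * real (2 * p) ^ 2 * W" using e1 by (simp add: W_def)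
      show "(real n / 64)^2 \<le> \<rho>^2" using \<rho>64 n by (intro power_mono) auto
    qed (use W0 n in auto)
    also have "\<dots> = 49152 * (real p)^2 / N"
      using n m1 by (simp add: W N_def m_def[symmetric] power2_eq_square field_simps)
    also have "\<dots> \<le> 50000 * (real p)^2 / N"
      using n m1 by (intro divide_right_mono) (auto simp: N_def m_def)
    finally show ?thesis .
  qed

  have cubic: "\<bar>cubic_sum (normalise n g)\<bar> \<le> 50000 * (real p)^2 / N"
  proof -
    define q where "q = sqrt W"
    have q0: "0 < q" and q2: "q^2 = W" using W0 by (auto simp: q_def)
    have cq: "c = 1 / (real p * q)" by (simp add: c q_def W_def)
    have c0: "0 < c" using cq q0 p1 by simp
    define T where "T = (\<Sum>j=1..n. m3 j * g j ^ 3)"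
    define V where "V = (\<Sum>j=1..n. (m3 j)^2 * g j ^ 6)"
    have V: "V \<le> 3 * real (3 * p) ^ 3 * W"
    proof -
      have "V \<le> (\<Sum>j=1..n. m4 j * g j ^ 6)"
        unfolding V_def using standardized standardized_law.third_moment_square_le
        by (intro sum_mono mult_right_mono) auto
      also have "\<dots> \<le> exp 1 * real (3 * p) ^ 3 * W" using e2 by (simp add: W_def)
      also have "\<dots> \<le> 3 * real (3 * p) ^ 3 * W" using exp3 W0 by (intro mult_right_mono) auto
      finally show ?thesis .
    qed
    \<comment> \<open>The choice of c balances the two parts: V is at most 81 p^3 W, so the
      compensator c^2 V / 2 is of order p like the level in \<open>e3\<close>, and division by c
      leaves p^2 sqrt W.\<close>
    have "c^2 * V / 2 \<le> c^2 * (3 * real (3 * p) ^ 3 * W) / 2" using V by (intro divide_right_mono mult_left_mono) auto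
    also have "\<dots> = 81 / 2 * real p"
      using p1 q0 unfolding cq q2[symmetric] by (simp add: field_simps power2_eq_square power3_eq_cube)
    finally have cV: "c^2 * V / 2 \<le> 81 / 2 * real p" .
    have "(\<Sum>j=1..n. (c * m3 j) * g j ^ 3 - (c * m3 j)\<^sup>2 * g j ^ 6 / 2) = c * T - c\<^sup>2 * V / 2"
      "(\<Sum>j=1..n. (- c * m3 j) * g j ^ 3 - (- c * m3 j)\<^sup>2 * g j ^ 6 / 2) = - (c * T) - c\<^sup>2 * V / 2"
      unfolding T_def V_def
      by (simp_all add: sum_subtractf sum_distrib_left sum_divide_distrib power_mult_distrib mult_ac sum_negf)
    then have "\<bar>c * T\<bar> \<le> 83 / 2 * real p" using e3 cV by (simp add: abs_le_iff)
    then have cT: "c * \<bar>T\<bar> \<le> 83 / 2 * real p" using c0 by (simp add: abs_mult)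
    have T: "\<bar>T\<bar> \<le> 83 / 2 * (real p)^2 * q"
    proof -
      have "\<bar>T\<bar> = (real p * q) * (c * \<bar>T\<bar>)" using p1 q0 by (simp add: cq)
      also have "\<dots> \<le> (real p * q) * (83 / 2 * real p)" using cT p1 q0 by (intro mult_left_mono) auto
      finally show ?thesis by (simp add: power2_eq_square mult_ac)
    qed
    \<comment> \<open>With m >= 1, sqrt m is raised to m, so that the cubic sum gets a bound of the
      same form p^2 m / n as the quartic one.\<close>
    have q_le: "q \<le> sqrt (real n) * m"
    proof -
      have "sqrt m \<le> m" using m1 real_sqrt_le_mono[of m "m^2"] by (simp add: power2_eq_square)
      then show ?thesis using n by (simp add: q_def W real_sqrt_mult mult_left_mono)
    qed
    have "cubic_sum (normalise n g) = (\<Sum>j=1..n. m3 j * g j ^ 3 / s ^ 3)"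
      unfolding cubic_sum_def by (intro sum.cong refl) (simp add: nrm power_divide mult.commute)
    also have "\<dots> = T / s ^ 3" by (simp add: T_def sum_divide_distrib)
    finally have "\<bar>cubic_sum (normalise n g)\<bar> = \<bar>T\<bar> / s ^ 3" using s0 by simp
    also have "\<dots> \<le> (83 / 2 * (real p)^2 * (sqrt (real n) * m)) / (sqrt (real n) / 8) ^ 3"
    proof (rule frac_le)
      show "\<bar>T\<bar> \<le> 83 / 2 * (real p)^2 * (sqrt (real n) * m)"
        by (rule order_trans[OF T]) (use q_le in \<open>intro mult_left_mono; simp\<close>)
      show "(sqrt (real n) / 8) ^ 3 \<le> s ^ 3" using s8 n by (intro power_mono) auto
    qed (use n m1 in auto)
    also have "\<dots> = 21248 * (real p)^2 * m / real n"
    proof -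
      have "(sqrt (real n)) ^ 3 = real n * sqrt (real n)" by (simp add: power3_eq_cube)
      then show ?thesis using n by (simp add: power_divide field_simps)
    qed
    also have "\<dots> = 21248 * (real p)^2 / N" by (simp add: N_def m_def)
    also have "\<dots> \<le> 50000 * (real p)^2 / N"
      using n m1 by (intro divide_right_mono) (auto simp: N_def m_def)
    finally show ?thesis .
  qed

  have mass: "1 / 224 \<le> controlled_mass R (normalise n g)"
  proof -
    \<comment> \<open>The ratio of the lower bound in \<open>e5\<close> to the upper bound in
      \<open>e4\<close> is 1/224.\<close>
    have "(real n / 56) / (4 * real n) \<le> (\<Sum>j\<in>light. if (g j)^2 \<le> 6 then (g j)^2 else 0) / \<rho>"
      using e5 \<rho> \<rho>0 n by (intro frac_le sum_nonneg) auto
    also have "\<dots> = (\<Sum>j\<in>{j\<in>light. (g j)^2 \<le> 6}. (g j)^2) / \<rho>"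
      using finite_subset[OF light_sub] by (simp add: sum.inter_filter)
    also have "\<dots> = (\<Sum>j\<in>{j\<in>light. (g j)^2 \<le> 6}. (normalise n g j)^2)"
      unfolding sum_divide_distrib
    proof (intro sum.cong refl)
      fix j assume "j \<in> {j \<in> light. (g j)^2 \<le> 6}"
      then have "j \<in> {1..n}" using light_sub by auto
      then show "(g j)^2 / \<rho> = (normalise n g j)^2" by (simp add: nrm power_divide s2)
    qed
    also have "\<dots> \<le> controlled_mass R (normalise n g)"
    proof (rule sum_mono2)
      show "{j \<in> light. (g j)^2 \<le> 6} \<subseteq> {j \<in> {1..n}. (normalise n g j)^2 * m4 j * R^2 \<le> 1 / 2}"
      proof
        fix j assume j: "j \<in> {j \<in> light. (g j)^2 \<le> 6}"
        then have jn: "j \<in> {1..n}" and jm: "m4 j \<le> 2 * m" using light_sub by (auto simp: light_def m_def)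
        have "(normalise n g j)^2 * m4 j * R^2 = ((g j)^2 / \<rho>) * m4 j * (real n / (1600 * m))"
          using jn by (simp add: nrm power_divide s2 R N_def m_def)
        \<comment> \<open>Origin of 1600 in R: the truncation level 6, the norm bound n / 64 and the
          factor 2 for light coordinates give 768 / 1600 < 1/2.\<close>
        also have "\<dots> \<le> (6 / (real n / 64)) * (2 * m) * (real n / (1600 * m))"
          using j jm \<rho>64 n m1 m4_nonneg[OF jn] by (intro mult_mono frac_le) auto
        also have "\<dots> \<le> 1 / 2" using n m1 by (simp add: field_simps)
        finally show "j \<in> {j \<in> {1..n}. (normalise n g j)^2 * m4 j * R^2 \<le> 1 / 2}" using jn by simp
      qed
    qed auto
    finally show ?thesis using n by simp
  qed

  have tail: "sum_char_tail R \<epsilon> (normalise n g) \<le> ennreal b"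
  proof -
    \<comment> \<open>This ratio lies in [1/8, 2], which explains the cut-off R / 2 and the
      smoothing \<epsilon> / 8 in \<open>e6\<close>.\<close>
    define r where "r = s / sqrt (real n)"
    have r: "1 / 8 \<le> r" "r \<le> 2" using s8 s_2 n by (auto simp: r_def field_simps)
    have "sum_char_tail R \<epsilon> (normalise n g) = sum_char_tail R \<epsilon> (\<lambda>j. (g j / sqrt (real n)) / r)"
    proof -
      have "sum_char (normalise n g) t = sum_char (\<lambda>j. (g j / sqrt (real n)) / r) t" for t
        unfolding sum_char_def by (intro prod.cong refl) (use n in \<open>simp add: nrm r_def\<close>)
      then show ?thesis by (simp add: sum_char_tail_def)
    qed
    also have "\<dots> \<le> sum_char_tail (R / 2) (\<epsilon> * (1 / 8)) (\<lambda>j. g j / sqrt (real n))"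
      by (rule sum_char_tail_rescale) (use r in auto)
    finally show ?thesis using e6 by simp
  qed
  show ?thesis
    unfolding good_directions_def
    using normalise_in_unit_sphere[OF one_le_n] quartic cubic mass tail by blast
qed

text \<open>A union bound over seven events of probability at most exp (- p). The condition p <= n /
  56 serves the two norm bounds, \<open>small\<close> the averaged tail.\<close>

lemma sphere_measure_good_directions:
  fixes p :: nat
  defines "N \<equiv> real n / mean_m4"
  assumes p: "1 \<le> p" "real p \<le> real n / 56" and R: "0 < R" "R^2 = N / 1600" and \<epsilon>: "0 < \<epsilon>" and b: "0 < b"
    and small: "exp (- N / 51200) * (409600 * first_weight / (N * \<epsilon>^2)) \<le> exp (- real p) * b"
  shows "1 - 7 * exp (- real p) \<le>
    measure (sphere_measure n) (good_directions (50000 * (real p)^2 / N) R \<epsilon> b)"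
proof -
  interpret G: prob_space "gaussian n" by (rule prob_space_gaussian)
  let ?F = "good_directions (50000 * (real p)^2 / N) R \<epsilon> b"
  define W where "W = (\<Sum>j=1..n. m4 j)"
  define c where "c = 1 / (real p * sqrt W)"
  have n: "0 < real n" using one_le_n by simp
  have N: "0 < N" using n one_le_mean_m4 by (simp add: N_def)
  have W0: "0 < (\<Sum>j=1..n. m4 j)"
    using n one_le_mean_m4 by (simp add: mean_m4_def field_simps)
  note F = good_directions_measurable[of "50000 * (real p)^2 / N" R \<epsilon> b]
  note nm = normalise_measurable[OF one_le_n]
  have nm': "normalise n \<in> gaussian n \<rightarrow>\<^sub>M sphere_space n"
    using nm by (simp cong: measurable_cong_sets add: measurable_cong_sets[OF sets_gaussian refl])
  define A where "A = normalise n -` ?F \<inter> space (gaussian n)"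
  have A[measurable]: "A \<in> sets (gaussian n)" unfolding A_def by (rule measurable_sets[OF nm' F])
  have mF: "measure (sphere_measure n) ?F = G.prob A"
    unfolding sphere_measure_eq[OF one_le_n] A_def by (rule measure_distr[OF nm' F])
  have scaled: "(\<lambda>g. sum_char_tail (R / 2) (\<epsilon> / 8) (\<lambda>j. g j / sqrt (real n))) \<in> borel_measurable (gaussian n)"
  proof -
    have "(\<lambda>g. \<lambda>j\<in>{1..n}. g j / sqrt (real n)) \<in> gaussian n \<rightarrow>\<^sub>M borel_PiM n"
      by measurable
    from measurable_compose[OF this sum_char_tail_measurable]
    have "(\<lambda>g. sum_char_tail (R / 2) (\<epsilon> / 8) (\<lambda>j\<in>{1..n}. g j / sqrt (real n))) \<in> borel_measurable (gaussian n)" .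
    moreover have "sum_char (\<lambda>j\<in>{1..n}. g j / sqrt (real n)) t = sum_char (\<lambda>j. g j / sqrt (real n)) t" for g t
      unfolding sum_char_def by (intro prod.cong refl) simp
    ultimately show ?thesis by (simp add: sum_char_tail_def)
  qed
  note scaled[measurable]
  have [measurable]: "light \<subseteq> {1..n}" by (auto simp: light_def)
  define B1 where "B1 = {g \<in> space (gaussian n). exp 1 * real (2 * p) ^ 2 * (\<Sum>j=1..n. m4 j) \<le> (\<Sum>j=1..n. m4 j * g j ^ (2 * 2))}"
  define B2 where "B2 = {g \<in> space (gaussian n). exp 1 * real (3 * p) ^ 3 * (\<Sum>j=1..n. m4 j) \<le> (\<Sum>j=1..n. m4 j * g j ^ (2 * 3))}"
  define B3 where "B3 = {g \<in> space (gaussian n). real p \<le> (\<Sum>j=1..n. (c * m3 j) * g j ^ 3 - (c * m3 j)\<^sup>2 * g j ^ 6 / 2)}"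
  define B4 where "B4 = {g \<in> space (gaussian n). real p \<le> (\<Sum>j=1..n. (- c * m3 j) * g j ^ 3 - (- c * m3 j)\<^sup>2 * g j ^ 6 / 2)}"
  define B5 where "B5 = {g \<in> space (gaussian n). 4 * real n \<le> (\<Sum>j=1..n. (g j)^2)}"
  define B6 where "B6 = {g \<in> space (gaussian n). (\<Sum>j\<in>light. if (g j)^2 \<le> 6 then (g j)^2 else 0) \<le> real n / 56}"
  define B7 where "B7 = {g \<in> space (gaussian n). ennreal b \<le> sum_char_tail (R / 2) (\<epsilon> / 8) (\<lambda>j. g j / sqrt (real n))}"
  have P1: "G.prob B1 \<le> exp (- real p)" and P2: "G.prob B2 \<le> exp (- real p)"
    unfolding B1_def B2_def by (rule gaussian_power_sum_tail; use m4_nonneg W0 p in simp)+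
  have P3: "G.prob B3 \<le> exp (- real p)" and P4: "G.prob B4 \<le> exp (- real p)"
    unfolding B3_def B4_def by (rule gaussian_cubic_tail)+
  have P5: "G.prob B5 \<le> exp (- real p)"
    unfolding B5_def by (rule order_trans[OF gaussian_norm_upper_tail]) (use p in simp)
  have P6: "G.prob B6 \<le> exp (- real p)"
    unfolding B6_def by (rule order_trans[OF gaussian_truncated_norm_lower_tail]) (use p card_light in \<open>auto simp: light_def\<close>)
  have P7: "G.prob B7 \<le> exp (- real p)"
    unfolding B7_def
  proof (rule G.prob_ge_le_exp[OF scaled b])
    \<comment> \<open>From this, (R / 2)^2 / 8 = N / 51200 and (R / 2)^2 (\<epsilon> / 8)^2 = N
      \<epsilon>^2 / 409600, the constants in \<open>small\<close>.\<close>
    have R2: "(R / 2)^2 = N / 6400" using R by (simp add: power_divide)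
    have "(\<integral>\<^sup>+g. sum_char_tail (R / 2) (\<epsilon> / 8) (\<lambda>j. g j / sqrt (real n)) \<partial>gaussian n) \<le>
       ennreal (exp (- (R / 2)\<^sup>2 / 8) * (first_weight / ((R / 2)^2 * (\<epsilon> / 8)^2)))"
    proof (rule sum_char_tail_expectation)
      have "4 * (R / 2)^2 * mean_m4 = real n / 1600"
        unfolding R2 N_def using one_le_mean_m4 by simp
      then show "4 * (R / 2)^2 * mean_m4 \<le> real n" using n by simp
    qed (use R \<epsilon> in auto)
    also have "exp (- (R / 2)\<^sup>2 / 8) * (first_weight / ((R / 2)^2 * (\<epsilon> / 8)^2)) =
        exp (- N / 51200) * (409600 * first_weight / (N * \<epsilon>^2))"
      unfolding R2 by (simp add: power_divide)
    also have "ennreal \<dots> \<le> ennreal (exp (- real p) * b)" by (rule ennreal_leI[OF small])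
    finally show "(\<integral>\<^sup>+g. sum_char_tail (R / 2) (\<epsilon> / 8) (\<lambda>j. g j / sqrt (real n)) \<partial>gaussian n) \<le> ennreal (exp (- real p) * b)" .
  qed
  have meas[measurable]: "B1 \<in> sets (gaussian n)" "B2 \<in> sets (gaussian n)" "B3 \<in> sets (gaussian n)" "B4 \<in> sets (gaussian n)"
     "B5 \<in> sets (gaussian n)" "B7 \<in> sets (gaussian n)"
    unfolding B1_def B2_def B3_def B4_def B5_def B7_def by measurable
  have meas6[measurable]: "B6 \<in> sets (gaussian n)"
  proof -
    have "(\<lambda>g. \<Sum>j\<in>light. if (g j)^2 \<le> 6 then (g j)^2 else 0) \<in> borel_measurable (gaussian n)"
    proof (rule borel_measurable_sum)
      fix j assume "j \<in> light"
      then have [measurable]: "j \<in> {1..n}" by (auto simp: light_def)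
      show "(\<lambda>g. if (g j)^2 \<le> 6 then (g j)^2 else 0) \<in> borel_measurable (gaussian n)" by measurable
    qed
    then show ?thesis unfolding B6_def by measurable
  qed
  have "space (gaussian n) - A \<subseteq> B1 \<union> (B2 \<union> (B3 \<union> (B4 \<union> (B5 \<union> (B6 \<union> B7)))))"
  proof (rule ccontr)
    assume "\<not> ?thesis"
    then obtain g where g: "g \<in> space (gaussian n)" "g \<notin> A"
      and nB: "g \<notin> B1" "g \<notin> B2" "g \<notin> B3" "g \<notin> B4" "g \<notin> B5" "g \<notin> B6" "g \<notin> B7" by blast
    have f1: "(\<Sum>j=1..n. m4 j * g j ^ 4) < exp 1 * real (2 * p) ^ 2 * (\<Sum>j=1..n. m4 j)"
      using nB(1) g(1) by (simp add: B1_def not_le)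
    have f2: "(\<Sum>j=1..n. m4 j * g j ^ 6) < exp 1 * real (3 * p) ^ 3 * (\<Sum>j=1..n. m4 j)"
      using nB(2) g(1) by (simp add: B2_def not_le)
    have f3: "(\<Sum>j=1..n. (c * m3 j) * g j ^ 3 - (c * m3 j)\<^sup>2 * g j ^ 6 / 2) < real p"
      using nB(3) g(1) unfolding B3_def mem_Collect_eq by linarith
    have f4: "(\<Sum>j=1..n. (- c * m3 j) * g j ^ 3 - (- c * m3 j)\<^sup>2 * g j ^ 6 / 2) < real p"
      using nB(4) g(1) unfolding B4_def mem_Collect_eq by linarith
    have f5: "(\<Sum>j=1..n. (g j)^2) < 4 * real n"
      using nB(5) g(1) unfolding B5_def mem_Collect_eq by linarith
    have f6: "real n / 56 < (\<Sum>j\<in>light. if (g j)^2 \<le> 6 then (g j)^2 else 0)"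
      using nB(6) g(1) unfolding B6_def mem_Collect_eq by linarith
    have f7: "sum_char_tail (R / 2) (\<epsilon> / 8) (\<lambda>j. g j / sqrt (real n)) < ennreal b"
      using nB(7) g(1) unfolding B7_def mem_Collect_eq not_le[symmetric] by blast
    have "normalise n g \<in> ?F"
      unfolding N_def
      by (rule normalise_in_good_directions[OF p(1) f1 f2 c_def[unfolded W_def] f3 f4 f5 f6 _ f7])
        (simp add: R N_def)
    then show False using g by (simp add: A_def)
  qed
  then have "G.prob (space (gaussian n) - A) \<le> G.prob (B1 \<union> (B2 \<union> (B3 \<union> (B4 \<union> (B5 \<union> (B6 \<union> B7))))))"
    by (rule G.finite_measure_mono) measurable
  also have "\<dots> \<le> G.prob B1 + (G.prob B2 + (G.prob B3 + (G.prob B4 + (G.prob B5 + (G.prob B6 + G.prob B7)))))"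
    using measure_Un_le[of B1 "gaussian n" "B2 \<union> (B3 \<union> (B4 \<union> (B5 \<union> (B6 \<union> B7))))"]
      measure_Un_le[of B2 "gaussian n" "B3 \<union> (B4 \<union> (B5 \<union> (B6 \<union> B7)))"]
      measure_Un_le[of B3 "gaussian n" "B4 \<union> (B5 \<union> (B6 \<union> B7))"]
      measure_Un_le[of B4 "gaussian n" "B5 \<union> (B6 \<union> B7)"]
      measure_Un_le[of B5 "gaussian n" "B6 \<union> B7"] measure_Un_le[of B6 "gaussian n" B7]
      meas meas6 by (simp add: sets.Un)
  also have "\<dots> \<le> 7 * exp (- real p)" using P1 P2 P3 P4 P5 P6 P7 by linarith
  finally have "1 - G.prob A \<le> 7 * exp (- real p)" by (simp add: G.prob_compl)
  then show ?thesis unfolding mF by simp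
qed

end

section \<open>Normal approximation\<close>

lemma std_normal_interval:
  "measure std_gauss {\<alpha>..\<beta>} = 1 / sqrt (2 * pi) * (LBINT t:{\<alpha>..\<beta>}. exp (- t\<^sup>2 / 2))"
proof -
  have "measure std_gauss {\<alpha>..\<beta>} = (LINT t|std_gauss. indicator {\<alpha>..\<beta>} t)"
    by simp
  also have "\<dots> = (LINT t|lborel. std_normal_density t *\<^sub>R indicator {\<alpha>..\<beta>} t)"
    by (rule integral_density) auto
  also have "\<dots> = (LINT t|lborel. 1 / sqrt (2 * pi) * (indicator {\<alpha>..\<beta>} t *\<^sub>R exp (- t\<^sup>2 / 2)))"
    by (intro LINT_cong refl) (simp add: std_normal_density_def)
  finally show ?thesis unfolding set_lebesgue_integral_def by simp
qed

text \<open>For a closed interval the left endpoint involves left limits of the cdfs; the uniform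
  bound survives that limit, and each endpoint contributes e.\<close>

lemma interval_diff_le_cdf_diff:
  assumes \<mu>: "real_distribution \<mu>" and \<nu>: "real_distribution \<nu>" and \<alpha>\<beta>: "\<alpha> < \<beta>"
    and le: "\<And>x. \<bar>cdf \<mu> x - cdf \<nu> x\<bar> \<le> e"
  shows "\<bar>measure \<mu> {\<alpha>..\<beta>} - measure \<nu> {\<alpha>..\<beta>}\<bar> \<le> 2 * e"
proof -
  interpret \<mu>: real_distribution \<mu> by fact
  interpret \<nu>: real_distribution \<nu> by fact
  have "((\<lambda>x. \<bar>cdf \<mu> x - cdf \<nu> x\<bar>) \<longlongrightarrow> \<bar>measure \<mu> {..<\<alpha>} - measure \<nu> {..<\<alpha>}\<bar>) (at_left \<alpha>)"
    by (intro tendsto_intros \<mu>.cdf_at_left \<nu>.cdf_at_left)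
  then have left: "\<bar>measure \<mu> {..<\<alpha>} - measure \<nu> {..<\<alpha>}\<bar> \<le> e"
    by (rule tendsto_upperbound) (auto intro: always_eventually le)
  have split: "measure M {\<alpha>..\<beta>} = cdf M \<beta> - measure M {..<\<alpha>}" if "real_distribution M" for M
  proof -
    interpret real_distribution M by fact
    have "{\<alpha>..\<beta>} = {..\<beta>} - {..<\<alpha>}" "{..<\<alpha>} \<subseteq> {..\<beta>}" using \<alpha>\<beta> by auto
    then show ?thesis by (simp add: cdf_def finite_measure_Diff)
  qed
  show ?thesis using left le[of \<beta>] split[OF \<mu>] split[OF \<nu>] by linarith
qed

section \<open>Linear forms of independent random variables\<close>

locale normalized_variables = prob_space M for M :: "'a measure" +
  fixes n :: nat and X :: "nat \<Rightarrow> 'a \<Rightarrow> real"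
  assumes normalized: "normalized_independent M n X" and dimension: "1 \<le> n"
begin

definition law :: "nat \<Rightarrow> real measure" where
  "law j = distr M borel (X j)"

abbreviation sum_law :: "(nat \<Rightarrow> real) \<Rightarrow> real measure" where
  "sum_law \<theta> \<equiv> distr M borel (\<lambda>\<omega>. \<Sum>j=1..n. \<theta> j * X j \<omega>)"

lemma indep: "indep_vars (\<lambda>_. borel) X {1..n}"
  using normalized by (simp add: normalized_independent_def)

lemma X_measurable: "j \<in> {1..n} \<Longrightarrow> X j \<in> borel_measurable M"
  using indep by (auto simp: indep_vars_def)

lemma linear_form_measurable: "(\<lambda>\<omega>. \<Sum>j=1..n. \<theta> j * X j \<omega>) \<in> borel_measurable M"
  using X_measurable by (auto intro!: borel_measurable_sum)

sublocale family: standardized_family n law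
proof (rule standardized_family.intro)
  show "1 \<le> n" by (rule dimension)
  fix j assume j: "j \<in> {1..n}"
  note [measurable] = X_measurable[OF j]
  have "real_distribution (law j)"
    unfolding law_def by (rule real_distribution_distr) simp
  moreover have "standardized_law_axioms (law j)"
  proof (rule standardized_law_axioms.intro)
    show "integrable (law j) (\<lambda>x. x ^ 4)" "(LINT x|law j. x) = 0" "(LINT x|law j. x^2) = 1"
      unfolding law_def using normalized j
      by (auto simp: normalized_independent_def integral_distr integrable_distr_eq)
  qed
  ultimately show "standardized_law (law j)" by (rule standardized_law.intro)
qed

lemma mean_m4_eq: "family.mean_m4 = (\<Sum>j=1..n. LINT \<omega>|M. X j \<omega> ^ 4) / real n"
proof -
  have "family.m4 j = (LINT \<omega>|M. X j \<omega> ^ 4)" if j: "j \<in> {1..n}" for j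
    unfolding standardized_law.fourth_moment_def[OF family.standardized[OF j]]
    using X_measurable[OF j] by (simp add: law_def integral_distr)
  then show ?thesis unfolding family.mean_m4_def by (metis (no_types, lifting) sum.cong)
qed

lemma moment_delta_power4: "moment_delta M n X ^ 4 = family.mean_m4"
proof -
  have "0 < family.mean_m4" using family.one_le_mean_m4 by linarith
  moreover have "moment_delta M n X = family.mean_m4 powr (1 / 4)"
    by (simp add: moment_delta_def mean_m4_eq)
  ultimately show ?thesis by (simp add: powr_powr flip: powr_realpow)
qed

lemma char_linear_form:
  "char (sum_law \<theta>) t = family.sum_char \<theta> t"
proof -
  have "indep_vars (\<lambda>_. borel) (\<lambda>j. (\<lambda>x. \<theta> j * x) \<circ> X j) {1..n}"
    by (rule indep_vars_compose[OF indep]) simp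
  then have "indep_vars (\<lambda>_. borel) (\<lambda>j \<omega>. \<theta> j * X j \<omega>) {1..n}" by (simp add: o_def)
  then have "char (sum_law \<theta>) t = (\<Prod>j=1..n. char (distr M borel (\<lambda>\<omega>. \<theta> j * X j \<omega>)) t)"
    by (rule char_distr_sum)
  also have "\<dots> = family.sum_char \<theta> t"
    unfolding family.sum_char_def
  proof (intro prod.cong refl)
    fix j assume "j \<in> {1..n}"
    note [measurable] = X_measurable[OF this]
    show "char (distr M borel (\<lambda>\<omega>. \<theta> j * X j \<omega>)) t = char (law j) (\<theta> j * t)"
      unfolding char_def law_def
      by (subst (1 2) integral_distr) (simp_all add: mult_ac)
  qed
  finally show ?thesis .
qed

lemma linear_form_law: "real_distribution (sum_law \<theta>)"
  by (rule real_distribution_distr) (rule linear_form_measurable)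

lemma normal_discrepancy_eq:
  "normal_discrepancy M n X \<theta> = (SUP (\<alpha>, \<beta>)\<in>{(\<alpha>, \<beta>). \<alpha> < \<beta>}.
     \<bar>measure (sum_law \<theta>) {\<alpha>..\<beta>} - measure std_gauss {\<alpha>..\<beta>}\<bar>)"
proof -
  have "measure (sum_law \<theta>) {\<alpha>..\<beta>} =
    measure M {\<omega> \<in> space M. \<alpha> \<le> (\<Sum>j=1..n. \<theta> j * X j \<omega>) \<and> (\<Sum>j=1..n. \<theta> j * X j \<omega>) \<le> \<beta>}" for \<alpha> \<beta>
    by (subst measure_distr[OF linear_form_measurable])
      (auto intro!: arg_cong[where f = "measure M"])
  then show ?thesis unfolding normal_discrepancy_def std_normal_interval by simp
qed

lemma normal_discrepancy_le:
  assumes "\<And>x. \<bar>cdf (sum_law \<theta>) x - cdf std_gauss x\<bar> \<le> e"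
  shows "normal_discrepancy M n X \<theta> \<le> 2 * e"
  unfolding normal_discrepancy_eq
proof (rule cSUP_least)
  show "{(\<alpha>, \<beta>). \<alpha> < \<beta>} \<noteq> ({} :: (real \<times> real) set)" using zero_less_one by blast
qed (use interval_diff_le_cdf_diff[OF linear_form_law real_dist_normal_dist _ assms] in auto)

lemma normal_discrepancy_le_1: "normal_discrepancy M n X \<theta> \<le> 1"
  unfolding normal_discrepancy_eq
proof (rule cSUP_least)
  interpret L: real_distribution "sum_law \<theta>" by (rule linear_form_law)
  show "{(\<alpha>, \<beta>). \<alpha> < \<beta>} \<noteq> ({} :: (real \<times> real) set)" using zero_less_one by blast
  fix p :: "real \<times> real"
  show "(case p of (\<alpha>, \<beta>) \<Rightarrow> \<bar>L.prob {\<alpha>..\<beta>} - measure std_gauss {\<alpha>..\<beta>}\<bar>) \<le> 1"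
    using L.prob_le_1[of "{fst p..snd p}"] std_normal.prob_le_1[of "{fst p..snd p}"]
      measure_nonneg[of "sum_law \<theta>" "{fst p..snd p}"]
      measure_nonneg[of std_gauss "{fst p..snd p}"]
    unfolding split_beta by linarith
qed

lemma normal_discrepancy_good_direction:
  assumes \<theta>: "\<theta> \<in> family.good_directions a R \<epsilon> b" and R: "0 < R" and \<epsilon>: "0 < \<epsilon>" and b: "0 \<le> b"
  shows "normal_discrepancy M n X \<theta> \<le>
    2 * (3 * \<epsilon> + (4 * a * third_weight + b + first_weight / R^2))"
proof (rule normal_discrepancy_le, rule smoothing_inequality[OF linear_form_law \<epsilon>])
  have "0 \<le> a" using \<theta> by (auto simp: family.good_directions_def)
  then show "0 \<le> 4 * a * third_weight + b + first_weight / R^2"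
    using b third_weight_nonneg first_weight_nonneg by auto
  show "(\<integral>\<^sup>+t. ennreal (norm (char (sum_law \<theta>) t - exp (- t\<^sup>2 / 2)) *
      exp (- (\<epsilon> * t)\<^sup>2 / 2) / \<bar>t\<bar>) \<partial>lborel)
    \<le> ennreal (4 * a * third_weight + b + first_weight / R^2)"
    unfolding char_linear_form
    by (rule family.smoothed_char_integral_le)
      (use \<theta> R b in \<open>auto simp: family.good_directions_def unit_sphere_def\<close>)
qed

end

section \<open>Choice of the constants\<close>

lemma exists_threshold:
  "\<exists>B\<ge>512000. \<forall>N\<ge>B. 409600 * first_weight * N^2 * exp (- N / 51200) \<le> exp (- N / 102400)"
proof -
  \<comment> \<open>In terms of x = N / 102400 the left side is w x^2 exp (- 2 x). Half of the decay
    absorbs the polynomial, the other half is kept to pay for exp (- p).\<close>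
  define w where "w = 409600 * first_weight * 102400^2"
  have w: "0 \<le> w" using first_weight_nonneg by (simp add: w_def)
  have "((\<lambda>x::real. w * (x ^ 2 / exp x)) \<longlongrightarrow> w * 0) at_top"
    by (intro tendsto_mult tendsto_const tendsto_power_div_exp_0)
  then have "\<forall>\<^sub>F x in at_top. w * (x ^ 2 / exp x) < 1"
    by (intro order_tendstoD) auto
  then obtain x0 where x0: "\<And>x. x0 \<le> x \<Longrightarrow> w * (x ^ 2 / exp x) < 1"
    by (auto simp: eventually_at_top_linorder)
  show ?thesis
  proof (intro exI conjI allI impI)
    show "512000 \<le> max 512000 (102400 * x0)" by simp
    fix N :: real assume N: "max 512000 (102400 * x0) \<le> N"
    define x where "x = N / 102400"
    have "w * (x ^ 2 / exp x) < 1" using N by (intro x0) (simp add: x_def)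
    then have "w * x^2 \<le> exp x" by (simp add: field_simps)
    then have "w * x^2 * exp (- (2 * x)) \<le> exp x * exp (- (2 * x))" by (intro mult_right_mono) auto
    moreover have "w * x^2 = 409600 * first_weight * N^2"
      by (simp add: w_def x_def power_divide)
    ultimately show "409600 * first_weight * N^2 * exp (- N / 51200) \<le> exp (- N / 102400)"
      by (simp add: x_def flip: exp_add)
  qed
qed

lemma exists_admissible_constant:
  "\<exists>C>0. \<forall>(M :: 'a measure) n X \<rho>. 1 \<le> n \<longrightarrow> 0 < \<rho> \<longrightarrow> \<rho> < 1 \<longrightarrow> normalized_independent M n X \<longrightarrow>
     (\<exists>F. F \<subseteq> unit_sphere n \<and> F \<in> sets (sphere_measure n) \<and> measure (sphere_measure n) F \<ge> 1 - \<rho> \<and>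
       (\<forall>\<theta>\<in>F. normal_discrepancy M n X \<theta> \<le> C * (max 1 (ln (1 / \<rho>)))^2 * moment_delta M n X ^ 4 / real n))"
proof -
  obtain B where B: "512000 \<le> B"
    "\<And>N. B \<le> N \<Longrightarrow> 409600 * first_weight * N^2 * exp (- N / 51200) \<le> exp (- N / 102400)"
    using exists_threshold by blast
  \<comment> \<open>Collects the coefficients that arise from \<epsilon> = b = 1 / N, a = 50000 p^2
    / N and R^2 = N / 1600 in \<open>normal_discrepancy_good_direction\<close>.\<close>
  define D where "D = 8 + 3200 * first_weight + 400000 * third_weight"
  \<comment> \<open>B settles the case of small N; the factor 25 comes from p <= 5 L.\<close>
  define C where "C = max B (25 * D)"
  have D8: "8 \<le> D" using first_weight_nonneg third_weight_nonneg by (simp add: D_def)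
  show ?thesis
  proof (intro exI[of _ C] conjI allI impI)
    show "0 < C" using B(1) by (simp add: C_def less_max_iff_disj)
    fix M :: "'a measure" and n X and \<rho> :: real
    assume n: "1 \<le> n" and \<rho>: "0 < \<rho>" "\<rho> < 1" and norm: "normalized_independent M n X"
    interpret prob_space M using norm by (simp add: normalized_independent_def)
    interpret normalized_variables M n X by unfold_locales (fact norm, fact n)
    define L where "L = max 1 (ln (1 / \<rho>))"
    define N where "N = real n / family.mean_m4"
    have L1: "1 \<le> L" by (simp add: L_def)
    have LL: "L \<le> L^2" using L1 by (simp add: power2_eq_square)
    have n0: "0 < real n" using n by simp
    have N0: "0 < N" using n0 family.one_le_mean_m4 by (simp add: N_def)
    have Nn: "N \<le> real n" using n0 family.one_le_mean_m4 by (simp add: N_def divide_le_eq)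
    have rhs: "C * L^2 * moment_delta M n X ^ 4 / real n = C * L^2 / N"
      using n0 family.one_le_mean_m4 by (simp add: moment_delta_power4 N_def field_simps)
    have sets_sphere: "sets (sphere_measure n) = sets (sphere_space n)"
      by (simp add: sphere_measure_eq[OF n])
    have "\<exists>F. F \<subseteq> unit_sphere n \<and> F \<in> sets (sphere_measure n) \<and> measure (sphere_measure n) F \<ge> 1 - \<rho> \<and>
       (\<forall>\<theta>\<in>F. normal_discrepancy M n X \<theta> \<le> C * L^2 / N)"
      (is ?G)
    proof (cases "N < B * L^2")
      case True \<comment> \<open>the claimed bound exceeds \<open>1\<close>\<close>
      interpret S: prob_space "sphere_measure n"
        using rotation_invariant_gaussian[OF n] unfolding sphere_measure_eq[OF n] rotation_invariant_prob_def by blast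
      have sp: "space (sphere_measure n) = unit_sphere n"
        by (auto simp: sphere_measure_eq[OF n] space_restrict_space space_PiM unit_sphere_def)
      have "B * L^2 \<le> C * L^2" by (intro mult_right_mono) (auto simp: C_def)
      then have "1 \<le> C * L^2 / N" using True N0 by simp
      then have "normal_discrepancy M n X \<theta> \<le> C * L^2 / N" for \<theta>
        using normal_discrepancy_le_1[of \<theta>] by linarith
      moreover have "unit_sphere n \<in> sets (sphere_measure n)" using sets.top[of "sphere_measure n"] by (simp add: sp)
      moreover have "measure (sphere_measure n) (unit_sphere n) = 1" using S.prob_space by (simp add: sp)
      ultimately show ?G
        using \<rho> by (intro exI[of _ "unit_sphere n"]) auto
    next
      case False
      then have NB: "B * L^2 \<le> N" by simp
      \<comment> \<open>The summand 3 absorbs the factor 7 of the union bound, as 7 <= exp 3; p <= 5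
        L holds because L >= 1.\<close>
      define p where "p = nat \<lceil>L\<rceil> + 3"
      have p: "1 \<le> p" "L + 3 \<le> real p" "real p \<le> 5 * L"
        using L1 by (simp_all add: p_def) linarith+
      \<comment> \<open>Since 512000 = 5 * 102400 and p <= 5 L <= 5 L^2, this yields p <= N /
        102400, the exponent that \<open>exists_threshold\<close> leaves over.\<close>
      have "512000 * L^2 \<le> B * L^2" using B(1) by (intro mult_right_mono) auto
      then have NL: "512000 * L^2 \<le> N" using NB by linarith
      have pN: "real p \<le> N / 102400" using p(3) LL NL by simp
      have "B * 1 \<le> B * L^2" using LL L1 B(1) by (intro mult_left_mono) auto
      then have BN: "B \<le> N" using NB by simp
      define R where "R = sqrt (N / 1600)"
      have R: "0 < R" "R^2 = N / 1600" using N0 by (auto simp: R_def)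
      define F where "F = family.good_directions (50000 * (real p)^2 / N) R (1 / N) (1 / N)"
      have "1 - 7 * exp (- real p) \<le> measure (sphere_measure n) F"
        unfolding F_def N_def
      proof (rule family.sphere_measure_good_directions)
        show "1 \<le> p" by (rule p)
        show "real p \<le> real n / 56" using pN Nn n0 by simp
        show "R^2 = real n / family.mean_m4 / 1600" using R(2) by (simp add: N_def)
        have "409600 * first_weight * N^2 * exp (- N / 51200) \<le> exp (- real p)"
          by (rule order_trans[OF B(2)[OF BN]]) (use pN in simp)
        then have "exp (- N / 51200) * (409600 * first_weight / (N * (1 / N)^2)) \<le> exp (- real p) * (1 / N)"
          using N0 by (simp add: field_simps power2_eq_square)
        then show "exp (- (real n / family.mean_m4) / 51200) *
           (409600 * first_weight / (real n / family.mean_m4 * (1 / (real n / family.mean_m4))^2))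
           \<le> exp (- real p) * (1 / (real n / family.mean_m4))" by (simp only: N_def)
      qed (unfold N_def[symmetric], use R N0 in auto)
      moreover have "7 * exp (- real p) \<le> \<rho>"
      proof -
        have "7 \<le> exp (3 :: real)"
        proof -
          have "(2 :: real) ^ 3 \<le> exp 1 ^ 3" using exp_ge_add_one_self[of 1] by (intro power_mono) auto
          then show ?thesis by (simp flip: exp_of_nat_mult)
        qed
        then have "7 * exp (- real p) \<le> exp 3 * exp (- real p)" by (intro mult_right_mono) auto
        also have "\<dots> \<le> exp (- L)" using p(2) by (simp flip: exp_add)
        also have "\<dots> \<le> exp (- ln (1 / \<rho>))" by (simp add: L_def)
        also have "\<dots> = \<rho>" using \<rho> by (simp add: ln_div)
        finally show ?thesis .
      qed
      ultimately have "1 - \<rho> \<le> measure (sphere_measure n) F" by linarith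
      moreover have "normal_discrepancy M n X \<theta> \<le> C * L^2 / N" if \<theta>: "\<theta> \<in> F" for \<theta>
      proof -
        have "normal_discrepancy M n X \<theta> \<le> 2 * (3 * (1 / N) + (4 * (50000 * (real p)^2 / N) * third_weight + 1 / N + first_weight / R^2))"
          by (rule normal_discrepancy_good_direction) (use \<theta> R N0 in \<open>auto simp: F_def\<close>)
        also have "\<dots> = (8 + 3200 * first_weight + 400000 * third_weight * (real p)^2) / N"
          unfolding R using N0 by (simp add: field_simps)
        also have "\<dots> \<le> (D * (real p)^2) / N"
        proof (rule divide_right_mono)
          have "1 \<le> (real p)^2" using p(1) by simp
          then have "(8 + 3200 * first_weight) * 1 \<le> (8 + 3200 * first_weight) * (real p)^2"
            using first_weight_nonneg by (intro mult_left_mono) auto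
          then show "8 + 3200 * first_weight + 400000 * third_weight * (real p)^2 \<le> D * (real p)^2"
            by (simp add: D_def algebra_simps)
        qed (use N0 in simp)
        also have "\<dots> \<le> (C * L^2) / N"
        proof (rule divide_right_mono)
          have "(real p)^2 \<le> (5 * L)^2" using p(3) by (intro power_mono) auto
          then have "D * (real p)^2 \<le> D * (25 * L^2)" using D8 by (intro mult_left_mono) (auto simp: power_mult_distrib)
          also have "\<dots> = (25 * D) * L^2" by simp
          also have "\<dots> \<le> C * L^2" by (intro mult_right_mono) (auto simp: C_def)
          finally show "D * (real p)^2 \<le> C * L^2" .
        qed (use N0 in simp)
        finally show ?thesis .
      qed
      moreover have "F \<subseteq> unit_sphere n" by (auto simp: F_def family.good_directions_def)
      moreover have "F \<in> sets (sphere_measure n)"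
        unfolding F_def sets_sphere by (rule family.good_directions_measurable)
      ultimately show ?G
        by blast
    qed
    then show "\<exists>F. F \<subseteq> unit_sphere n \<and> F \<in> sets (sphere_measure n) \<and> measure (sphere_measure n) F \<ge> 1 - \<rho> \<and>
       (\<forall>\<theta>\<in>F. normal_discrepancy M n X \<theta> \<le> C * (max 1 (ln (1 / \<rho>)))^2 * moment_delta M n X ^ 4 / real n)"
      unfolding L_def[symmetric] rhs .
  qed
qed

section \<open>Independence of the constants from the sample space\<close>

lemma transfer_to_product_space:
  fixes M :: "'a measure"
  assumes norm: "normalized_independent M n X" and n: "1 \<le> n"
  defines "P \<equiv> distr M (PiM {1..n} (\<lambda>_. borel :: real measure)) (\<lambda>\<omega>. \<lambda>j\<in>{1..n}. X j \<omega>)"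
  shows "normalized_independent P n (\<lambda>j x. x j)"
    and "moment_delta P n (\<lambda>j x. x j) = moment_delta M n X"
    and "normal_discrepancy P n (\<lambda>j x. x j) \<theta> = normal_discrepancy M n X \<theta>"
proof -
  interpret prob_space M using norm by (simp add: normalized_independent_def)
  interpret normalized_variables M n X by unfold_locales (fact norm, fact n)
  let ?B = "PiM {1..n} (\<lambda>_. borel :: real measure)"
  have V[measurable]: "(\<lambda>\<omega>. \<lambda>j\<in>{1..n}. X j \<omega>) \<in> M \<rightarrow>\<^sub>M ?B"
    using X_measurable by (intro measurable_restrict) auto
  interpret P: prob_space P unfolding P_def by (rule prob_space_distr[OF V])
  have int: "(LINT x|P. f (x j)) = (LINT \<omega>|M. f (X j \<omega>))" "integrable P (\<lambda>x. f (x j)) \<longleftrightarrow> integrable M (\<lambda>\<omega>. f (X j \<omega>))"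
    if j: "j \<in> {1..n}" and [measurable]: "f \<in> borel_measurable borel" for f :: "real \<Rightarrow> real" and j
  proof -
    have [measurable]: "(\<lambda>x. f (x j)) \<in> borel_measurable ?B" using j by measurable
    show "(LINT x|P. f (x j)) = (LINT \<omega>|M. f (X j \<omega>))"
      unfolding P_def using j by (subst integral_distr[OF V]) simp_all
    show "integrable P (\<lambda>x. f (x j)) \<longleftrightarrow> integrable M (\<lambda>\<omega>. f (X j \<omega>))"
      unfolding P_def using j by (subst integrable_distr_eq[OF V]) simp_all
  qed
  have coord: "(\<lambda>x. x j) \<in> borel_measurable P" if "j \<in> {1..n}" for j
    unfolding P_def using that by simp
  have comp: "distr P borel (\<lambda>x. x j) = distr M borel (X j)" if j: "j \<in> {1..n}" for j
  proof -
    have "distr P borel (\<lambda>x. x j) = distr M borel ((\<lambda>x. x j) \<circ> (\<lambda>\<omega>. \<lambda>j\<in>{1..n}. X j \<omega>))"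
      unfolding P_def using j by (intro distr_distr V) simp
    also have "(\<lambda>x. x j) \<circ> (\<lambda>\<omega>. \<lambda>j\<in>{1..n}. X j \<omega>) = X j" using j by (auto simp: fun_eq_iff)
    finally show ?thesis .
  qed
  \<comment> \<open>Independence means that the joint law is the product of the marginals. P already
    lives on the product space, so restricting the coordinates again gives back P, and its marginals
    are the laws of the X j.\<close>
  have "P.indep_vars (\<lambda>_. borel) (\<lambda>j x. x j) {1..n}"
  proof (subst P.indep_vars_iff_distr_eq_PiM')
    show "{1..n} \<noteq> {}" using n by simp
    show "\<And>i. i \<in> {1..n} \<Longrightarrow> P.random_variable borel (\<lambda>x. x i)" by (rule coord)
    have "distr P ?B (\<lambda>x. \<lambda>i\<in>{1..n}. x i) = distr M ?B ((\<lambda>x. \<lambda>i\<in>{1..n}. x i) \<circ> (\<lambda>\<omega>. \<lambda>j\<in>{1..n}. X j \<omega>))"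
      unfolding P_def by (intro distr_distr V) simp
    also have "\<dots> = P" unfolding P_def by (intro distr_cong) auto
    also have "P = (\<Pi>\<^sub>M i\<in>{1..n}. distr M borel (X i))"
      unfolding P_def using indep_vars_iff_distr_eq_PiM'[of "{1..n}" X "\<lambda>_. borel"] indep X_measurable n by auto
    also have "\<dots> = (\<Pi>\<^sub>M i\<in>{1..n}. distr P borel (\<lambda>x. x i))"
      by (intro PiM_cong refl comp[symmetric])
    finally show "distr P ?B (\<lambda>x. \<lambda>i\<in>{1..n}. x i) = (\<Pi>\<^sub>M i\<in>{1..n}. distr P borel (\<lambda>x. x i))" .
  qed
  then show "normalized_independent P n (\<lambda>j x. x j)"
    using norm int(1)[of _ "\<lambda>x. x"] int(1)[of _ "\<lambda>x. x^2"] int(2)[of _ "\<lambda>x. x ^ 4"]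
    by (auto simp: normalized_independent_def P.prob_space_axioms)
  show "moment_delta P n (\<lambda>j x. x j) = moment_delta M n X"
  proof -
    have "(\<Sum>j=1..n. LINT x|P. x j ^ 4) = (\<Sum>j=1..n. LINT \<omega>|M. X j \<omega> ^ 4)"
      by (rule sum.cong[OF refl int(1)]) auto
    then show ?thesis by (simp add: moment_delta_def)
  qed
  have "measure P {x \<in> space P. \<alpha> \<le> (\<Sum>j=1..n. \<theta> j * x j) \<and> (\<Sum>j=1..n. \<theta> j * x j) \<le> \<beta>} =
     measure M {\<omega> \<in> space M. \<alpha> \<le> (\<Sum>j=1..n. \<theta> j * X j \<omega>) \<and> (\<Sum>j=1..n. \<theta> j * X j \<omega>) \<le> \<beta>}" for \<alpha> \<beta>
  proof -
    have "{x \<in> space ?B. \<alpha> \<le> (\<Sum>j=1..n. \<theta> j * x j) \<and> (\<Sum>j=1..n. \<theta> j * x j) \<le> \<beta>} \<in> sets ?B"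
      by measurable
    then show ?thesis
      unfolding P_def space_distr by (subst measure_distr[OF V])
        (auto intro!: arg_cong[where f = "measure M"] simp: space_PiM)
  qed
  then show "normal_discrepancy P n (\<lambda>j x. x j) \<theta> = normal_discrepancy M n X \<theta>"
    by (simp add: normal_discrepancy_def)
qed

text \<open>Hypothesis, \<delta> and discrepancy depend on the joint law only, so the set F found
  for the coordinate functions under that law serves X itself.\<close>

lemma admissible_constant_transfer:
  assumes "admissible_constant TYPE(nat \<Rightarrow> real) K"
  shows "admissible_constant TYPE('a) K"
  unfolding admissible_constant_def
proof (intro allI impI)
  fix n and \<rho> :: real and M :: "'a measure" and X
  assume n: "1 \<le> n" and \<rho>: "0 < \<rho>" "\<rho> < 1" and norm: "normalized_independent M n X"
  note t = transfer_to_product_space[OF norm n]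
  show "\<exists>F\<subseteq>unit_sphere n. F \<in> sets (sphere_measure n) \<and> 1 - \<rho> \<le> measure (sphere_measure n) F \<and>
      (\<forall>\<theta>\<in>F. normal_discrepancy M n X \<theta> \<le> K \<rho> * moment_delta M n X ^ 4 / real n)"
    using assms[unfolded admissible_constant_def, rule_format, OF n \<rho> t(1)] unfolding t(2,3) .
qed

theorem theorem1p1:
  "(\<exists>C>0. \<exists>K::real \<Rightarrow> real.
      (\<forall>\<rho>. 0 < \<rho> \<longrightarrow> \<rho> < 1 \<longrightarrow> K \<rho> \<le> C * (max 1 (ln (1 / \<rho>)))\<^sup>2) \<and>
      admissible_constant TYPE(nat \<Rightarrow> real) K) \<and>
   (\<forall>K. admissible_constant TYPE(nat \<Rightarrow> real) K \<longrightarrow> admissible_constant TYPE('a) K)"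
proof (intro conjI allI impI)
  obtain C where C: "C > 0" and bound: "\<And>(M :: (nat \<Rightarrow> real) measure) n X \<rho>. 1 \<le> n \<Longrightarrow> 0 < \<rho> \<Longrightarrow> \<rho> < 1 \<Longrightarrow>
     normalized_independent M n X \<Longrightarrow>
     (\<exists>F. F \<subseteq> unit_sphere n \<and> F \<in> sets (sphere_measure n) \<and> measure (sphere_measure n) F \<ge> 1 - \<rho> \<and>
       (\<forall>\<theta>\<in>F. normal_discrepancy M n X \<theta> \<le> C * (max 1 (ln (1 / \<rho>)))\<^sup>2 * moment_delta M n X ^ 4 / real n))"
    using exists_admissible_constant by blast
  show "\<exists>C>0. \<exists>K::real \<Rightarrow> real.
      (\<forall>\<rho>. 0 < \<rho> \<longrightarrow> \<rho> < 1 \<longrightarrow> K \<rho> \<le> C * (max 1 (ln (1 / \<rho>)))\<^sup>2) \<and>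
      admissible_constant TYPE(nat \<Rightarrow> real) K"
    by (rule exI[of _ C], intro conjI C exI[of _ "\<lambda>\<rho>. C * (max 1 (ln (1 / \<rho>)))\<^sup>2"])
      (use bound in \<open>auto simp: admissible_constant_def\<close>)
qed (rule admissible_constant_transfer)

end
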